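(* Let $n\ge2$, and let $R$, $I$, $\mathcal M$ be as in the context. Let $I^m\subset R$ be the ideal generated by the products $X_aX_b$ over all incomparable pairs $a,b\in\mathcal M$. Then the cone $C(I,I^m)\subset\mathbb{R}^{\mathcal M}$ consists of exactly those $w$ that satisfy $w_a+w_b<w_{a\vee b}+w_{a\wedge b}$ for every diamond pair $\{a,b\}$ and $w_a+w_b<w_{p_1(a,b)}+w_{q_1(a,b)}$ for every special diamond pair $\{a,b\}$. This description is minimal: for each of these inequalities, the set of points of $\overline{C(I,I^m)}$ where it holds with equality is a facet of $\overline{C(I,I^m)}$.
   Context: Plücker setting: $R$ is the polynomial ring over $\mathbb{C}$ in the Plücker variables $X_{i_1,\ldots,i_k}$, $1\le k\le n-1$, $1\le i_1<\dots<i_k\le n$, and $I\subset R$ is the ideal of Plücker relations, i.e. the kernel of the homomorphism sending $X_{i_1,\ldots,i_k}$ to the determinant of $(z_{r,i_s})_{1\le r,s\le k}$ in $\mathbb{C}[z_{i,j}]$. The lattice $\mathcal M$ has one element $a_{i_1,\ldots,i_k}$ for each Plücker variable, with $a_{i_1,\ldots,i_k}\le a_{j_1,\ldots,j_l}$ iff $k\ge l$ and $i_r\le j_r$ for $1\le r\le l$; it is a distributive lattice, with, for $k\ge l$, meet $a_{\min(i_1,j_1),\ldots,\min(i_l,j_l),i_{l+1},\ldots,i_k}$ and join $a_{\max(i_1,j_1),\ldots,\max(i_l,j_l)}$. Write $X_a$ for the Plücker variable corresponding to $a$ and use coordinates $w_a$ on $\mathbb{R}^{\mathcal M}$. For $w$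 and a polynomial $p$, $\mathrm{in}_w p$ is the sum of the terms of $p$ of minimal $w$-weight; $\mathrm{in}_w I$ is the span of all $\mathrm{in}_w p$, $p\in I$; $C(I,J)=\{w:\mathrm{in}_wI=J\}$. A diamond pair is a two-element set $\{a,b\}$ such that $a\vee b$ covers $a$ and $b$ and both cover $a\wedge b$. Standard monomials $X_{c_1}\cdots X_{c_m}$, $c_1\le\dots\le c_m$, project to a basis of $R/I$; hence for incomparable $a,b$ there is a unique element of $I$ of the form $s(a,b)=X_aX_b-\sum_{i=0}^{m(a,b)}c_iX_{p_i(a,b)}X_{q_i(a,b)}$ with pairwise distinct pairs, $p_i<q_i$, $c_i\ne0$, indexed so that $p_0=a\wedge b$, $q_0=a\vee b$. For a diamond pair $m(a,b)=1$, so there is exactly one further term $X_{p_1(a,b)}X_{q_1(a,b)}$. A diamond pair is special if $q_1(a,b)$ covers $a\vee b$. *)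

theory Defs
  imports
    "HOL-Analysis.Analysis"
    "HOL-Library.Poly_Mapping"
    "HOL-Library.Cardinality"
    "Jordan_Normal_Form.Determinant"
begin

no_notation Matrix.vec_index (infixl \<open>$\<close> 100)

text \<open>A finitely supported map from exponent vectors to coefficients; the product is the
  convolution product of the library.\<close>

type_synonym ('v, 'a) mvpoly = "('v \<Rightarrow>\<^sub>0 nat) \<Rightarrow>\<^sub>0 'a"

definition mvar :: "'v \<Rightarrow> ('v, 'a::comm_ring_1) mvpoly" where
  "mvar v = Poly_Mapping.single (Poly_Mapping.single v 1) 1"

definition mconst :: "'a \<Rightarrow> ('v, 'a::comm_ring_1) mvpoly" where
  "mconst c = Poly_Mapping.single 0 c"

definition msubst :: "('v \<Rightarrow> ('u, 'a) mvpoly) \<Rightarrow> ('v, 'a::comm_ring_1) mvpoly \<Rightarrow> ('u, 'a) mvpoly" where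
  "msubst f p = (\<Sum>m\<in>Poly_Mapping.keys p. mconst (Poly_Mapping.lookup p m) *
      (\<Prod>v\<in>Poly_Mapping.keys m. f v ^ Poly_Mapping.lookup m v))"

lemma module_times: "Modules.module ((*) :: 'a::comm_ring_1 \<Rightarrow> 'a \<Rightarrow> 'a)"
  by unfold_locales (simp_all add: algebra_simps)

lemma vector_space_mconst:
  "Vector_Spaces.vector_space (\<lambda>(c::'a::field) (p::('v, 'a) mvpoly). mconst c * p)"
  by unfold_locales
    (simp_all add: mconst_def algebra_simps single_add mult_single flip: mult.assoc)

definition ideal_generated :: "('v, 'a::comm_ring_1) mvpoly set \<Rightarrow> ('v, 'a) mvpoly set" where
  "ideal_generated B = Modules.module.span (*) B"

definition linear_span :: "('v, 'a::field) mvpoly set \<Rightarrow> ('v, 'a) mvpoly set" where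
  "linear_span B = Modules.module.span (\<lambda>c p. mconst c * p) B"

definition monom_weight :: "real ^ 'v \<Rightarrow> ('v::finite \<Rightarrow>\<^sub>0 nat) \<Rightarrow> real" where
  "monom_weight w m = (\<Sum>v\<in>UNIV. real (Poly_Mapping.lookup m v) * w $ v)"

definition initial_part :: "real ^ 'v \<Rightarrow> ('v::finite, complex) mvpoly \<Rightarrow> ('v, complex) mvpoly" where
  "initial_part w p =
     (\<Sum>m\<in>{m \<in> Poly_Mapping.keys p. \<forall>m'\<in>Poly_Mapping.keys p. monom_weight w m \<le> monom_weight w m'}.
        Poly_Mapping.single m (Poly_Mapping.lookup p m))"

definition initial_ideal :: "real ^ 'v \<Rightarrow> ('v::finite, complex) mvpoly set \<Rightarrow> ('v, complex) mvpoly set" where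
  "initial_ideal w I = linear_span (initial_part w ` I)"

definition groebner_cone ::
    "('v::finite, complex) mvpoly set \<Rightarrow> ('v, complex) mvpoly set \<Rightarrow> (real ^ 'v) set" where
  "groebner_cone I J = {w. initial_ideal w I = J}"

text \<open>The type \<open>'n\<close> only serves to fix the number \<open>n = CARD('n) \<ge> 2\<close>. An element of
  \<open>'n plucker\<close> is a list \<open>[i\<^sub>1, \<dots>, i\<^sub>k]\<close> with \<open>1 \<le> i\<^sub>1 < \<dots> < i\<^sub>k \<le> n\<close> and \<open>1 \<le> k \<le> n - 1\<close>.
  Thus \<open>real ^ 'n plucker\<close> is the coordinate space of the lattice, and
  \<open>('n plucker, complex) mvpoly\<close> the polynomial ring in the Pluecker variables.
  List positions count from 0.\<close>

definition plucker_indices :: "nat \<Rightarrow> nat list set" where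
  "plucker_indices n = {xs. sorted_wrt (<) xs \<and> set xs \<subseteq> {1..n} \<and> 1 \<le> length xs \<and> length xs \<le> n - 1}"

typedef ('n::card2) plucker = "plucker_indices CARD('n)"
  morphisms indices Abs_plucker
proof
  show "[1] \<in> plucker_indices CARD('n)"
    using two_le_card[where 'a='n] by (simp add: plucker_indices_def)
qed

setup_lifting type_definition_plucker

lemma finite_plucker_indices: "finite (plucker_indices n)"
proof (rule finite_subset)
  show "plucker_indices n \<subseteq> {xs. set xs \<subseteq> {1..n} \<and> length xs \<le> n}"
    by (auto simp: plucker_indices_def)
  show "finite {xs. set xs \<subseteq> {1..n} \<and> length xs \<le> n}"
    by (rule finite_lists_length_le) simp
qed

instance plucker :: (card2) finite
proof
  have "finite (range (indices :: 'a plucker \<Rightarrow> nat list))"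
    using finite_plucker_indices[of "CARD('a)"] by (rule finite_subset[rotated]) (auto intro: indices)
  moreover have "inj (indices :: 'a plucker \<Rightarrow> nat list)"
    by (simp add: inj_def indices_inject)
  ultimately show "finite (UNIV :: 'a plucker set)"
    by (rule finite_imageD)
qed

text \<open>In the meet at most one of the two dropped remainders is nonempty, namely that of the longer
  list. The function \<open>map2\<close> truncates to the length of the shorter list.\<close>

definition list_meet :: "nat list \<Rightarrow> nat list \<Rightarrow> nat list" where
  "list_meet xs ys = map2 min xs ys @ drop (length ys) xs @ drop (length xs) ys"

definition list_join :: "nat list \<Rightarrow> nat list \<Rightarrow> nat list" where
  "list_join xs ys = map2 max xs ys"

lemma length_list_meet [simp]: "length (list_meet xs ys) = max (length xs) (length ys)"
  by (auto simp: list_meet_def)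

lemma length_list_join [simp]: "length (list_join xs ys) = min (length xs) (length ys)"
  by (auto simp: list_join_def)

lemma nth_list_join [simp]:
  "r < length xs \<Longrightarrow> r < length ys \<Longrightarrow> list_join xs ys ! r = max (xs ! r) (ys ! r)"
  by (simp add: list_join_def)

lemma nth_list_meet:
  "r < max (length xs) (length ys) \<Longrightarrow> list_meet xs ys ! r =
     (if r < length xs then if r < length ys then min (xs ! r) (ys ! r) else xs ! r else ys ! r)"
  by (auto simp: list_meet_def nth_append)

lemma plucker_indices_iff:
  "xs \<in> plucker_indices n \<longleftrightarrow> (\<forall>i j. i < j \<longrightarrow> j < length xs \<longrightarrow> xs ! i < xs ! j) \<and>
     (\<forall>i<length xs. 1 \<le> xs ! i \<and> xs ! i \<le> n) \<and> 1 \<le> length xs \<and> length xs \<le> n - 1"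
  by (auto simp: plucker_indices_def sorted_wrt_iff_nth_less subset_iff in_set_conv_nth)

lemma list_join_in_plucker_indices:
  assumes "xs \<in> plucker_indices n" "ys \<in> plucker_indices n"
  shows "list_join xs ys \<in> plucker_indices n"
proof -
  have "list_join xs ys ! i < list_join xs ys ! j"
    if "i < j" "j < length xs" "j < length ys" for i j
  proof -
    have "xs ! i < xs ! j" "ys ! i < ys ! j"
      using assms that unfolding plucker_indices_iff by blast+
    then show ?thesis
      using that by (auto simp: less_max_iff_disj)
  qed
  moreover have "1 \<le> list_join xs ys ! i \<and> list_join xs ys ! i \<le> n"
    if "i < length xs" "i < length ys" for i
    using assms that unfolding plucker_indices_iff by (simp add: le_max_iff_disj)
  moreover have "1 \<le> min (length xs) (length ys)" "min (length xs) (length ys) \<le> n - 1"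
    using assms unfolding plucker_indices_iff by linarith+
  ultimately show ?thesis
    unfolding plucker_indices_iff by (auto simp del: nth_list_join)
qed

lemma list_meet_in_plucker_indices:
  assumes "xs \<in> plucker_indices n" "ys \<in> plucker_indices n"
  shows "list_meet xs ys \<in> plucker_indices n"
proof -
  have "list_meet xs ys ! i < list_meet xs ys ! j"
    if "i < j" "j < max (length xs) (length ys)" for i j
  proof -
    have "i < max (length xs) (length ys)" using that by simp
    moreover have "j < length xs \<Longrightarrow> xs ! i < xs ! j" "j < length ys \<Longrightarrow> ys ! i < ys ! j"
      using assms that(1) unfolding plucker_indices_iff by blast+
    ultimately show ?thesis
      using that by (auto simp: nth_list_meet less_max_iff_disj)
  qed
  moreover have "1 \<le> list_meet xs ys ! i \<and> list_meet xs ys ! i \<le> n"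
    if "i < max (length xs) (length ys)" for i
  proof -
    have "i < length xs \<Longrightarrow> 1 \<le> xs ! i \<and> xs ! i \<le> n" "i < length ys \<Longrightarrow> 1 \<le> ys ! i \<and> ys ! i \<le> n"
      using assms unfolding plucker_indices_iff by blast+
    then show ?thesis
      using that by (auto simp: nth_list_meet less_max_iff_disj min_le_iff_disj)
  qed
  moreover have "1 \<le> max (length xs) (length ys)" "max (length xs) (length ys) \<le> n - 1"
    using assms unfolding plucker_indices_iff by linarith+
  ultimately show ?thesis
    unfolding plucker_indices_iff by simp
qed

instantiation plucker :: (card2) distrib_lattice
begin

definition less_eq_plucker :: "'a plucker \<Rightarrow> 'a plucker \<Rightarrow> bool" where
  "a \<le> b \<longleftrightarrow> length (indices b) \<le> length (indices a) \<and>
     (\<forall>r<length (indices b). indices a ! r \<le> indices b ! r)"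

definition less_plucker :: "'a plucker \<Rightarrow> 'a plucker \<Rightarrow> bool" where
  "(a::'a plucker) < b \<longleftrightarrow> a \<le> b \<and> \<not> b \<le> a"

lift_definition inf_plucker :: "'a plucker \<Rightarrow> 'a plucker \<Rightarrow> 'a plucker" is list_meet
  by (rule list_meet_in_plucker_indices)

lift_definition sup_plucker :: "'a plucker \<Rightarrow> 'a plucker \<Rightarrow> 'a plucker" is list_join
  by (rule list_join_in_plucker_indices)

instance
proof
  fix a b c :: "'a plucker"
  show "a < b \<longleftrightarrow> a \<le> b \<and> \<not> b \<le> a"
    by (rule less_plucker_def)
  show "a \<le> a"
    by (simp add: less_eq_plucker_def)
  show "a \<le> c" if "a \<le> b" "b \<le> c"
    using that unfolding less_eq_plucker_def by (meson le_trans less_le_trans)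
  show "a = b" if "a \<le> b" "b \<le> a"
  proof -
    have "indices a = indices b"
      using that unfolding less_eq_plucker_def by (intro nth_equalityI) (auto intro: le_antisym)
    then show ?thesis by (simp add: indices_inject)
  qed
  show "inf a b \<le> a" "inf a b \<le> b"
    by (auto simp: less_eq_plucker_def inf_plucker.rep_eq nth_list_meet)
  show "a \<le> inf b c" if "a \<le> b" "a \<le> c"
    using that by (auto simp: less_eq_plucker_def inf_plucker.rep_eq nth_list_meet)
  show "a \<le> sup a b" "b \<le> sup a b"
    by (auto simp: less_eq_plucker_def sup_plucker.rep_eq)
  show "sup b c \<le> a" if "b \<le> a" "c \<le> a"
    using that by (auto simp: less_eq_plucker_def sup_plucker.rep_eq)
  have "indices (sup a (inf b c)) = indices (inf (sup a b) (sup a c))"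
  proof (rule nth_equalityI)
    show "length (indices (sup a (inf b c))) = length (indices (inf (sup a b) (sup a c)))"
      by (simp add: sup_plucker.rep_eq inf_plucker.rep_eq)
    fix r assume "r < length (indices (sup a (inf b c)))"
    then have "r < length (indices a)" "r < length (indices b) \<or> r < length (indices c)"
      by (auto simp: sup_plucker.rep_eq inf_plucker.rep_eq)
    then show "indices (sup a (inf b c)) ! r = indices (inf (sup a b) (sup a c)) ! r"
      by (cases "r < length (indices b)"; cases "r < length (indices c)")
        (simp_all add: sup_plucker.rep_eq inf_plucker.rep_eq nth_list_meet less_max_iff_disj
          max_min_distrib2)
  qed
  then show "sup a (inf b c) = inf (sup a b) (sup a c)"
    by (simp add: indices_inject)
qed

end

definition covers :: "'a::order \<Rightarrow> 'a \<Rightarrow> bool" where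
  "covers b a \<longleftrightarrow> a < b \<and> \<not> (\<exists>c. a < c \<and> c < b)"

definition incomparable :: "'a::order \<Rightarrow> 'a \<Rightarrow> bool" where
  "incomparable a b \<longleftrightarrow> \<not> a \<le> b \<and> \<not> b \<le> a"

definition diamond_pair :: "'a::lattice \<Rightarrow> 'a \<Rightarrow> bool" where
  "diamond_pair a b \<longleftrightarrow> a \<noteq> b \<and> covers (sup a b) a \<and> covers (sup a b) b \<and>
     covers a (inf a b) \<and> covers b (inf a b)"

definition plucker_minor :: "'n::card2 plucker \<Rightarrow> (nat \<times> nat, complex) mvpoly" where
  "plucker_minor a = (let k = length (indices a) in
     Determinant.det (Matrix.mat k k (\<lambda>(r, s). mvar (r + 1, indices a ! s))))"

definition plucker_ideal :: "('n::card2 plucker, complex) mvpoly set" where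
  "plucker_ideal = {p. msubst plucker_minor p = 0}"

definition incomparable_ideal :: "('n::card2 plucker, complex) mvpoly set" where
  "incomparable_ideal = ideal_generated {mvar a * mvar b |a b. incomparable a b}"

text \<open>The next predicate states that \<open>X\<^sub>a X\<^sub>b - (\<Sum>i\<le>m. c\<^sub>i X\<^bsub>p i\<^esub> X\<^bsub>q i\<^esub>)\<close> is the element \<open>s(a, b)\<close>,
  indexed as required.\<close>

definition straightening ::
    "'n::card2 plucker \<Rightarrow> 'n plucker \<Rightarrow> nat \<Rightarrow> (nat \<Rightarrow> complex) \<Rightarrow>
     (nat \<Rightarrow> 'n plucker) \<Rightarrow> (nat \<Rightarrow> 'n plucker) \<Rightarrow> bool" where
  "straightening a b m c p q \<longleftrightarrow>
     (\<forall>i\<le>m. p i < q i \<and> c i \<noteq> 0) \<and> inj_on (\<lambda>i. (p i, q i)) {..m} \<and>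
     p 0 = inf a b \<and> q 0 = sup a b \<and>
     mvar a * mvar b - (\<Sum>i\<le>m. mconst (c i) * mvar (p i) * mvar (q i)) \<in> plucker_ideal"

text \<open>For a diamond pair there is exactly one further term besides that of the meet and the join;
  the next three definitions are meant for diamond pairs only.\<close>

definition further_pair :: "'n::card2 plucker \<Rightarrow> 'n plucker \<Rightarrow> 'n plucker \<times> 'n plucker" where
  "further_pair a b = (THE x. \<exists>c p q. straightening a b 1 c p q \<and> x = (p 1, q 1))"

definition p1 :: "'n::card2 plucker \<Rightarrow> 'n plucker \<Rightarrow> 'n plucker" where
  "p1 a b = fst (further_pair a b)"

definition q1 :: "'n::card2 plucker \<Rightarrow> 'n plucker \<Rightarrow> 'n plucker" where
  "q1 a b = snd (further_pair a b)"

definition special_diamond_pair :: "'n::card2 plucker \<Rightarrow> 'n plucker \<Rightarrow> bool" where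
  "special_diamond_pair a b \<longleftrightarrow> diamond_pair a b \<and> covers (q1 a b) (sup a b)"

end

theory Submission
  imports Defs
begin

text \<open>
  The initial ideal is \<open>I\<^sup>m\<close> if and only if \<open>X\<^sub>a X\<^sub>b\<close> is the initial term of \<open>s(a, b)\<close> for all incomparable
  \<open>a, b\<close>; this uses that standard monomials are independent, which holds because their diagonal
  terms are distinct. Restricting to matrices with prescribed zeros (Schubert varieties), the same
  independence shows that the terms \<open>X\<^sub>p X\<^sub>q\<close> of \<open>s(a, b)\<close> satisfy \<open>p \<le> a \<and> b\<close> and \<open>a \<or> b \<le> q\<close>.

  Hence for \<open>b < c < a \<or> b\<close> the straightening of \<open>X\<^sub>a X\<^sub>b X\<^sub>c\<close> is \<open>X\<^sub>c\<close> times that of \<open>X\<^sub>a X\<^sub>b\<close>. Computing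
  it via \<open>X\<^sub>a X\<^sub>c\<close> instead reduces the strict inequalities for \<open>(a, b)\<close> to those for the smaller
  interval of \<open>(a, c)\<close>, as long as all inequalities hold weakly; moving along a segment towards an
  interior point of the cone provides the weak inequalities. So only diamond pairs matter. Adding
  inequalities for overlapping quadruples of entries, the second inequality of a diamond pair
  follows from those of special pairs and the supermodularity of \<open>w\<close>.

  For the minimality, a function violating exactly one of the inequalities is obtained from the
  square of the rank by a correction on one diamond.
\<close>

section \<open>Polynomials and the Pluecker ideal\<close>

text \<open>Two points shape the proof. Existence of a straightening is not visible from the
  exchange relations: each of them mixes many products, and it takes a combination of several of
  them, found by inverting a matrix of subset inclusions over the complex numbers, to solve for a
  given product. And strict inequalities on diamonds do not propagate directly: rewriting
  \<open>X_a X_c\<close> inside \<open>X_a X_b X_c\<close> produces monomials that must be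
  straightened further, at pairs over which nothing is known; only if every relation holds at least
  weakly can these later steps not lower the weight. Independence is tested without a term order:
  powers of a single indeterminate are put into the matrix, with exponents so far apart that the
  diagonal term of a minor has the top degree and the degree of a product can be read off digit by
  digit. A facet is certified by one vector that violates a single inequality: adding a multiple of
  an interior point moves it onto the hyperplane, where all other inequalities are strict.\<close>

abbreviation "lookup \<equiv> Poly_Mapping.lookup"
abbreviation "keys \<equiv> Poly_Mapping.keys"
abbreviation "single \<equiv> Poly_Mapping.single"

lemma sum_single_lookup: "(\<Sum>m\<in>keys p. single m (lookup p m)) = p"
proof (rule poly_mapping_eqI)
  fix k
  show "lookup (\<Sum>m\<in>keys p. single m (lookup p m)) k = lookup p k"
    by (cases "k \<in> keys p")
      (simp_all add: lookup_sum lookup_single when_def not_in_keys_iff_lookup_eq_zero)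
qed

lemma keys_add_nat: "keys (m + m' :: 'v \<Rightarrow>\<^sub>0 nat) = keys m \<union> keys m'"
  by (auto simp: in_keys_iff lookup_add)

section \<open>Evaluation of polynomials\<close>

definition monom_val :: "('v \<Rightarrow> 'b::comm_ring_1) \<Rightarrow> ('v \<Rightarrow>\<^sub>0 nat) \<Rightarrow> 'b" where
  "monom_val f m = (\<Prod>v\<in>keys m. f v ^ lookup m v)"

lemma monom_val_superset:
  "finite A \<Longrightarrow> keys m \<subseteq> A \<Longrightarrow> monom_val f m = (\<Prod>v\<in>A. f v ^ lookup m v)"
  unfolding monom_val_def
  by (rule prod.mono_neutral_left) (auto simp: not_in_keys_iff_lookup_eq_zero)

lemma monom_val_add: "monom_val f (m + m') = monom_val f m * monom_val f m'"
proof -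
  let ?A = "keys m \<union> keys m'"
  have "monom_val f (m + m') = (\<Prod>v\<in>?A. f v ^ lookup (m + m') v)"
    by (rule monom_val_superset) (auto simp: keys_add_nat)
  also have "\<dots> = monom_val f m * monom_val f m'"
    by (simp add: monom_val_superset[of ?A] lookup_add power_add prod.distrib)
  finally show ?thesis .
qed

lemma monom_val_zero [simp]: "monom_val f 0 = 1"
  and monom_val_single [simp]: "monom_val f (single v k) = f v ^ k"
  by (simp_all add: monom_val_def)

text \<open>Two instances are needed: with \<open>mconst\<close> the map \<open>extend\<close> is
  the substitution \<open>msubst\<close>, and with the constants of \<open>complex poly\<close> it
  evaluates minors at matrices over univariate polynomials, where degrees can be compared.\<close>

locale coefficient_hom =
  fixes \<phi> :: "'a::comm_ring_1 \<Rightarrow> 'b::comm_ring_1"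
  assumes add: "\<phi> (x + y) = \<phi> x + \<phi> y"
    and mult: "\<phi> (x * y) = \<phi> x * \<phi> y"
    and one: "\<phi> 1 = 1"
begin

lemma zero: "\<phi> 0 = 0"
  using add[of 0 0] by simp

definition extend :: "('v \<Rightarrow> 'b) \<Rightarrow> ('v, 'a) mvpoly \<Rightarrow> 'b" where
  "extend f p = (\<Sum>m\<in>keys p. \<phi> (lookup p m) * monom_val f m)"

lemma extend_zero [simp]: "extend f 0 = 0"
  by (simp add: extend_def)

lemma extend_add: "extend f (p + q) = extend f p + extend f q"
  unfolding extend_def
  by (rule setsum_keys_plus_distrib) (simp_all add: zero add algebra_simps)

lemma extend_sum: "extend f (sum g A) = (\<Sum>x\<in>A. extend f (g x))"
  by (induction A rule: infinite_finite_induct) (simp_all add: extend_add)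

lemma extend_uminus: "extend f (- p) = - extend f p"
proof -
  have "extend f (- p) + extend f p = 0"
    by (simp flip: extend_add)
  then show ?thesis by (simp add: eq_neg_iff_add_eq_0)
qed

lemma extend_diff: "extend f (p - q) = extend f p - extend f q"
  using extend_add[of f p "- q"] by (simp add: extend_uminus)

lemma extend_single: "extend f (single m c) = \<phi> c * monom_val f m"
  by (cases "c = 0") (simp_all add: extend_def zero)

lemma extend_mult: "extend f (p * q) = extend f p * extend f q"
proof -
  have "p * q = (\<Sum>m\<in>keys p. single m (lookup p m)) * (\<Sum>m\<in>keys q. single m (lookup q m))"
    by (simp add: sum_single_lookup)
  also have "\<dots> = (\<Sum>m\<in>keys p. \<Sum>m'\<in>keys q. single (m + m') (lookup p m * lookup q m'))"
    by (simp add: sum_product mult_single)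
  finally have "extend f (p * q) =
      (\<Sum>m\<in>keys p. \<Sum>m'\<in>keys q. (\<phi> (lookup p m) * monom_val f m) * (\<phi> (lookup q m') * monom_val f m'))"
    by (simp add: extend_sum extend_single mult monom_val_add mult_ac)
  then show ?thesis
    by (simp add: extend_def sum_product)
qed

lemma extend_one [simp]: "extend f 1 = 1"
  using extend_single[of f 0 1] by (simp add: one)

lemma extend_power: "extend f (p ^ k) = extend f p ^ k"
  by (induction k) (simp_all add: extend_mult)

lemma extend_prod: "extend f (prod g A) = (\<Prod>x\<in>A. extend f (g x))"
  by (induction A rule: infinite_finite_induct) (simp_all add: extend_mult)

lemma extend_mconst [simp]: "extend f (mconst c) = \<phi> c"
  by (simp add: mconst_def extend_single)

lemma extend_mvar [simp]: "extend f (mvar v) = f v"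
  by (simp add: mvar_def extend_single one)

end

interpretation const_hom: coefficient_hom "mconst :: 'a::comm_ring_1 \<Rightarrow> ('u, 'a) mvpoly"
  by unfold_locales (simp_all add: mconst_def single_add mult_single)

lemma msubst_eq_extend: "msubst = const_hom.extend"
  by (intro ext) (simp add: msubst_def const_hom.extend_def monom_val_def)

lemma (in coefficient_hom) extend_msubst:
  "extend z (msubst f p) = extend (\<lambda>v. extend z (f v)) p"
proof -
  have "extend z (msubst f p) =
      (\<Sum>m\<in>keys p. \<phi> (lookup p m) * (\<Prod>v\<in>keys m. extend z (f v) ^ lookup m v))"
    by (simp add: msubst_def extend_sum extend_mult extend_prod extend_power)
  then show ?thesis
    by (simp add: extend_def monom_val_def)
qed

lemma mconst_mult_single: "mconst c * single m d = single m (c * d)"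
  by (simp add: mconst_def mult_single)

lemma lookup_mconst_mult [simp]: "lookup (mconst c * p) m = c * lookup p m"
proof -
  have "mconst c * p = (\<Sum>k\<in>keys p. single k (c * lookup p k))"
    by (subst sum_single_lookup[of p, symmetric])
      (simp add: sum_distrib_left mconst_mult_single)
  then show ?thesis
    by (cases "m \<in> keys p")
      (simp_all add: lookup_sum lookup_single when_def not_in_keys_iff_lookup_eq_zero)
qed

lemma keys_mconst_mult: "keys (mconst c * p) \<subseteq> keys p"
  by (auto simp: in_keys_iff)

lemma mconst_0 [simp]: "mconst 0 = 0"
  and mconst_1 [simp]: "mconst 1 = 1"
  by (simp_all add: mconst_def)

definition pair_monom :: "'v \<Rightarrow> 'v \<Rightarrow> 'v \<Rightarrow>\<^sub>0 nat" where
  "pair_monom a b = single a 1 + single b 1"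

lemma mvar_mult_mvar: "mvar a * mvar b = single (pair_monom a b) 1"
  by (simp add: mvar_def mult_single pair_monom_def)

lemma keys_pair_monom: "keys (pair_monom a b) = {a, b}"
  by (simp add: pair_monom_def keys_add_nat insert_commute)

lemma keys_sumE:
  assumes "k \<in> keys (sum g A)"
  obtains x where "x \<in> A" "k \<in> keys (g x)"
  using subsetD[OF keys_sum assms] by blast

lemma keys_diffE:
  assumes "k \<in> keys (f - g)"
  obtains "k \<in> keys f" | "k \<in> keys g"
  using subsetD[OF keys_diff assms] by blast

section \<open>The Pluecker ideal and the monomial ideal of incomparable pairs\<close>

lemma plucker_ideal_zero: "0 \<in> plucker_ideal"
  by (simp add: plucker_ideal_def msubst_eq_extend)

lemma plucker_ideal_add: "p \<in> plucker_ideal \<Longrightarrow> q \<in> plucker_ideal \<Longrightarrow> p + q \<in> plucker_ideal"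
  by (simp add: plucker_ideal_def msubst_eq_extend const_hom.extend_add)

lemma plucker_ideal_diff: "p \<in> plucker_ideal \<Longrightarrow> q \<in> plucker_ideal \<Longrightarrow> p - q \<in> plucker_ideal"
  by (simp add: plucker_ideal_def msubst_eq_extend const_hom.extend_diff)

lemma plucker_ideal_mult: "p \<in> plucker_ideal \<Longrightarrow> r * p \<in> plucker_ideal"
  by (simp add: plucker_ideal_def msubst_eq_extend const_hom.extend_mult)

lemma plucker_ideal_sum: "(\<And>x. x \<in> A \<Longrightarrow> g x \<in> plucker_ideal) \<Longrightarrow> sum g A \<in> plucker_ideal"
  by (induction A rule: infinite_finite_induct) (auto intro: plucker_ideal_zero plucker_ideal_add)

definition standard :: "('v::order \<Rightarrow>\<^sub>0 nat) \<Rightarrow> bool" where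
  "standard m \<longleftrightarrow> (\<forall>a\<in>keys m. \<forall>b\<in>keys m. \<not> incomparable a b)"

lemma not_standardE:
  assumes "\<not> standard m"
  obtains a b u where "incomparable a b" "m = u + pair_monom a b"
proof -
  obtain a b where ab: "a \<in> keys m" "b \<in> keys m" "incomparable a b"
    using assms by (auto simp: standard_def)
  then have "a \<noteq> b" by (auto simp: incomparable_def)
  have "m = (m - pair_monom a b) + pair_monom a b"
  proof (rule poly_mapping_eqI)
    fix k
    have "lookup m a \<ge> 1" "lookup m b \<ge> 1" using ab by (auto simp: in_keys_iff)
    then show "lookup m k = lookup ((m - pair_monom a b) + pair_monom a b) k"
      using \<open>a \<noteq> b\<close> by (auto simp: pair_monom_def lookup_add lookup_minus lookup_single when_def)
  qed
  then show ?thesis using ab that by blast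
qed

lemma not_standard_add: "\<not> standard m' \<Longrightarrow> \<not> standard (m + m')"
  by (auto simp: standard_def keys_add_nat)

text \<open>The ideal is generated by monomials, so membership is decided monomial by monomial;
  \<open>not_standardE\<close> splits a generator off each nonstandard monomial.\<close>

lemma incomparable_ideal_iff: "p \<in> incomparable_ideal \<longleftrightarrow> (\<forall>m\<in>keys p. \<not> standard m)"
proof
  interpret M: Modules.module "(*) :: ('a plucker, complex) mvpoly \<Rightarrow> _ \<Rightarrow> _"
    by (rule module_times)
  let ?G = "{mvar a * mvar b |a b :: 'a plucker. incomparable a b} :: ('a plucker, complex) mvpoly set"
  show "\<forall>m\<in>keys p. \<not> standard m" if "p \<in> incomparable_ideal"
  proof -
    have "p \<in> M.span ?G"
      using that by (simp add: incomparable_ideal_def ideal_generated_def)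
    then show ?thesis
    proof (induction rule: M.span_induct_alt)
      case base
      then show ?case by simp
    next
      case (step c x y)
      obtain a b where x: "x = mvar a * mvar b" and "incomparable a b" using step(1) by blast
      then have "\<forall>m\<in>keys x. \<not> standard m"
        by (auto simp: mvar_mult_mvar standard_def keys_pair_monom)
      then have "\<forall>m\<in>keys (c * x). \<not> standard m"
        using keys_mult[of c x] not_standard_add by blast
      then show ?case
        using step(2) Poly_Mapping.keys_add[of "c * x" y] by blast
    qed
  qed
  show "p \<in> incomparable_ideal" if p: "\<forall>m\<in>keys p. \<not> standard m"
  proof -
    have "single m (lookup p m) \<in> M.span ?G" if m: "m \<in> keys p" for m
    proof -
      obtain a b u where ab: "incomparable a b" "m = u + pair_monom a b"
        using not_standardE p m by blast
      have "single m (lookup p m) = single u (lookup p m) * (mvar a * mvar b)"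
        by (simp add: ab(2) mvar_mult_mvar mult_single)
      moreover have "single u (lookup p m) * (mvar a * mvar b) \<in> M.span ?G"
        using ab(1) by (intro M.span_scale M.span_base) blast
      ultimately show ?thesis by simp
    qed
    then have "(\<Sum>m\<in>keys p. single m (lookup p m)) \<in> M.span ?G"
      by (rule M.span_sum)
    then show ?thesis
      by (simp add: sum_single_lookup incomparable_ideal_def ideal_generated_def)
  qed
qed

lemma lookup_initial_part:
  "lookup (initial_part w p) m =
     (if \<forall>m'\<in>keys p. monom_weight w m \<le> monom_weight w m' then lookup p m else 0)"
proof -
  let ?M = "{m \<in> keys p. \<forall>m'\<in>keys p. monom_weight w m \<le> monom_weight w m'}"
  have fin: "finite ?M" by simp
  have "lookup (initial_part w p) m = (\<Sum>k\<in>?M. (lookup p k when k = m))"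
    by (simp add: initial_part_def lookup_sum lookup_single)
  also have "\<dots> = (if m \<in> ?M then lookup p m else 0)"
    using fin by (simp add: when_def)
  finally show ?thesis by (auto simp: in_keys_iff)
qed

lemma monom_weight_add: "monom_weight w (m + m') = monom_weight w m + monom_weight w m'"
  by (simp add: monom_weight_def lookup_add algebra_simps sum.distrib)

lemma monom_weight_single [simp]: "monom_weight w (single a k) = real k * w $ a"
proof -
  have "monom_weight w (single a k) = (\<Sum>v\<in>UNIV. if a = v then real k * w $ v else 0)"
    unfolding monom_weight_def by (intro sum.cong) (auto simp: lookup_single when_def)
  then show ?thesis by simp
qed

lemma linear_span_subset_incomparable_ideal:
  assumes "B \<subseteq> incomparable_ideal"
  shows "linear_span B \<subseteq> incomparable_ideal"
proof
  interpret V: Vector_Spaces.vector_space "\<lambda>c (p :: ('a plucker, complex) mvpoly). mconst c * p"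
    by (rule vector_space_mconst)
  fix p assume "p \<in> linear_span B"
  then have "p \<in> V.span B" by (simp add: linear_span_def)
  then show "p \<in> incomparable_ideal"
  proof (induction rule: V.span_induct_alt)
    case base
    then show ?case by (simp add: incomparable_ideal_iff)
  next
    case (step c x y)
    then have "x \<in> incomparable_ideal" using assms by blast
    then show ?case
      using step(2) Poly_Mapping.keys_add[of "mconst c * x" y] keys_mconst_mult[of c x]
      unfolding incomparable_ideal_iff by blast
  qed
qed

lemma incomparable_ideal_subset_linear_span:
  assumes "\<And>m. \<not> standard m \<Longrightarrow> single m 1 \<in> linear_span B"
  shows "incomparable_ideal \<subseteq> linear_span B"
proof
  interpret V: Vector_Spaces.vector_space "\<lambda>c (p :: ('a plucker, complex) mvpoly). mconst c * p"
    by (rule vector_space_mconst)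
  fix p :: "('a plucker, complex) mvpoly"
  assume "p \<in> incomparable_ideal"
  then have "(\<Sum>m\<in>keys p. mconst (lookup p m) * single m 1) \<in> V.span B"
    using assms by (intro V.span_sum V.span_scale) (auto simp: incomparable_ideal_iff linear_span_def)
  then show "p \<in> linear_span B"
    by (simp add: linear_span_def mconst_mult_single sum_single_lookup)
qed

section \<open>Exchange relations\<close>

definition remove_nth :: "nat \<Rightarrow> 'a list \<Rightarrow> 'a list" where
  "remove_nth j xs = take j xs @ drop (Suc j) xs"

lemma length_remove_nth [simp]: "j < length xs \<Longrightarrow> length (remove_nth j xs) = length xs - 1"
  by (simp add: remove_nth_def)

lemma nth_remove_nth:
  "j < length xs \<Longrightarrow> s < length xs - 1 \<Longrightarrow> remove_nth j xs ! s = xs ! (if s < j then s else Suc s)"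
  by (auto simp: remove_nth_def nth_append)

definition leading_minor :: "(nat \<times> nat \<Rightarrow> 'a::comm_ring_1) \<Rightarrow> nat list \<Rightarrow> 'a" where
  "leading_minor z xs =
     Determinant.det (Matrix.mat (length xs) (length xs) (\<lambda>(r, s). z (r + 1, xs ! s)))"

text \<open>A copy of row \<open>r0 + 1\<close> is put on top of the first
  \<open>length xs - 1\<close> rows, among which it already occurs; the vanishing determinant is
  expanded along the copy.\<close>

lemma leading_minor_row_relation:
  assumes "Suc r0 < length xs"
  shows "(\<Sum>s<length xs. (-1) ^ s * z (r0 + 1, xs ! s) * leading_minor z (remove_nth s xs)) = 0"
proof -
  let ?n = "length xs"
  let ?A = "Matrix.mat ?n ?n (\<lambda>(r, s). z (if r = 0 then r0 + 1 else r, xs ! s))"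
  have "0 < ?n" using assms by linarith
  have "Determinant.det ?A = 0"
    by (rule det_identical_rows[of _ ?n 0 "Suc r0"]) (use assms \<open>0 < ?n\<close> in \<open>auto simp: row_def intro!: eq_vecI\<close>)
  moreover have "Determinant.det ?A = (\<Sum>s<?n. ?A $$ (0, s) * cofactor ?A 0 s)"
    by (rule laplace_expansion_row) (use assms in auto)
  moreover have "?A $$ (0, s) * cofactor ?A 0 s =
      (-1) ^ s * z (r0 + 1, xs ! s) * leading_minor z (remove_nth s xs)" if "s < ?n" for s
  proof -
    have "mat_delete ?A 0 s = Matrix.mat (?n - 1) (?n - 1) (\<lambda>(r, t). z (r + 1, remove_nth s xs ! t))"
      using that by (intro eq_matI) (auto simp: mat_delete_def nth_remove_nth)
    then show ?thesis
      using that \<open>0 < ?n\<close> by (simp add: cofactor_def leading_minor_def)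
  qed
  ultimately show ?thesis by simp
qed

text \<open>These are the cofactors in the expansion of an initial minor along a column: one of the
  first \<open>length xs + 1\<close> rows, namely \<open>r0 + 1\<close>, is skipped.\<close>

definition gap_minor :: "(nat \<times> nat \<Rightarrow> 'a::comm_ring_1) \<Rightarrow> nat \<Rightarrow> nat list \<Rightarrow> 'a" where
  "gap_minor z r0 xs = Determinant.det (Matrix.mat (length xs) (length xs)
     (\<lambda>(r, s). z ((if r < r0 then r else Suc r) + 1, xs ! s)))"

lemma leading_minor_column_expansion:
  assumes "j < length xs"
  shows "leading_minor z xs =
    (\<Sum>r<length xs. z (r + 1, xs ! j) * ((-1) ^ (r + j) * gap_minor z r (remove_nth j xs)))"
proof -
  let ?n = "length xs"
  let ?A = "Matrix.mat ?n ?n (\<lambda>(r, s). z (r + 1, xs ! s))"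
  have "Determinant.det ?A = (\<Sum>r<?n. ?A $$ (r, j) * cofactor ?A r j)"
    by (rule laplace_expansion_column) (use assms in auto)
  moreover have "?A $$ (r, j) * cofactor ?A r j =
      z (r + 1, xs ! j) * ((-1) ^ (r + j) * gap_minor z r (remove_nth j xs))" if "r < ?n" for r
  proof -
    have "mat_delete ?A r j = Matrix.mat (?n - 1) (?n - 1)
        (\<lambda>(r', t). z ((if r' < r then r' else Suc r') + 1, remove_nth j xs ! t))"
      using that assms by (intro eq_matI) (auto simp: mat_delete_def nth_remove_nth)
    then show ?thesis
      using that assms by (simp add: cofactor_def gap_minor_def)
  qed
  ultimately show ?thesis by (simp add: leading_minor_def)
qed

text \<open>Expansion of the minor of \<open>i # ys\<close> along its first column; it vanishes
  because the column \<open>i\<close> occurs twice.\<close>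

lemma gap_minor_column_relation:
  assumes "i \<in> set ys"
  shows "(\<Sum>r<Suc (length ys). z (r + 1, i) * ((-1) ^ r * gap_minor z r ys)) = 0"
proof -
  obtain s where s: "s < length ys" "ys ! s = i" using assms by (auto simp: in_set_conv_nth)
  have "leading_minor z (i # ys) = 0"
    unfolding leading_minor_def
    by (rule det_identical_columns[of _ "Suc (length ys)" 0 "Suc s"])
      (use s in \<open>auto simp: col_def intro!: eq_vecI\<close>)
  then show ?thesis
    using leading_minor_column_expansion[of 0 "i # ys" z] by (simp add: remove_nth_def)
qed

section \<open>Index sets and their sorted lists\<close>

abbreviation "slist \<equiv> sorted_list_of_set :: nat set \<Rightarrow> nat list"

lemma slist_split:
  assumes "finite A" "i \<in> A"
  shows "slist A = slist {x\<in>A. x < i} @ i # slist {x\<in>A. i < x}"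
proof (rule sorted_distinct_set_unique)
  show "sorted (slist {x \<in> A. x < i} @ i # slist {x \<in> A. i < x})"
    using assms by (auto simp: sorted_append)
  show "set (slist A) = set (slist {x \<in> A. x < i} @ i # slist {x \<in> A. i < x})"
    using assms by auto
qed (use assms in auto)

lemma slist_nth_rank: "finite A \<Longrightarrow> i \<in> A \<Longrightarrow> slist A ! card {x\<in>A. x < i} = i"
  by (simp add: slist_split nth_append)

lemma slist_remove:
  assumes "finite A" "i \<in> A"
  shows "remove_nth (card {x\<in>A. x < i}) (slist A) = slist (A - {i})"
proof (rule sorted_distinct_set_unique)
  show "sorted (remove_nth (card {x \<in> A. x < i}) (slist A))"
    "distinct (remove_nth (card {x \<in> A. x < i}) (slist A))"
    "set (remove_nth (card {x \<in> A. x < i}) (slist A)) = set (slist (A - {i}))"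
    using assms by (auto simp: slist_split remove_nth_def sorted_append)
qed auto

lemma card_rank_less: "finite A \<Longrightarrow> i \<in> A \<Longrightarrow> card {x\<in>A. x < (i::nat)} < card A"
  by (rule psubset_card_mono) auto

lemma bij_betw_rank: "finite A \<Longrightarrow> bij_betw (\<lambda>i::nat. card {x\<in>A. x < i}) A {..<card A}"
proof -
  assume A: "finite A"
  have inj: "inj_on (\<lambda>i. card {x\<in>A. x < i}) A"
    by (rule inj_on_inverseI[where g = "\<lambda>j. slist A ! j"]) (use slist_nth_rank[OF A] in auto)
  moreover have "(\<lambda>i. card {x\<in>A. x < i}) ` A \<subseteq> {..<card A}"
    using card_rank_less[OF A] by auto
  ultimately have "(\<lambda>i. card {x\<in>A. x < i}) ` A = {..<card A}"
    by (intro card_subset_eq) (simp_all add: card_image)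
  then show ?thesis using inj by (simp add: bij_betw_def)
qed

text \<open>The number of elements of \<open>J\<close> below \<open>i\<close> is the position of
  \<open>i\<close> in the sorted list, so the sign on the left cancels the column part of the
  cofactor signs.\<close>

lemma leading_minor_set_expansion:
  assumes "finite J" "i \<notin> J"
  shows "(-1) ^ card {x\<in>J. x < i} * leading_minor z (slist (insert i J)) =
    (\<Sum>r<Suc (card J). z (r + 1, i) * ((-1) ^ r * gap_minor z r (slist J)))"
proof -
  let ?j = "card {x\<in>J. x < i}"
  have eq: "{x \<in> insert i J. x < i} = {x\<in>J. x < i}" by auto
  have "?j < length (slist (insert i J))"
    using card_rank_less[of "insert i J" i] assms unfolding eq by simp
  note exp = leading_minor_column_expansion[OF this, of z]
  have "slist (insert i J) ! ?j = i" "remove_nth ?j (slist (insert i J)) = slist J"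
    using slist_nth_rank[of "insert i J" i] slist_remove[of "insert i J" i] assms unfolding eq by auto
  then have "leading_minor z (slist (insert i J)) =
      (\<Sum>r<Suc (card J). z (r + 1, i) * ((-1) ^ (r + ?j) * gap_minor z r (slist J)))"
    using exp assms by simp
  moreover have "(-1) ^ ?j * ((-1) ^ ?j * x) = x" for x :: 'a
    by (simp flip: mult.assoc power_add)
  ultimately show ?thesis
    by (simp add: sum_distrib_left power_add algebra_simps)
qed

text \<open>The second minor is expanded along its column \<open>i\<close>. The terms with
  \<open>i\<close> in both sets can then be added, since there the expansion vanishes by
  \<open>gap_minor_column_relation\<close>. Summing over \<open>i\<close> first gives, for each row
  up to \<open>card J + 1\<close>, an instance of \<open>leading_minor_row_relation\<close>; the
  cardinality hypothesis says that all these rows occur in the minors of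
  \<open>I - {i}\<close>.\<close>

lemma minor_exchange:
  fixes z :: "nat \<times> nat \<Rightarrow> 'a::comm_ring_1"
  assumes fin: "finite I" "finite J" and card: "card J + 2 \<le> card I"
  shows "(\<Sum>i\<in>I - J. (-1) ^ (card {x\<in>I. x < i} + card {x\<in>J. x < i}) *
    leading_minor z (slist (I - {i})) * leading_minor z (slist (insert i J))) = 0"
proof -
  let ?E = "\<lambda>i. \<Sum>r<Suc (card J). z (r + 1, i) * ((-1) ^ r * gap_minor z r (slist J))"
  let ?M = "\<lambda>i. (-1) ^ card {x\<in>I. x < i} * leading_minor z (slist (I - {i}))"
  have "(\<Sum>i\<in>I - J. (-1) ^ (card {x\<in>I. x < i} + card {x\<in>J. x < i}) *
      leading_minor z (slist (I - {i})) * leading_minor z (slist (insert i J))) =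
      (\<Sum>i\<in>I - J. ?M i * ?E i)"
  proof (intro sum.cong refl)
    fix i assume "i \<in> I - J"
    then have "?E i = (-1) ^ card {x\<in>J. x < i} * leading_minor z (slist (insert i J))"
      by (intro leading_minor_set_expansion[OF fin(2), symmetric]) auto
    then show "(-1) ^ (card {x\<in>I. x < i} + card {x\<in>J. x < i}) * leading_minor z (slist (I - {i})) *
        leading_minor z (slist (insert i J)) = ?M i * ?E i"
      by (simp only: power_add mult_ac)
  qed
  also have "\<dots> = (\<Sum>i\<in>I. ?M i * ?E i)"
  proof (rule sum.mono_neutral_left)
    show "\<forall>i\<in>I - (I - J). ?M i * ?E i = 0"
      using gap_minor_column_relation[of _ "slist J" z] fin by (auto simp del: sum.lessThan_Suc)
  qed (use fin in auto)
  also have "\<dots> = (\<Sum>r<Suc (card J). (-1) ^ r * gap_minor z r (slist J) * (\<Sum>i\<in>I. ?M i * z (r + 1, i)))"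
    by (simp only: sum_distrib_left, subst sum.swap) (simp add: mult_ac del: sum.lessThan_Suc)
  also have "\<dots> = 0"
  proof (rule sum.neutral, rule ballI)
    fix r assume r: "r \<in> {..<Suc (card J)}"
    have "(\<Sum>i\<in>I. ?M i * z (r + 1, i)) = (\<Sum>s<card I. (-1) ^ s * z (r + 1, slist I ! s) *
        leading_minor z (remove_nth s (slist I)))"
      using fin by (subst sum.reindex_bij_betw[OF bij_betw_rank[OF fin(1)], symmetric])
        (auto intro!: sum.cong simp: slist_nth_rank slist_remove mult_ac)
    also have "\<dots> = 0"
      using leading_minor_row_relation[of r "slist I" z] r card fin by simp
    finally show "(-1) ^ r * gap_minor z r (slist J) * (\<Sum>i\<in>I. ?M i * z (r + 1, i)) = 0"
      by simp
  qed
  finally show ?thesis .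
qed

section \<open>Exchange relations in the Pluecker ideal\<close>

definition plk :: "nat set \<Rightarrow> 'n::card2 plucker" where
  "plk A = Abs_plucker (slist A)"

definition plk_set :: "'n::card2 itself \<Rightarrow> nat set \<Rightarrow> bool" where
  "plk_set _ A \<longleftrightarrow> A \<subseteq> {1..CARD('n)} \<and> 1 \<le> card A \<and> card A \<le> CARD('n) - 1"

lemma indices_plk:
  assumes "plk_set TYPE('n::card2) A"
  shows "indices (plk A :: 'n plucker) = slist A"
proof -
  have "finite A" using assms by (auto simp: plk_set_def intro: finite_subset)
  then have "slist A \<in> plucker_indices CARD('n)"
    using assms by (auto simp: plucker_indices_def plk_set_def)
  then show ?thesis by (simp add: plk_def Abs_plucker_inverse)
qed

lemma sorted_indices: "sorted_wrt (<) (indices a)"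
  and set_indices_subset: "set (indices (a :: 'n::card2 plucker)) \<subseteq> {1..CARD('n)}"
  and length_indices: "1 \<le> length (indices a)" "length (indices a) \<le> CARD('n) - 1"
  using indices[of a] by (auto simp: plucker_indices_def)

lemma distinct_indices: "distinct (indices a)"
  using sorted_indices[of a] by (simp add: strict_sorted_iff)

lemma plk_set_indices: "plk_set TYPE('n::card2) (set (indices (a :: 'n plucker)))"
  using set_indices_subset[of a] length_indices[of a]
  by (simp add: plk_set_def distinct_card[OF distinct_indices])

lemma slist_set_indices: "slist (set (indices a)) = indices a"
  using sorted_indices[of a] distinct_indices[of a]
  by (simp add: sorted_list_of_set_sort_remdups distinct_remdups_id sorted_sort_id strict_sorted_iff)

lemma plk_indices [simp]: "plk (set (indices a)) = a"
  by (simp add: plk_def slist_set_indices indices_inverse)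

lemma plucker_minor_eq: "plucker_minor a = leading_minor mvar (indices a)"
  by (simp add: plucker_minor_def leading_minor_def Let_def)

lemma plucker_exchange:
  assumes sub: "I \<subseteq> {1..CARD('n)}" "J \<subseteq> {1..CARD('n)}" and card: "card J + 2 \<le> card I"
  shows "(\<Sum>i\<in>I - J. mconst ((-1) ^ (card {x\<in>I. x < i} + card {x\<in>J. x < i})) *
    (mvar (plk (I - {i})) * mvar (plk (insert i J)))) \<in> (plucker_ideal :: ('n::card2 plucker, complex) mvpoly set)"
proof -
  have fin: "finite I" "finite J" using sub by (auto intro: finite_subset)
  have "card I \<le> CARD('n)" using card_mono[OF _ sub(1)] by simp
  have ok: "plk_set TYPE('n) (I - {i})" "plk_set TYPE('n) (insert i J)" if "i \<in> I - J" for i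
    using that sub card fin \<open>card I \<le> CARD('n)\<close> by (auto simp: plk_set_def)
  have sgn: "mconst ((-1) ^ k) = ((-1) ^ k :: (nat \<times> nat, complex) mvpoly)" for k
    by (induction k) (simp_all add: mconst_def single_uminus)
  show ?thesis
    using minor_exchange[OF fin card, of "mvar :: _ \<Rightarrow> (nat \<times> nat, complex) mvpoly"] ok
    by (simp add: plucker_ideal_def msubst_eq_extend const_hom.extend_sum const_hom.extend_mult
        plucker_minor_eq indices_plk sgn mult.assoc cong: sum.cong_simp)
qed

text \<open>The sign of the exchange of \<open>i\<close> only depends on the rank of \<open>i\<close> in the symmetric difference
  \<open>D\<close> of the two index sets, so it can be absorbed into the products.\<close>

definition rank_sign :: "nat set \<Rightarrow> nat \<Rightarrow> complex" where
  "rank_sign D i = (-1) ^ card {x\<in>D. x < i}"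

definition twisted_product :: "nat set \<Rightarrow> nat set \<Rightarrow> nat set \<Rightarrow> ('n::card2 plucker, complex) mvpoly" where
  "twisted_product S D C = mconst (\<Prod>i\<in>C. rank_sign D i) * (mvar (plk (S \<union> (D - C))) * mvar (plk (S \<union> C)))"

text \<open>This is \<open>plucker_exchange\<close> for the index sets
  \<open>S \<union> (D - J)\<close> and \<open>S \<union> J\<close>. The elements of
  \<open>S\<close> below \<open>i\<close> are counted in both exponents of the sign and cancel; what
  remains is the rank of \<open>i\<close> in \<open>D\<close>.\<close>

lemma twisted_exchange:
  assumes sub: "S \<subseteq> {1..CARD('n)}" "D \<subseteq> {1..CARD('n)}" and disj: "S \<inter> D = {}"
    and J: "J \<subseteq> D" and card: "2 * card J + 2 \<le> card D"
  shows "(\<Sum>i\<in>D - J. twisted_product S D (insert i J)) \<in> (plucker_ideal :: ('n::card2 plucker, complex) mvpoly set)"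
proof -
  let ?I = "S \<union> (D - J)" and ?J = "S \<union> J"
  have fin: "finite S" "finite D" "finite J" using sub J by (auto intro: finite_subset)
  have "card ?I = card S + (card D - card J)" "card ?J = card S + card J"
    using fin disj J by (auto simp: card_Diff_subset intro!: card_Un_disjoint[THEN trans])
  then have "card ?J + 2 \<le> card ?I" using card by simp
  from plucker_exchange[OF _ _ this, where 'n='n]
  have ex: "(\<Sum>i\<in>?I - ?J. mconst ((-1) ^ (card {x\<in>?I. x < i} + card {x\<in>?J. x < i})) *
    (mvar (plk (?I - {i})) * mvar (plk (insert i ?J)))) \<in> (plucker_ideal :: ('n plucker, complex) mvpoly set)"
    using sub J by blast
  have "(\<Sum>i\<in>D - J. twisted_product S D (insert i J)) =
    mconst (\<Prod>i\<in>J. rank_sign D i) * (\<Sum>i\<in>?I - ?J. mconst ((-1) ^ (card {x\<in>?I. x < i} + card {x\<in>?J. x < i})) *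
    (mvar (plk (?I - {i})) * mvar (plk (insert i ?J)) :: ('n plucker, complex) mvpoly))"
    unfolding sum_distrib_left
  proof (rule sum.cong)
    show "D - J = ?I - ?J" using disj by auto
    fix i assume "i \<in> ?I - ?J"
    then have i: "i \<in> D" "i \<notin> J" "i \<notin> S" by auto
    have "{x\<in>?I. x < i} = {x\<in>S. x < i} \<union> {x\<in>D - J. x < i}"
      "{x\<in>?J. x < i} = {x\<in>S. x < i} \<union> {x\<in>J. x < i}"
      "{x\<in>D. x < i} = {x\<in>D - J. x < i} \<union> {x\<in>J. x < i}" using J by auto
    then have "card {x\<in>?I. x < i} = card {x\<in>S. x < i} + card {x\<in>D - J. x < i}"
      "card {x\<in>?J. x < i} = card {x\<in>S. x < i} + card {x\<in>J. x < i}"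
      "card {x\<in>D. x < i} = card {x\<in>D - J. x < i} + card {x\<in>J. x < i}"
      using fin disj J by (simp_all add: card_Un_disjoint disjoint_iff) (subst card_Un_disjoint; auto)+
    then have "card {x\<in>?I. x < i} + card {x\<in>?J. x < i} = 2 * card {x\<in>S. x < i} + card {x\<in>D. x < i}"
      by simp
    then have sgn: "(-1) ^ (card {x\<in>?I. x < i} + card {x\<in>?J. x < i}) = rank_sign D i"
      by (simp add: rank_sign_def power_add)
    have sets: "S \<union> (D - insert i J) = ?I - {i}" "S \<union> insert i J = insert i ?J" using i by auto
    have "(\<Prod>k\<in>insert i J. rank_sign D k) = (\<Prod>k\<in>J. rank_sign D k) * rank_sign D i"
      using fin i by simp
    then show "twisted_product S D (insert i J) =
      mconst (\<Prod>i\<in>J. rank_sign D i) * (mconst ((-1) ^ (card {x\<in>?I. x < i} + card {x\<in>?J. x < i})) *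
      (mvar (plk (?I - {i})) * mvar (plk (insert i ?J))))"
      unfolding twisted_product_def sgn sets by (simp only: mult.assoc const_hom.mult)
  qed
  then show ?thesis using ex by (simp only: plucker_ideal_mult)
qed

section \<open>The lattice of columns\<close>

definition cnt :: "nat set \<Rightarrow> nat \<Rightarrow> nat" where
  "cnt A z = card {i\<in>A. i \<le> z}"

text \<open>In terms of these counting functions the order is the reversed pointwise order, meet and
  join are pointwise maximum and minimum, and columns of different lengths need no case
  distinction.\<close>

definition pcnt :: "'n::card2 plucker \<Rightarrow> nat \<Rightarrow> nat" where
  "pcnt a z = cnt (set (indices a)) z"

text \<open>Since \<open>xs\<close> increases, the positions with entries up to \<open>z\<close>
  form an initial segment, whose length is the count.\<close>

lemma less_cnt_iff:
  assumes "sorted_wrt (<) xs"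
  shows "r < cnt (set xs) z \<longleftrightarrow> r < length xs \<and> xs ! r \<le> z"
proof -
  let ?I = "{r. r < length xs \<and> xs ! r \<le> z}"
  have mono: "xs ! i \<le> xs ! j" if "i \<le> j" "j < length xs" for i j
    using assms that by (metis le_eq_less_or_eq order_refl sorted_wrt_nth_less)
  have "distinct xs" using assms by (simp add: strict_sorted_iff)
  then have "inj_on ((!) xs) ?I" by (auto simp: inj_on_def nth_eq_iff_index_eq)
  moreover have "{i \<in> set xs. i \<le> z} = (!) xs ` ?I" by (auto simp: in_set_conv_nth)
  ultimately have card: "cnt (set xs) z = card ?I" by (simp add: cnt_def card_image)
  show ?thesis
  proof (cases "r \<in> ?I")
    case True
    then have "{..r} \<subseteq> ?I" using mono by (auto intro: le_trans)
    then have "card {..r} \<le> card ?I" by (intro card_mono) auto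
    then show ?thesis using True card by simp
  next
    case False
    have "?I \<subseteq> {..<r}"
    proof
      fix s assume "s \<in> ?I"
      then show "s \<in> {..<r}" using False mono[of r s] by (auto simp: not_less intro: ccontr)
    qed
    then have "card ?I \<le> card {..<r}" by (intro card_mono) auto
    then show ?thesis using False card by simp
  qed
qed

lemma less_pcnt_iff: "r < pcnt a z \<longleftrightarrow> r < length (indices a) \<and> indices a ! r \<le> z"
  unfolding pcnt_def by (rule less_cnt_iff[OF sorted_indices])

lemma nat_eqI_less: "(\<And>r::nat. r < x \<longleftrightarrow> r < y) \<Longrightarrow> x = y"
  by (meson linorder_neqE_nat less_irrefl)

lemma plucker_le_iff: "a \<le> b \<longleftrightarrow> (\<forall>z. pcnt b z \<le> pcnt a z)"
proof
  assume ab: "a \<le> b"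
  show "\<forall>z. pcnt b z \<le> pcnt a z"
  proof
    fix z
    have "r < pcnt b z \<Longrightarrow> r < pcnt a z" for r
      using ab by (auto simp: less_pcnt_iff less_eq_plucker_def intro: le_trans)
    then show "pcnt b z \<le> pcnt a z" using not_less by blast
  qed
next
  assume le: "\<forall>z. pcnt b z \<le> pcnt a z"
  have *: "r < length (indices a) \<and> indices a ! r \<le> indices b ! r" if "r < length (indices b)" for r
    using that le less_pcnt_iff[of r b "indices b ! r"] less_pcnt_iff[of r a "indices b ! r"]
    by (metis le_refl less_le_trans)
  have "length (indices b) \<le> length (indices a)"
    using *[of "length (indices b) - 1"] length_indices(1)[of b] by linarith
  then show "a \<le> b" using * by (simp add: less_eq_plucker_def)
qed

lemma pcnt_sup: "pcnt (sup a b) z = min (pcnt a z) (pcnt b z)"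
  by (rule nat_eqI_less) (auto simp: less_pcnt_iff sup_plucker.rep_eq)

lemma pcnt_inf: "pcnt (inf a b) z = max (pcnt a z) (pcnt b z)"
  by (rule nat_eqI_less) (auto simp: less_pcnt_iff inf_plucker.rep_eq nth_list_meet less_max_iff_disj
      min_le_iff_disj split: if_splits)

lemma pcnt_large:
  assumes "CARD('n) \<le> z"
  shows "pcnt (a :: 'n::card2 plucker) z = length (indices a)"
proof -
  have "{i \<in> set (indices a). i \<le> z} = set (indices a)"
    using set_indices_subset[of a] assms by auto
  then show ?thesis by (simp add: pcnt_def cnt_def distinct_card distinct_indices)
qed

lemma pcnt_cap: "pcnt (a :: 'n::card2 plucker) z = pcnt a (min z CARD('n))"
  by (cases "z \<le> CARD('n)") (simp_all add: pcnt_large min_def)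

lemma plucker_le_iff_bounded:
  "(a :: 'n::card2 plucker) \<le> b \<longleftrightarrow> (\<forall>z\<le>CARD('n). pcnt b z \<le> pcnt a z)"
  unfolding plucker_le_iff by (metis pcnt_cap min.cobounded2)

lemma pcnt_eqI_bounded: "(\<And>z. z \<le> CARD('n) \<Longrightarrow> pcnt a z = pcnt b z) \<Longrightarrow> a = (b :: 'n::card2 plucker)"
  by (rule antisym) (simp_all add: plucker_le_iff_bounded)

text \<open>Dropping the entry \<open>n + 1\<close> turns strictly increasing columns with entries up to \<open>n + 1\<close>
  into shorter ones; covering relations then always replace an entry \<open>u\<close> by \<open>u + 1\<close>.\<close>

definition pk :: "nat set \<Rightarrow> 'n::card2 plucker" where
  "pk A = plk (A - {Suc CARD('n)})"

definition pk_set :: "'n::card2 itself \<Rightarrow> nat set \<Rightarrow> bool" where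
  "pk_set T A \<longleftrightarrow> plk_set T (A - {Suc CARD('n)})"

lemma pk_set_finite: "pk_set T A \<Longrightarrow> finite A"
  unfolding pk_set_def plk_set_def
  by (meson finite_Diff2 finite_atLeastAtMost finite_subset finite.emptyI finite.insertI)

lemma set_indices_pk:
  assumes "pk_set TYPE('n::card2) A"
  shows "set (indices (pk A :: 'n plucker)) = A - {Suc CARD('n)}"
  using assms pk_set_finite[OF assms] by (simp add: pk_def pk_set_def indices_plk)

lemma pcnt_pk:
  assumes "pk_set TYPE('n::card2) A" "z \<le> CARD('n)"
  shows "pcnt (pk A :: 'n plucker) z = cnt A z"
proof -
  have "{i \<in> A - {Suc CARD('n)}. i \<le> z} = {i\<in>A. i \<le> z}" using assms(2) by auto
  then show ?thesis by (simp add: pcnt_def set_indices_pk[OF assms(1)] cnt_def)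
qed

lemma cnt_insert: "finite A \<Longrightarrow> u \<notin> A \<Longrightarrow> cnt (insert u A) z = cnt A z + of_bool (u \<le> z)"
proof -
  assume "finite A" "u \<notin> A"
  moreover have "{i \<in> insert u A. i \<le> z} = (if u \<le> z then insert u {i\<in>A. i \<le> z} else {i\<in>A. i \<le> z})"
    by auto
  ultimately show ?thesis by (simp add: cnt_def)
qed

lemma cnt_Suc: "finite A \<Longrightarrow> cnt A (Suc v) = cnt A v + of_bool (Suc v \<in> A)"
proof -
  assume "finite A"
  moreover have "{i\<in>A. i \<le> Suc v} = (if Suc v \<in> A then insert (Suc v) {i\<in>A. i \<le> v} else {i\<in>A. i \<le> v})"
    by (auto simp: le_Suc_eq)
  ultimately show ?thesis by (auto simp: cnt_def)
qed

lemma cnt_mono: "finite A \<Longrightarrow> y \<le> z \<Longrightarrow> cnt A y \<le> cnt A z"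
  unfolding cnt_def by (rule card_mono) auto

text \<open>A rank function counted from the top: an entry \<open>i\<close> contributes
  \<open>n + 1 - i\<close>. In particular an entry \<open>n + 1\<close> would contribute 0, in
  agreement with its being dropped by \<open>pk\<close>.\<close>

definition depth :: "'n::card2 plucker \<Rightarrow> nat" where
  "depth a = (\<Sum>z\<le>CARD('n). pcnt a z)"

lemma depth_strict: "a < b \<Longrightarrow> depth b < depth (a :: 'n::card2 plucker)"
proof -
  assume "a < b"
  have le: "\<forall>z\<le>CARD('n). pcnt b z \<le> pcnt a z"
    using less_imp_le[OF \<open>a < b\<close>] by (simp add: plucker_le_iff_bounded)
  obtain z where "z \<le> CARD('n)" "pcnt b z < pcnt a z"
    using \<open>a < b\<close> unfolding less_plucker_def plucker_le_iff_bounded[of b a] by (meson not_le)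
  then show ?thesis unfolding depth_def using le by (intro sum_strict_mono_ex1) auto
qed

lemma covers_if_depth: "a < b \<Longrightarrow> depth a = Suc (depth b) \<Longrightarrow> covers b a"
  unfolding covers_def by (auto dest!: depth_strict)

section \<open>Covering relations\<close>

lemma cnt_step: 
  assumes "finite A" "u \<in> A" "Suc u \<notin> A"
  shows "cnt A z = cnt (insert (Suc u) (A - {u})) z + of_bool (z = u)"
proof -
  have "cnt A z = cnt (insert u (A - {u})) z" using assms by (simp add: insert_absorb)
  also have "\<dots> = cnt (A - {u}) z + of_bool (u \<le> z)" using assms by (intro cnt_insert) auto
  finally show ?thesis using assms by (simp add: cnt_insert)
qed

text \<open>Let \<open>z\<close> be the last place where the counts of \<open>x\<close> and
  \<open>y\<close> differ, and \<open>u\<close> the largest entry of \<open>x\<close> up to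
  \<open>z\<close>. Raising \<open>u\<close> to \<open>u + 1\<close> lowers the count of
  \<open>x\<close> at \<open>u\<close> only. There it still exceeds that of \<open>y\<close>,
  because the count of \<open>x\<close> is constant from \<open>u\<close> to \<open>z\<close> while
  that of \<open>y\<close> can only grow.\<close>

lemma cover_step:
  fixes x y :: "'n::card2 plucker"
  assumes "x < y"
  obtains u where "u \<in> set (indices x)" "Suc u \<notin> set (indices x)"
    "pk_set TYPE('n) (insert (Suc u) (set (indices x) - {u}))"
    "x < pk (insert (Suc u) (set (indices x) - {u}))"
    "pk (insert (Suc u) (set (indices x) - {u})) \<le> y"
proof -
  let ?n = "CARD('n)" and ?X = "set (indices x)"
  have le: "\<forall>z\<le>?n. pcnt y z \<le> pcnt x z"
    using less_imp_le[OF assms] by (simp add: plucker_le_iff_bounded)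
  have ex: "\<exists>z. z \<le> ?n \<and> pcnt y z < pcnt x z"
    using assms unfolding less_plucker_def plucker_le_iff_bounded[of y x] by (meson not_le)
  define z where "z = Max {z. z \<le> ?n \<and> pcnt y z < pcnt x z}"
  have fin: "finite {z. z \<le> ?n \<and> pcnt y z < pcnt x z}" by (rule finite_subset[of _ "{..?n}"]) auto
  have z: "z \<le> ?n" "pcnt y z < pcnt x z"
  proof -
    have "z \<in> {z. z \<le> ?n \<and> pcnt y z < pcnt x z}"
      unfolding z_def by (rule Max_in[OF fin]) (use ex in blast)
    then show "z \<le> ?n" "pcnt y z < pcnt x z" by simp_all
  qed
  have zmax: "pcnt y z' = pcnt x z'" if "z < z'" "z' \<le> ?n" for z'
  proof (rule ccontr)
    assume "pcnt y z' \<noteq> pcnt x z'"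
    then have "pcnt y z' < pcnt x z'" using le that(2) by (simp add: le_neq_implies_less)
    then have "z' \<le> z" unfolding z_def using fin that(2) by (intro Max_ge) auto
    then show False using that(1) by simp
  qed
  have cx: "pcnt x v = cnt ?X v" and cy: "pcnt y v = cnt (set (indices y)) v" for v
    by (simp_all add: pcnt_def)
  have "Suc z \<notin> ?X"
  proof
    assume "Suc z \<in> ?X"
    then have "Suc z \<le> ?n" using set_indices_subset[of x] by auto
    then have "pcnt y (Suc z) = pcnt x (Suc z)" using zmax by simp
    then show False using cnt_Suc[of ?X z] cnt_Suc[of "set (indices y)" z] z(2) \<open>Suc z \<in> ?X\<close>
      by (cases "Suc z \<in> set (indices y)") (simp_all add: cx cy)
  qed
  have "{i\<in>?X. i \<le> z} \<noteq> {}"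
    using z(2) unfolding cx cnt_def by force
  define u where "u = Max {i\<in>?X. i \<le> z}"
  have u: "u \<in> ?X" "u \<le> z"
    using Max_in[of "{i\<in>?X. i \<le> z}"] \<open>{i\<in>?X. i \<le> z} \<noteq> {}\<close> unfolding u_def by auto
  have umax: "i \<le> u" if "i \<in> ?X" "i \<le> z" for i
    unfolding u_def using that by (intro Max_ge) auto
  have su: "Suc u \<notin> ?X"
  proof
    assume "Suc u \<in> ?X"
    then show False using umax[of "Suc u"] u(2) \<open>Suc z \<notin> ?X\<close> by (cases "u = z") auto
  qed
  have "{i\<in>?X. i \<le> z} = {i\<in>?X. i \<le> u}" using umax u by auto
  then have "pcnt x u = pcnt x z" by (simp add: cx cnt_def)
  moreover have "pcnt y u \<le> pcnt y z" using u(2) by (simp add: cy cnt_mono)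
  ultimately have lt: "pcnt y u < pcnt x u" using z(2) by simp
  let ?X' = "insert (Suc u) (?X - {u})"
  have "u \<le> ?n" "1 \<le> u" using u(1) set_indices_subset[of x] by auto
  have cardX: "card ?X = length (indices x)" by (simp add: distinct_card distinct_indices)
  \<comment> \<open>For \<open>u = n\<close> the entry becomes \<open>n + 1\<close> and disappears.
    Then \<open>y\<close> is shorter than \<open>x\<close>, so \<open>x\<close> has at least two
    entries and a nonempty column remains.\<close>
  have valid: "pk_set TYPE('n) ?X'"
  proof (cases "u = ?n")
    case True
    have "?X' - {Suc ?n} = ?X - {u}" using set_indices_subset[of x] True by auto
    moreover have "length (indices y) < length (indices x)" using lt True by (simp add: pcnt_large)
    then have "2 \<le> card ?X" using length_indices(1)[of y] cardX by simp
    ultimately show ?thesis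
      using length_indices(2)[of x] set_indices_subset[of x] u(1) cardX
      by (auto simp: pk_set_def plk_set_def)
  next
    case False
    then have "?X' - {Suc ?n} = ?X'" using \<open>u \<le> ?n\<close> set_indices_subset[of x] by auto
    moreover have "card ?X' = card ?X" using u(1) su card_Suc_Diff1[of ?X u] by simp
    ultimately show ?thesis
      using False \<open>u \<le> ?n\<close> length_indices[of x] set_indices_subset[of x] cardX
      by (auto simp: pk_set_def plk_set_def)
  qed
  have cnt': "pcnt x v = pcnt (pk ?X' :: 'n plucker) v + of_bool (v = u)" if "v \<le> ?n" for v
    using cnt_step[of ?X u v] u(1) su that by (simp add: pcnt_pk[OF valid that] cx)
  have "x \<le> pk ?X'" by (simp add: plucker_le_iff_bounded cnt')
  moreover have "\<not> pk ?X' \<le> x"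
    using cnt'[OF \<open>u \<le> ?n\<close>] \<open>u \<le> ?n\<close> by (auto simp: plucker_le_iff_bounded intro!: exI[of _ u])
  ultimately have "x < pk ?X'" by (simp add: less_plucker_def)
  moreover have "pk ?X' \<le> y"
    unfolding plucker_le_iff_bounded
  proof (intro allI impI)
    fix v assume "v \<le> ?n"
    then show "pcnt y v \<le> pcnt (pk ?X' :: 'n plucker) v"
      using cnt'[of v] le lt by (cases "v = u") auto
  qed
  ultimately show ?thesis using that u(1) su valid by blast
qed

lemma incomparable_sup_inf:
  fixes a b :: "'a::lattice"
  assumes "incomparable a b"
  shows "a < sup a b" "b < sup a b" "inf a b < a" "inf a b < b"
proof -
  have "a \<noteq> sup a b" "b \<noteq> sup a b" "inf a b \<noteq> a" "inf a b \<noteq> b"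
    using assms unfolding incomparable_def by (metis sup_ge1 sup_ge2 inf_le1 inf_le2)+
  then show "a < sup a b" "b < sup a b" "inf a b < a" "inf a b < b"
    by (simp_all add: less_le)
qed

section \<open>Quadruples of entries and diamond pairs\<close>

lemma depth_step:
  fixes x :: "'n::card2 plucker"
  assumes u: "u \<in> set (indices x)" "Suc u \<notin> set (indices x)"
    and v: "pk_set TYPE('n) (insert (Suc u) (set (indices x) - {u}))"
  shows "depth x = Suc (depth (pk (insert (Suc u) (set (indices x) - {u})) :: 'n plucker))"
proof -
  have "pcnt x z = pcnt (pk (insert (Suc u) (set (indices x) - {u})) :: 'n plucker) z + of_bool (z = u)"
    if "z \<le> CARD('n)" for z
    unfolding pcnt_pk[OF v that] pcnt_def[of x] using u by (intro cnt_step) auto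
  moreover have "u \<le> CARD('n)" using u(1) set_indices_subset[of x] by auto
  ultimately show ?thesis by (simp add: depth_def sum.distrib of_bool_def)
qed

text \<open>The value \<open>n + 1\<close> is allowed both for \<open>d\<close> and as an element of
  \<open>S\<close>. With \<open>d = n + 1\<close> the columns have different lengths; an
  \<open>n + 1\<close> in \<open>S\<close> is invisible after \<open>pk\<close>, so the columns
  determine \<open>S\<close> only up to this element.\<close>

definition quad :: "'n::card2 itself \<Rightarrow> nat set \<Rightarrow> nat \<Rightarrow> nat \<Rightarrow> nat \<Rightarrow> nat \<Rightarrow> bool" where
  "quad _ S a b c d \<longleftrightarrow> S \<subseteq> {1..Suc CARD('n)} \<and> 1 \<le> a \<and> a < b \<and> b < c \<and> c < d \<and> d \<le> Suc CARD('n) \<and>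
     a \<notin> S \<and> b \<notin> S \<and> c \<notin> S \<and> d \<notin> S"

abbreviation pk2 :: "nat set \<Rightarrow> nat \<Rightarrow> nat \<Rightarrow> 'n::card2 plucker" where
  "pk2 S u v \<equiv> pk (insert u (insert v S))"

lemma quad_finite: "quad T S a b c d \<Longrightarrow> finite S"
  unfolding quad_def by (auto intro: finite_subset)

text \<open>Two of the four entries are missing from the column, so at most \<open>n - 1\<close> of
  the \<open>n + 1\<close> values are used; since \<open>u\<close> and \<open>v\<close> differ, one
  of them is not \<open>n + 1\<close> and the column stays nonempty.\<close>

lemma quad_pk_set:
  assumes q: "quad TYPE('n::card2) S a b c d" and uv: "u \<in> {a,b,c,d}" "v \<in> {a,b,c,d}" "u \<noteq> v"
  shows "pk_set TYPE('n) (insert u (insert v S))"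
proof -
  let ?n = "CARD('n)" and ?A = "insert u (insert v S)"
  have fin: "finite S" by (rule quad_finite[OF q])
  have "card {a,b,c,d} = 4" using q by (simp add: quad_def)
  then have c2: "card ({a,b,c,d} - {u,v}) = 2" using uv by (subst card_Diff_subset) auto
  have "?A \<union> ({a,b,c,d} - {u,v}) \<subseteq> {1..Suc ?n}" using q uv by (auto simp: quad_def)
  then have "card (?A \<union> ({a,b,c,d} - {u,v})) \<le> card {1..Suc ?n}" by (intro card_mono) auto
  then have "card (?A \<union> ({a,b,c,d} - {u,v})) \<le> Suc ?n" by simp
  moreover have "?A \<inter> ({a,b,c,d} - {u,v}) = {}" using q by (auto simp: quad_def)
  then have "card (?A \<union> ({a,b,c,d} - {u,v})) = card ?A + 2" using c2 fin by (subst card_Un_disjoint) auto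
  ultimately have "card ?A \<le> ?n - 1" by simp
  then have "card (?A - {Suc ?n}) \<le> ?n - 1" using fin by (meson card_Diff1_le le_trans)
  moreover have "?A - {Suc ?n} \<noteq> {}" using uv(3) by auto
  then have "1 \<le> card (?A - {Suc ?n})" using fin by (simp add: Suc_le_eq card_gt_0_iff)
  moreover have "?A - {Suc ?n} \<subseteq> {1..?n}" using q uv by (auto simp: quad_def)
  ultimately show ?thesis by (simp add: pk_set_def plk_set_def)
qed

lemma quad_pcnt:
  assumes q: "quad TYPE('n::card2) S a b c d" and uv: "u \<in> {a,b,c,d}" "v \<in> {a,b,c,d}" "u \<noteq> v"
    and z: "z \<le> CARD('n)"
  shows "pcnt (pk2 S u v :: 'n plucker) z = cnt S z + of_bool (u \<le> z) + of_bool (v \<le> z)"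
  using quad_finite[OF q] q uv unfolding pcnt_pk[OF quad_pk_set[OF q uv] z]
  by (subst cnt_insert; (subst cnt_insert)?) (auto simp: quad_def)

lemma quad_depth:
  assumes q: "quad TYPE('n::card2) S a b c d" and uv: "u \<in> {a,b,c,d}" "v \<in> {a,b,c,d}" "u \<noteq> v"
  shows "depth (pk2 S u v :: 'n plucker) + u + v = (\<Sum>z\<le>CARD('n). cnt S z) + 2 * Suc CARD('n)"
proof -
  let ?n = "CARD('n)"
  have le: "u \<le> Suc ?n" "v \<le> Suc ?n" using q uv by (auto simp: quad_def)
  have s: "(\<Sum>z\<le>?n. of_bool (x \<le> z)) + x = Suc ?n" if "x \<le> Suc ?n" for x
  proof -
    have "(\<Sum>z\<le>?n. of_bool (x \<le> z)) = (\<Sum>z\<in>{x..?n}. 1::nat)"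
      by (rule sum.mono_neutral_cong_right) auto
    then show ?thesis using that by simp
  qed
  have "depth (pk2 S u v :: 'n plucker) = (\<Sum>z\<le>?n. cnt S z + of_bool (u \<le> z) + of_bool (v \<le> z))"
    unfolding depth_def by (intro sum.cong refl quad_pcnt[OF q uv]) auto
  then show ?thesis using s[OF le(1)] s[OF le(2)] by (simp add: sum.distrib)
qed

lemma quad_lattice:
  fixes x y :: "'n::card2 plucker"
  assumes q: "quad TYPE('n) S a b c d"
  defines "x \<equiv> pk2 S b c" and "y \<equiv> pk2 S a d"
  shows "sup x y = pk2 S b d" "inf x y = pk2 S a c" "incomparable x y"
    "pk2 S a b < inf x y" "sup x y < pk2 S c d"
proof -
  have o: "a < b" "b < c" "c < d" "d \<le> Suc CARD('n)" using q by (auto simp: quad_def)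
  note cn = quad_pcnt[OF q]
  show sup: "sup x y = pk2 S b d"
    by (rule pcnt_eqI_bounded) (use o in \<open>simp add: x_def y_def pcnt_sup cn\<close>)
  show inf: "inf x y = pk2 S a c"
    by (rule pcnt_eqI_bounded) (use o in \<open>simp add: x_def y_def pcnt_inf cn\<close>)
  show "incomparable x y"
    unfolding incomparable_def
  proof
    have "pcnt x a < pcnt y a" "pcnt y c < pcnt x c" using o by (simp_all add: x_def y_def cn)
    then show "\<not> x \<le> y" "\<not> y \<le> x" by (auto simp: plucker_le_iff not_le)
  qed
  have "pk2 S a b \<le> (pk2 S a c :: 'n plucker)" "pk2 S b d \<le> (pk2 S c d :: 'n plucker)"
    unfolding plucker_le_iff_bounded using o by (simp_all add: cn)
  moreover have "pcnt (pk2 S a c :: 'n plucker) b < pcnt (pk2 S a b :: 'n plucker) b"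
    "pcnt (pk2 S c d :: 'n plucker) b < pcnt (pk2 S b d :: 'n plucker) b"
    using o by (simp_all add: cn)
  ultimately show "pk2 S a b < inf x y" "sup x y < pk2 S c d"
    unfolding sup inf less_le by auto
qed

text \<open>The exchange of one entry between \<open>S \<union> {a, b, c}\<close> and
  \<open>S \<union> {d}\<close>. Only \<open>d\<close> can be lost by dropping \<open>n + 1\<close>
  on one side alone, which makes the smaller set smaller, so the cardinality condition
  survives.\<close>

lemma quad_three_term:
  assumes q: "quad TYPE('n::card2) S a b c d"
  obtains \<epsilon>\<^sub>1 \<epsilon>\<^sub>2 where "\<epsilon>\<^sub>1 \<noteq> 0" "\<epsilon>\<^sub>2 \<noteq> 0"
    "mvar (pk2 S b c) * mvar (pk2 S a d) - (mconst \<epsilon>\<^sub>1 * mvar (pk2 S a c) * mvar (pk2 S b d) +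
       mconst \<epsilon>\<^sub>2 * mvar (pk2 S a b) * mvar (pk2 S c d)) \<in> (plucker_ideal :: ('n plucker, complex) mvpoly set)"
proof -
  let ?n = "CARD('n)"
  let ?I = "insert a (insert b (insert c S)) - {Suc ?n}" and ?J = "insert d S - {Suc ?n}"
  have fin: "finite S" by (rule quad_finite[OF q])
  have sub: "?I \<subseteq> {1..?n}" "?J \<subseteq> {1..?n}" using q by (auto simp: quad_def)
  have I: "?I = insert a (insert b (insert c (S - {Suc ?n})))" using q by (auto simp: quad_def)
  then have "card ?I = card (S - {Suc ?n}) + 3" using q fin by (simp add: quad_def)
  moreover have "?J \<subseteq> insert d (S - {Suc ?n})" by auto
  then have "card ?J \<le> card (insert d (S - {Suc ?n}))" using fin by (intro card_mono) auto
  then have "card ?J \<le> card (S - {Suc ?n}) + 1" using fin by (simp add: card_insert_if split: if_splits)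
  ultimately have "card ?J + 2 \<le> card ?I" by simp
  note ex = plucker_exchange[OF sub this]
  define \<epsilon> :: "nat \<Rightarrow> complex" where "\<epsilon> i = (-1) ^ (card {x \<in> ?I. x < i} + card {x \<in> ?J. x < i})" for i
  have nz: "\<epsilon> i \<noteq> 0" for i by (simp add: \<epsilon>_def)
  have IJ: "?I - ?J = {a, b, c}" using q by (auto simp: quad_def)
  have sets: "?I - {a} = insert b (insert c S) - {Suc ?n}" "insert a ?J = insert a (insert d S) - {Suc ?n}"
    "?I - {b} = insert a (insert c S) - {Suc ?n}" "insert b ?J = insert b (insert d S) - {Suc ?n}"
    "?I - {c} = insert a (insert b S) - {Suc ?n}" "insert c ?J = insert c (insert d S) - {Suc ?n}"
    using q by (auto simp: quad_def)
  have ne: "a \<noteq> b" "a \<noteq> c" "b \<noteq> c" using q by (auto simp: quad_def)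
  let ?A = "mvar (pk2 S b c) * mvar (pk2 S a d) :: ('n plucker, complex) mvpoly"
  let ?B = "mvar (pk2 S a c) * mvar (pk2 S b d) :: ('n plucker, complex) mvpoly"
  let ?C = "mvar (pk2 S a b) * mvar (pk2 S c d) :: ('n plucker, complex) mvpoly"
  have "(\<Sum>i\<in>{a,b,c}. mconst (\<epsilon> i) * (mvar (plk (?I - {i})) * mvar (plk (insert i ?J)))) \<in>
      (plucker_ideal :: ('n plucker, complex) mvpoly set)"
    using ex unfolding IJ \<epsilon>_def .
  then have "mconst (\<epsilon> a) * ?A + (mconst (\<epsilon> b) * ?B + mconst (\<epsilon> c) * ?C) \<in> plucker_ideal"
    using ne by (simp add: sets pk_def)
  \<comment> \<open>The coefficient of the incomparable product is a sign; multiplying by it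
    normalizes this coefficient to 1.\<close>
  then have "mconst (\<epsilon> a) * (mconst (\<epsilon> a) * ?A + (mconst (\<epsilon> b) * ?B + mconst (\<epsilon> c) * ?C)) \<in> plucker_ideal"
    by (rule plucker_ideal_mult)
  moreover have "\<epsilon> a * \<epsilon> a = 1" by (simp add: \<epsilon>_def flip: power_add)
  then have "mconst (\<epsilon> a) * mconst (\<epsilon> a) = (1 :: ('n plucker, complex) mvpoly)"
    by (simp flip: const_hom.mult)
  then have "mconst (\<epsilon> a) * (mconst (\<epsilon> a) * ?A) = ?A" by (simp flip: mult.assoc)
  ultimately have "?A + (mconst (\<epsilon> a * \<epsilon> b) * ?B + mconst (\<epsilon> a * \<epsilon> c) * ?C) \<in> plucker_ideal"
    by (simp add: distrib_left const_hom.mult mult.assoc)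
  moreover have "mconst (- (x::complex)) = - (mconst x :: ('n plucker, complex) mvpoly)" for x
    by (simp add: mconst_def single_uminus)
  ultimately show ?thesis
    using that[of "- (\<epsilon> a * \<epsilon> b)" "- (\<epsilon> a * \<epsilon> c)"] nz by (simp add: algebra_simps)
qed

text \<open>By \<open>quad_depth\<close> the depth falls by as much as the sum of the two varying
  entries rises. The join has entries \<open>i + 1, j + 1\<close> and the further term
  \<open>j, j + 1\<close>, so they are \<open>j - i - 1\<close> levels apart.\<close>

lemma quad_diamond:
  assumes q: "quad TYPE('n::card2) S i (Suc i) j (Suc j)"
  shows "diamond_pair (pk2 S (Suc i) j) (pk2 S i (Suc j) :: 'n plucker)"
    "covers (pk2 S j (Suc j)) (pk2 S (Suc i) (Suc j) :: 'n plucker) \<longleftrightarrow> j = Suc (Suc i)"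
proof -
  let ?x = "pk2 S (Suc i) j :: 'n plucker" and ?y = "pk2 S i (Suc j) :: 'n plucker"
  note L = quad_lattice[OF q] and D = quad_depth[OF q]
  have o: "Suc i < j" using q by (simp add: quad_def)
  have inc: "?x \<noteq> ?y" "?x < sup ?x ?y" "?y < sup ?x ?y" "inf ?x ?y < ?x" "inf ?x ?y < ?y"
    using L(3) incomparable_sup_inf[OF L(3)] by (auto simp: incomparable_def)
  have "covers (sup ?x ?y) ?x" "covers (sup ?x ?y) ?y" "covers ?x (inf ?x ?y)" "covers ?y (inf ?x ?y)"
    using inc D[of i j] D[of "Suc i" j] D[of i "Suc j"] D[of "Suc i" "Suc j"] o
    by (auto intro!: covers_if_depth simp: L(1,2))
  then show "diamond_pair ?x ?y" using inc(1) by (simp add: diamond_pair_def)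
  show "covers (pk2 S j (Suc j)) (pk2 S (Suc i) (Suc j) :: 'n plucker) \<longleftrightarrow> j = Suc (Suc i)"
  proof
    assume "j = Suc (Suc i)"
    then show "covers (pk2 S j (Suc j)) (pk2 S (Suc i) (Suc j) :: 'n plucker)"
      using L(5)[unfolded L(1)] D[of j "Suc j"] D[of "Suc i" "Suc j"] o by (intro covers_if_depth) auto
  next
    assume c: "covers (pk2 S j (Suc j)) (pk2 S (Suc i) (Suc j) :: 'n plucker)"
    then have "pk2 S (Suc i) (Suc j) < (pk2 S j (Suc j) :: 'n plucker)" by (simp add: covers_def)
    then obtain x' where "pk2 S (Suc i) (Suc j) < (x' :: 'n plucker)" "x' \<le> pk2 S j (Suc j)"
        "depth (pk2 S (Suc i) (Suc j) :: 'n plucker) = Suc (depth x')"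
    proof (rule cover_step)
      fix u assume u: "u \<in> set (indices (pk2 S (Suc i) (Suc j) :: 'n plucker))"
        "Suc u \<notin> set (indices (pk2 S (Suc i) (Suc j) :: 'n plucker))"
      let ?X = "set (indices (pk2 S (Suc i) (Suc j) :: 'n plucker))"
      assume v: "pk_set TYPE('n) (insert (Suc u) (?X - {u}))"
        and "pk2 S (Suc i) (Suc j) < (pk (insert (Suc u) (?X - {u})) :: 'n plucker)"
        "pk (insert (Suc u) (?X - {u})) \<le> (pk2 S j (Suc j) :: 'n plucker)"
      moreover have "depth (pk2 S (Suc i) (Suc j) :: 'n plucker) = Suc (depth (pk (insert (Suc u) (?X - {u})) :: 'n plucker))"
        by (rule depth_step[OF u v])
      ultimately show thesis using that by blast
    qed
    then have "depth (pk2 S (Suc i) (Suc j) :: 'n plucker) = Suc (depth (pk2 S j (Suc j) :: 'n plucker))"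
      using c unfolding covers_def by (metis le_less)
    then show "j = Suc (Suc i)" using D[of j "Suc j"] D[of "Suc i" "Suc j"] o by simp
  qed
qed

lemma covers_step:
  fixes x y :: "'n::card2 plucker"
  assumes "covers y x"
  obtains u where "u \<in> set (indices x)" "Suc u \<notin> set (indices x)"
    "y = pk (insert (Suc u) (set (indices x) - {u}))"
  using assms cover_step[of x y] unfolding covers_def by (metis le_less)

text \<open>Both elements cover their meet, so each raises one entry of it by one; the two entries
  and their successors are the four values, and the rest of the meet is \<open>S\<close>.\<close>

lemma diamond_pair_quad:
  fixes a b :: "'n::card2 plucker"
  assumes "diamond_pair a b"
  obtains S i j where "quad TYPE('n) S i (Suc i) j (Suc j)"
    "(a = pk2 S (Suc i) j \<and> b = pk2 S i (Suc j)) \<or> (b = pk2 S (Suc i) j \<and> a = pk2 S i (Suc j))"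
proof -
  let ?D = "set (indices (inf a b))"
  obtain u where u: "u \<in> ?D" "Suc u \<notin> ?D" "a = pk (insert (Suc u) (?D - {u}))"
    using assms covers_step unfolding diamond_pair_def by blast
  obtain v where v: "v \<in> ?D" "Suc v \<notin> ?D" "b = pk (insert (Suc v) (?D - {v}))"
    using assms covers_step unfolding diamond_pair_def by blast
  have D: "?D \<subseteq> {1..CARD('n)}" by (rule set_indices_subset)
  have main: "quad TYPE('n) (?D - {i, j}) i (Suc i) j (Suc j)"
    "insert (Suc i) (?D - {i}) = insert (Suc i) (insert j (?D - {i, j}))"
    "insert (Suc j) (?D - {j}) = insert i (insert (Suc j) (?D - {i, j}))"
    if "i \<in> ?D" "Suc i \<notin> ?D" "j \<in> ?D" "Suc j \<notin> ?D" "i < j" for i j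
  proof -
    have "Suc i \<noteq> j" using that by auto
    then show "quad TYPE('n) (?D - {i, j}) i (Suc i) j (Suc j)"
      using that D unfolding quad_def by fastforce
  qed (use that in auto)
  have "u \<noteq> v" using assms u(3) v(3) by (auto simp: diamond_pair_def)
  then consider "u < v" | "v < u" by linarith
  then show ?thesis
  proof cases
    case 1
    then show ?thesis using main[OF u(1,2) v(1,2)] u(3) v(3) by (intro that[of "?D - {u, v}" u v]) auto
  next
    case 2
    then show ?thesis using main[OF v(1,2) u(1,2)] u(3) v(3) by (intro that[of "?D - {v, u}" v u]) auto
  qed
qed

text \<open>By distributivity \<open>c \<mapsto> sup c y\<close> is injective from the interval
  between \<open>inf x y\<close> and \<open>x\<close> to that between \<open>y\<close> and
  \<open>sup x y\<close>. So if both upper sides of the square are coverings, the lower sides are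
  coverings too.\<close>

lemma not_diamond_between:
  fixes a b :: "'a::distrib_lattice"
  assumes inc: "incomparable a b" and nd: "\<not> diamond_pair a b"
  shows "\<exists>c. (b < c \<and> c < sup a b) \<or> (a < c \<and> c < sup a b)"
proof (rule ccontr)
  assume no: "\<not> ?thesis"
  have *: False if "\<And>c. \<not> (y < c \<and> c < sup x y)" "incomparable x y" "inf x y < c" "c < x" for x y c :: 'a
  proof -
    have "sup c y \<noteq> y"
    proof
      assume "sup c y = y"
      then have "c \<le> y" by (metis sup_ge1)
      then have "c \<le> inf x y" using that(4) by simp
      then show False using that(3) leD by blast
    qed
    then have "y < sup c y" by (simp add: less_le)
    moreover have "sup c y \<le> sup x y" using that(4) by (meson less_imp_le sup_mono order_refl)
    ultimately have "sup c y = sup x y" using that(1)[of "sup c y"] by (auto simp: less_le)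
    then have "x = inf x (sup c y)" by (simp add: inf_sup_absorb)
    also have "\<dots> = sup (inf x c) (inf x y)" by (rule inf_sup_distrib1)
    also have "\<dots> = c" using that(3,4) by (simp add: inf.absorb2 sup.absorb1 less_imp_le)
    finally show False using that(4) by simp
  qed
  have "covers (sup a b) a" "covers (sup a b) b"
    using incomparable_sup_inf[OF inc] no by (auto simp: covers_def)
  moreover have "covers a (inf a b)"
    using incomparable_sup_inf[OF inc] no *[of b a] inc by (auto simp: covers_def)
  moreover have "covers b (inf a b)"
    using incomparable_sup_inf[OF inc] no *[of a b] inc
    by (auto simp: covers_def incomparable_def sup_commute inf_commute)
  moreover have "a \<noteq> b" using inc by (auto simp: incomparable_def)
  ultimately show False using nd by (simp add: diamond_pair_def)
qed

text \<open>The element \<open>c\<close> cuts the square of \<open>a\<close> and \<open>b\<close>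
  into the square of \<open>a\<close> and \<open>c\<close> and that of \<open>inf a c\<close> and
  \<open>b\<close>; they share the side from \<open>inf a c\<close> to \<open>c\<close>.\<close>

lemma incomparable_between:
  fixes a b c :: "'a::distrib_lattice"
  assumes "incomparable a b" "b < c" "c < sup a b"
  shows "incomparable a c" "sup a c = sup a b" "inf a b < inf a c" "inf (inf a c) b = inf a b" "sup (inf a c) b = c"
    "incomparable (inf a c) b"
proof -
  show "incomparable a c"
    unfolding incomparable_def
  proof
    show "\<not> a \<le> c" using assms(2,3) by (metis leD le_supI less_imp_le)
    show "\<not> c \<le> a" using assms(1,2) by (auto simp: incomparable_def)
  qed
  show "sup a c = sup a b"
    using assms(2,3) by (intro antisym) (auto intro: less_imp_le le_supI2 order_trans)
  show i: "inf (inf a c) b = inf a b" using assms(2) by (simp add: inf_assoc inf_absorb2 less_imp_le)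
  have "sup (inf a c) b = inf (sup a b) (sup c b)" by (rule sup_inf_distrib2)
  also have "\<dots> = c" using assms(2,3) by (simp add: sup_absorb1 inf_absorb2 less_imp_le)
  finally show s: "sup (inf a c) b = c" .
  have "inf a b \<le> inf a c" using assms(2) by (meson inf_mono less_imp_le order_refl)
  moreover have "inf a b \<noteq> inf a c" using s assms(2) by (metis inf_le2 sup_absorb2 less_irrefl)
  ultimately show "inf a b < inf a c" by (simp add: less_le)
  show "incomparable (inf a c) b"
    unfolding incomparable_def
  proof
    show "\<not> inf a c \<le> b" using s assms(2) by (auto simp: sup_absorb2)
    show "\<not> b \<le> inf a c" using assms(1) by (auto simp: incomparable_def)
  qed
qed

text \<open>Both pieces of a cut span smaller intervals than the square, and
  \<open>not_diamond_between\<close> provides a cut of every square that is not a diamond. The case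
  \<open>commute\<close> serves cuts on the side of \<open>a\<close>.\<close>

lemma incomparable_diamond_induct [consumes 1, case_names diamond commute between]:
  fixes P :: "'a::{finite,distrib_lattice} \<Rightarrow> 'a \<Rightarrow> bool"
  assumes inc: "incomparable a b"
    and dia: "\<And>a b. diamond_pair a b \<Longrightarrow> P a b"
    and comm: "\<And>a b. P a b \<Longrightarrow> P b a"
    and step: "\<And>a b c. incomparable a b \<Longrightarrow> b < c \<Longrightarrow> c < sup a b \<Longrightarrow> P a c \<Longrightarrow> P (inf a c) b \<Longrightarrow> P a b"
  shows "P a b"
  using inc
proof (induction "card {x. inf a b \<le> x \<and> x \<le> sup a b}" arbitrary: a b rule: less_induct)
  case less
  let ?A = "\<lambda>a b. {x. inf a b \<le> x \<and> x \<le> sup a b} :: 'a set"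
  have main: "P a b"
    if IH: "\<And>a' b'. card (?A a' b') < card (?A a b) \<Longrightarrow> incomparable a' b' \<Longrightarrow> P a' b'"
      and ab: "incomparable a b" and c: "b < c" "c < sup a b" for a b c
  proof -
    note B = incomparable_between[OF ab c]
    have "inf a b \<in> ?A a b" "sup a b \<in> ?A a b" by (simp_all add: le_infI1 le_supI1)
    moreover have "inf a b \<notin> ?A a c" using B(3) leD by blast
    moreover have "sup a b \<notin> ?A (inf a c) b" unfolding B(5) using c(2) leD by blast
    moreover have "?A a c \<subseteq> ?A a b"
      using less_imp_le[OF B(3)] unfolding B(2) by (blast intro: order_trans)
    moreover have "?A (inf a c) b \<subseteq> ?A a b"
      using less_imp_le[OF c(2)] unfolding B(4,5) by (blast intro: order_trans)
    ultimately have "?A a c \<noteq> ?A a b" "?A a c \<subseteq> ?A a b" "?A (inf a c) b \<noteq> ?A a b" "?A (inf a c) b \<subseteq> ?A a b"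
      by metis+
    then have "card (?A a c) < card (?A a b)" "card (?A (inf a c) b) < card (?A a b)"
      by (intro psubset_card_mono psubsetI; simp)+
    then show ?thesis using step[OF ab c] IH B(1,6) by blast
  qed
  show ?case
  proof (cases "diamond_pair a b")
    case False
    then obtain c where "(b < c \<and> c < sup a b) \<or> (a < c \<and> c < sup a b)"
      using not_diamond_between[OF less.prems] by blast
    then show ?thesis
    proof
      assume "b < c \<and> c < sup a b"
      then show ?thesis using main[of a b c] less by blast
    next
      assume c: "a < c \<and> c < sup a b"
      have "incomparable b a" using less.prems by (auto simp: incomparable_def)
      moreover have "P a' b'" if "card (?A a' b') < card (?A b a)" "incomparable a' b'" for a' b'
        using less.hyps that unfolding inf_commute[of b a] sup_commute[of b a] by blast
      ultimately have "P b a" using main[of b a c] c by (simp only: sup_commute)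
      then show ?thesis by (rule comm)
    qed
  qed (rule dia)
qed

lemma diamond_pair_incomparable: "diamond_pair a b \<Longrightarrow> incomparable a b"
  by (auto simp: diamond_pair_def covers_def incomparable_def sup_absorb1 sup_absorb2)

section \<open>Spanning by standard monomials\<close>

definition quadratic :: "('v::finite \<Rightarrow> 'v \<Rightarrow> complex) \<Rightarrow> ('v, complex) mvpoly" where
  "quadratic f = (\<Sum>p\<in>UNIV. \<Sum>q\<in>UNIV. mconst (f p q) * (mvar p * mvar q))"

lemma quadratic_add: "quadratic (\<lambda>p q. f p q + g p q) = quadratic f + quadratic g"
  by (simp add: quadratic_def const_hom.add distrib_right sum.distrib)

lemma quadratic_delta:
  "quadratic (\<lambda>p q. if p = p0 \<and> q = q0 then c else 0) = mconst c * (mvar p0 * mvar q0)"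
proof -
  have e: "mconst (if p = p0 \<and> q = q0 then c else 0) * (mvar p * mvar q) =
    (if p = p0 then if q = q0 then mconst c * (mvar p0 * mvar q0) else 0 else 0)" for p q
    by simp
  have "(\<Sum>q\<in>UNIV. mconst (if p = p0 \<and> q = q0 then c else 0) * (mvar p * mvar q)) =
    (if p = p0 then mconst c * (mvar p0 * mvar q0) else 0)" for p
    unfolding e by (cases "p = p0") simp_all
  then show ?thesis unfolding quadratic_def by simp
qed

lemma quadratic_scale: "quadratic (\<lambda>p q. x * f p q) = mconst x * quadratic f"
  by (simp add: quadratic_def const_hom.mult sum_distrib_left mult.assoc)

text \<open>The lengths of the columns are recorded because the later support argument, through
  \<open>vanishes_above\<close>, must know that the larger column of each term is not longer than
  the columns it is compared with.\<close>

definition straight :: "nat \<Rightarrow> nat \<Rightarrow> ('n::card2 plucker, complex) mvpoly set" where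
  "straight k l = {g. \<exists>f. (\<forall>p q. f p q \<noteq> 0 \<longrightarrow> p \<le> q \<and> length (indices p) = k \<and> length (indices q) = l) \<and>
     g - quadratic f \<in> plucker_ideal}"

lemma straightI:
  assumes "g - quadratic f \<in> plucker_ideal"
    and "\<And>p q. f p q \<noteq> 0 \<Longrightarrow> p \<le> q \<and> length (indices p) = k \<and> length (indices q) = l"
  shows "g \<in> straight k l"
  using assms unfolding straight_def by blast

lemma straightE:
  assumes "g \<in> straight k l"
  obtains f where "g - quadratic f \<in> plucker_ideal"
    "\<And>p q. f p q \<noteq> 0 \<Longrightarrow> p \<le> q \<and> length (indices p) = k \<and> length (indices q) = l"
  using assms unfolding straight_def by blast

lemma straight_ideal: "g \<in> plucker_ideal \<Longrightarrow> g \<in> straight k l"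
  by (rule straightI[of _ "\<lambda>_ _. 0"]) (simp_all add: quadratic_def)

lemma straight_add:
  assumes "g \<in> straight k l" "h \<in> straight k l"
  shows "g + h \<in> straight k l"
proof -
  obtain f where f: "g - quadratic f \<in> plucker_ideal"
    "\<And>p q. f p q \<noteq> 0 \<Longrightarrow> p \<le> q \<and> length (indices p) = k \<and> length (indices q) = l"
    using assms(1) by (rule straightE) blast
  obtain f' where f': "h - quadratic f' \<in> plucker_ideal"
    "\<And>p q. f' p q \<noteq> 0 \<Longrightarrow> p \<le> q \<and> length (indices p) = k \<and> length (indices q) = l"
    using assms(2) by (rule straightE) blast
  have "g + h - quadratic (\<lambda>p q. f p q + f' p q) = (g - quadratic f) + (h - quadratic f')"
    by (simp add: quadratic_add)
  also have "\<dots> \<in> plucker_ideal" using f(1) f'(1) by (rule plucker_ideal_add)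
  finally show ?thesis
  proof (rule straightI)
    fix p q assume "f p q + f' p q \<noteq> 0"
    then have "f p q \<noteq> 0 \<or> f' p q \<noteq> 0" by auto
    then show "p \<le> q \<and> length (indices p) = k \<and> length (indices q) = l" using f(2) f'(2) by blast
  qed
qed

lemma straight_scale:
  assumes "g \<in> straight k l"
  shows "mconst x * g \<in> straight k l"
proof -
  obtain f where f: "g - quadratic f \<in> plucker_ideal"
    "\<And>p q. f p q \<noteq> 0 \<Longrightarrow> p \<le> q \<and> length (indices p) = k \<and> length (indices q) = l"
    using assms by (rule straightE) blast
  have "mconst x * g - quadratic (\<lambda>p q. x * f p q) = mconst x * (g - quadratic f)"
    by (simp add: quadratic_scale right_diff_distrib)
  also have "\<dots> \<in> plucker_ideal" using f(1) by (rule plucker_ideal_mult)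
  finally show ?thesis by (rule straightI) (use f(2) in auto)
qed

lemma straight_diff: "g \<in> straight k l \<Longrightarrow> h \<in> straight k l \<Longrightarrow> g - h \<in> straight k l"
  using straight_add[of g k l "mconst (-1) * h"] straight_scale[of h k l "-1"]
  by (simp add: mconst_def single_uminus)

lemma straight_sum: "(\<And>x. x \<in> A \<Longrightarrow> g x \<in> straight k l) \<Longrightarrow> sum g A \<in> straight k l"
  by (induction A rule: infinite_finite_induct)
    (auto intro: straight_ideal plucker_ideal_zero straight_add)

lemma straight_base:
  assumes "p \<le> q"
  shows "mvar p * mvar q \<in> straight (length (indices p)) (length (indices q))"
  by (rule straightI[of _ "\<lambda>p' q'. if p' = p \<and> q' = q then 1 else 0"])
    (use assms in \<open>auto simp: quadratic_delta plucker_ideal_zero split: if_splits\<close>)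

lemma sum_subset_exchange:
  assumes "finite F"
  shows "(\<Sum>J | J \<subseteq> F \<and> card J = k. \<Sum>i\<in>F - J. h J (insert i J)) =
    (\<Sum>C | C \<subseteq> F \<and> card C = Suc k. \<Sum>i\<in>C. h (C - {i}) C)"
proof -
  have fin: "finite {J. J \<subseteq> F \<and> card J = k}" for k using assms by simp
  have sub: "J \<subseteq> F \<Longrightarrow> finite J" for J using assms by (rule rev_finite_subset)
  have "(\<Sum>J | J \<subseteq> F \<and> card J = k. \<Sum>i\<in>F - J. h J (insert i J)) =
    (\<Sum>(J, i)\<in>(SIGMA J:{J. J \<subseteq> F \<and> card J = k}. F - J). h J (insert i J))"
    using assms fin by (subst sum.Sigma) auto
  also have "\<dots> = (\<Sum>(C, i)\<in>(SIGMA C:{C. C \<subseteq> F \<and> card C = Suc k}. C). h (C - {i}) C)"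
    by (rule sum.reindex_bij_witness[of _ "\<lambda>(C, i). (C - {i}, i)" "\<lambda>(J, i). (insert i J, i)"])
      (auto simp: insert_absorb sub)
  also have "\<dots> = (\<Sum>C | C \<subseteq> F \<and> card C = Suc k. \<Sum>i\<in>C. h (C - {i}) C)"
    using fin sub by (subst sum.Sigma) auto
  finally show ?thesis .
qed

text \<open>The inverse of the inclusion matrix between the \<open>k\<close>-element and the \<open>k + 1\<close>-element subsets
  of a set with \<open>2 k + 1\<close> elements.\<close>

definition inclusion_inverse :: "nat \<Rightarrow> nat \<Rightarrow> complex" where
  "inclusion_inverse k s = (-1) ^ s * fact s * fact (k - s) / fact (Suc k)"

text \<open>Only \<open>s = card (C - B)\<close> matters: removing an element of
  \<open>C - B\<close> leaves \<open>s - 1\<close> elements outside \<open>B\<close>, removing one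
  of \<open>C \<inter> B\<close> leaves \<open>s\<close>. The claim becomes
  \<open>s * c (s - 1) + (k + 1 - s) * c s = 0\<close> for \<open>s > 0\<close> and
  \<open>(k + 1) * c 0 = 1\<close>, and this recursion has the factorial formula as its
  solution.\<close>

lemma inclusion_inverse:
  assumes fin: "finite F" and B: "B \<subseteq> F" "card B = Suc k" "card (F - B) = k"
    and C: "C \<subseteq> F" "card C = Suc k"
  shows "(\<Sum>i\<in>C. inclusion_inverse k (card (C - {i} - B))) = of_bool (C = B)"
proof -
  have finC: "finite C" "finite B" using fin B C by (auto intro: finite_subset)
  define s where "s = card (C - B)"
  have "card (C \<inter> B) + s = Suc k"
    using card_Int_Diff[OF finC(1), of B] C(2) by (simp add: s_def)
  have sk: "s \<le> k" using B(3) C(1) fin unfolding s_def by (metis Diff_mono card_mono finite_Diff order_refl)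
  have "(C - B) \<union> (C \<inter> B) = C" "(C - B) \<inter> (C \<inter> B) = {}" by auto
  then have "(\<Sum>i\<in>C. inclusion_inverse k (card (C - {i} - B))) =
    (\<Sum>i\<in>C - B. inclusion_inverse k (card (C - {i} - B))) + (\<Sum>i\<in>C \<inter> B. inclusion_inverse k (card (C - {i} - B)))"
    using finC sum.union_disjoint[of "C - B" "C \<inter> B" "\<lambda>i. inclusion_inverse k (card (C - {i} - B))"] by simp
  also have "(\<Sum>i\<in>C - B. inclusion_inverse k (card (C - {i} - B))) = of_nat s * inclusion_inverse k (s - 1)"
  proof -
    have "C - {i} - B = (C - B) - {i}" for i by auto
    then have "card (C - {i} - B) = s - 1" if "i \<in> C - B" for i
      using that finC unfolding s_def by simp
    then show ?thesis by (simp add: s_def)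
  qed
  also have "(\<Sum>i\<in>C \<inter> B. inclusion_inverse k (card (C - {i} - B))) = of_nat (Suc k - s) * inclusion_inverse k s"
  proof -
    have "C - {i} - B = C - B" if "i \<in> C \<inter> B" for i using that by auto
    then have "(\<Sum>i\<in>C \<inter> B. inclusion_inverse k (card (C - {i} - B))) = (\<Sum>i\<in>C \<inter> B. inclusion_inverse k s)"
      unfolding s_def by (intro sum.cong) auto
    moreover have "card (C \<inter> B) = Suc k - s" using \<open>card (C \<inter> B) + s = Suc k\<close> by simp
    ultimately show ?thesis by (simp only: sum_constant)
  qed
  also have "of_nat s * inclusion_inverse k (s - 1) + of_nat (Suc k - s) * inclusion_inverse k s = of_bool (s = 0)"
  proof (cases s)
    case 0
    have "1 + complex_of_nat k \<noteq> 0" using of_nat_neq_0[of k, where 'a = complex] by simp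
    then show ?thesis using 0 by (simp add: inclusion_inverse_def fact_reduce)
  next
    case (Suc t)
    have "Suc k - s = Suc (k - s)" "k - t = Suc (k - s)" using sk Suc by auto
    then show ?thesis using Suc by (simp add: inclusion_inverse_def field_simps del: of_nat_Suc)
  qed
  also have "s = 0 \<longleftrightarrow> C = B"
  proof
    assume "s = 0"
    then have "C \<subseteq> B" using finC by (simp add: s_def)
    then show "C = B" using finC B(2) C(2) by (simp add: card_subset_eq)
  qed (simp add: s_def)
  finally show ?thesis .
qed

lemma cnt_Un_disjoint:
  assumes "finite A" "finite B" "A \<inter> B = {}"
  shows "cnt (A \<union> B) z = cnt A z + cnt B z"
proof -
  have "{i \<in> A \<union> B. i \<le> z} = {i\<in>A. i \<le> z} \<union> {i\<in>B. i \<le> z}" by auto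
  then show ?thesis using assms by (auto simp: cnt_def intro!: card_Un_disjoint)
qed

text \<open>The largest \<open>z\<close> with more entries up to \<open>z\<close> in \<open>B\<close> than in \<open>A\<close> is moved to the left: with
  \<open>F\<close> the part of the symmetric difference up to \<open>z\<close>, the exchange relations for all sets \<open>J\<close>
  with \<open>r - 1\<close> elements in \<open>F\<close> are combined by the inverse of an inclusion matrix.\<close>

lemma straightening_bounded:
  assumes "plk_set TYPE('n::card2) A" "plk_set TYPE('n) B" "card B \<le> card A"
    and "\<forall>z\<ge>m. cnt B z \<le> cnt A z"
  shows "mvar (plk A) * mvar (plk B) \<in> (straight (card A) (card B) :: ('n plucker, complex) mvpoly set)"
  using assms
proof (induction m arbitrary: A B)
  case (0 A B)
  have ind: "indices (plk A :: 'n plucker) = slist A" "indices (plk B :: 'n plucker) = slist B"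
    using 0 by (simp_all add: indices_plk)
  have fin: "finite A" "finite B" using 0 by (auto simp: plk_set_def intro: finite_subset)
  have "plk A \<le> (plk B :: 'n plucker)"
    using 0(4) fin by (simp add: plucker_le_iff pcnt_def ind)
  from straight_base[OF this] show ?case by (simp add: ind)
next
  case (Suc m A B)
  let ?S = "straight (card A) (card B) :: ('n plucker, complex) mvpoly set"
  have fin: "finite A" "finite B" using Suc.prems by (auto simp: plk_set_def intro: finite_subset)
  show ?case
  proof (cases "cnt B m \<le> cnt A m")
    case True
    have "\<forall>z\<ge>m. cnt B z \<le> cnt A z"
    proof (intro allI impI)
      fix z assume "m \<le> z"
      then show "cnt B z \<le> cnt A z" using True Suc.prems(4) by (cases "z = m") auto
    qed
    then show ?thesis using Suc by blast
  next
    case False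
    have "cnt B (Suc m) \<le> cnt A (Suc m)" using Suc.prems by simp
    \<comment> \<open>Counts grow by at most one per step, so the order holding at
      \<open>Suc m\<close> limits the excess at \<open>m\<close> to one.\<close>
    then have Bm: "cnt B m = Suc (cnt A m)"
      using False by (cases "Suc m \<in> A"; cases "Suc m \<in> B") (simp_all add: cnt_Suc fin)
    define S D B' B'' F where "S = A \<inter> B" and "D = (A - B) \<union> (B - A)"
      and "B' = {i\<in>B - A. i \<le> m}" and "B'' = {i\<in>B - A. m < i}" and "F = {i\<in>D. i \<le> m}"
    have fin': "finite S" "finite D" "finite B'" "finite B''" "finite F"
      using fin by (simp_all add: S_def D_def B'_def B''_def F_def)
    have SD: "S \<inter> D = {}" "S \<subseteq> {1..CARD('n)}" "D \<subseteq> {1..CARD('n)}"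
      using Suc.prems(1,2) by (auto simp: S_def D_def plk_set_def)
    have A: "A = S \<union> (D - (B - A))" and B: "B = S \<union> (B - A)" by (auto simp: S_def D_def)
    have BA: "B - A = B' \<union> B''" "B' \<inter> B'' = {}" by (auto simp: B'_def B''_def)
    have cA: "cnt A z = cnt S z + cnt (A - B) z" and cB: "cnt B z = cnt S z + cnt (B - A) z" 
      and cD: "cnt D z = cnt (A - B) z + cnt (B - A) z" for z
    proof -
      have "S \<union> (A - B) = A" "S \<union> (B - A) = B" "S \<inter> (A - B) = {}" "S \<inter> (B - A) = {}"
        by (auto simp: S_def)
      then show "cnt A z = cnt S z + cnt (A - B) z" "cnt B z = cnt S z + cnt (B - A) z"
        using cnt_Un_disjoint[of S "A - B" z] cnt_Un_disjoint[of S "B - A" z] fin fin' by simp_all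
      show "cnt D z = cnt (A - B) z + cnt (B - A) z"
        unfolding D_def using fin by (intro cnt_Un_disjoint) auto
    qed
    obtain k where k: "card B' = Suc k" "card (F - B') = k"
    proof -
      have "cnt (B - A) m = card B'" by (simp add: cnt_def B'_def)
      moreover have "F - B' = {i\<in>A - B. i \<le> m}" by (auto simp: F_def D_def B'_def)
      then have "cnt (A - B) m = card (F - B')" by (simp add: cnt_def)
      ultimately show ?thesis using that cA[of m] cB[of m] Bm by simp
    qed
    have B'F: "B' \<subseteq> F" by (auto simp: B'_def F_def D_def)
    have cardBA: "card (B - A) = Suc k + card B''" using BA k fin' by (simp add: card_Un_disjoint)
    have cards: "card A = card S + card (A - B)" "card B = card S + card (B - A)" "card D = card (A - B) + card (B - A)"
    proof -
      show "card A = card S + card (A - B)" unfolding S_def using fin(1) by (rule card_Int_Diff)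
      show "card B = card S + card (B - A)" unfolding S_def Int_commute[of A] using fin(2) by (rule card_Int_Diff)
      show "card D = card (A - B) + card (B - A)"
        unfolding D_def using fin by (intro card_Un_disjoint) auto
    qed
    let ?e = "twisted_product S D :: nat set \<Rightarrow> ('n plucker, complex) mvpoly"
    \<comment> \<open>If an entry above \<open>m\<close> is exchanged, only \<open>k\<close>
      elements of \<open>F\<close> remain in the second column, so its excess at \<open>m\<close> is
      gone, and beyond \<open>m\<close> its counts are at most those of \<open>B\<close>. The
      induction hypothesis applies.\<close>
    have good: "?e (insert i (J \<union> B'')) \<in> ?S" if J: "J \<subseteq> F" "card J = k" and i: "i \<in> D" "m < i" "i \<notin> B''" for J i
    proof -
      define C where "C = insert i (J \<union> B'')"
      have CD: "C \<subseteq> D" using J i by (auto simp: C_def F_def B''_def D_def)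
      have finJ: "finite J" using J fin' finite_subset by blast
      have "J \<inter> B'' = {}" "i \<notin> J" using J i by (auto simp: F_def B''_def)
      then have cC: "cnt C z = cnt J z + cnt B'' z + of_bool (i \<le> z)" for z
        using i finJ fin' by (simp add: C_def cnt_insert cnt_Un_disjoint)
      have cardC: "card C = card (B - A)"
        using \<open>J \<inter> B'' = {}\<close> \<open>i \<notin> J\<close> i finJ fin' J by (simp add: C_def card_Un_disjoint cardBA)
      have finC: "finite C" using CD fin' finite_subset by blast
      let ?A = "S \<union> (D - C)" and ?B = "S \<union> C"
      have disj: "S \<inter> (D - C) = {}" "S \<inter> C = {}" using SD CD by auto
      have cardAB: "card ?A = card A" "card ?B = card B"
      proof -
        have "card (D - C) = card (A - B)"
          using CD finC cards(3) cardC by (simp add: card_Diff_subset)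
        then show "card ?A = card A" "card ?B = card B"
          using disj fin' finC cards cardC by (simp_all add: card_Un_disjoint)
      qed
      have "cnt ?B z \<le> cnt ?A z" if z: "m \<le> z" for z
      proof -
        have "cnt D z = cnt C z + cnt (D - C) z"
          using cnt_Un_disjoint[of C "D - C" z] CD finC fin' by (simp add: Un_absorb1)
        moreover have "cnt ?B z = cnt S z + cnt C z" "cnt ?A z = cnt S z + cnt (D - C) z"
          using cnt_Un_disjoint[OF _ _ disj(1), of z] cnt_Un_disjoint[OF _ _ disj(2), of z] fin' finC by simp_all
        moreover have "{x\<in>J. x \<le> z} = J" using J z by (auto simp: F_def)
        then have "cnt J z = k" using J by (simp add: cnt_def)
        moreover have "{x\<in>B'. x \<le> z} = B'" using z by (auto simp: B'_def)
        then have "cnt (B - A) z = Suc k + cnt B'' z"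
          unfolding BA(1) using k BA(2) fin' by (simp add: cnt_Un_disjoint) (simp add: cnt_def)
        moreover have "cnt (B - A) z \<le> cnt (A - B) z" if "m < z"
          using Suc.prems(4) that cA[of z] cB[of z] by (metis Suc_leI add_le_cancel_left)
        moreover have "cnt (B - A) m = Suc (cnt (A - B) m)" using Bm cA[of m] cB[of m] by simp
        ultimately show ?thesis using cC[of z] cD[of z] z i(2) by (cases "z = m") (auto split: if_splits)
      qed
      moreover have "plk_set TYPE('n) ?A" "plk_set TYPE('n) ?B"
        using Suc.prems(1,2) cardAB SD CD by (auto simp: plk_set_def)
      ultimately have "mvar (plk ?A) * mvar (plk ?B) \<in> ?S"
        using Suc.IH[of ?A ?B] cardAB Suc.prems(3) by simp
      then show ?thesis unfolding twisted_product_def C_def[symmetric] by (rule straight_scale)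
    qed
    \<comment> \<open>In the exchange relation for \<open>J \<union> B''\<close> the terms with
      \<open>i\<close> above \<open>m\<close> are straight by \<open>good\<close>; hence so is the
      sum of the others. The condition on cardinalities amounts to \<open>B\<close> not being longer
      than \<open>A\<close>.\<close>
    have rel: "(\<Sum>i\<in>F - J. ?e (insert i (J \<union> B''))) \<in> ?S" if J: "J \<subseteq> F" "card J = k" for J
    proof -
      let ?J = "J \<union> B''" and ?R = "{i\<in>D. m < i \<and> i \<notin> B''}"
      have finJ: "finite J" using J fin' finite_subset by blast
      have JD: "?J \<subseteq> D" using J by (auto simp: F_def B''_def D_def)
      have "J \<inter> B'' = {}" using J by (auto simp: F_def B''_def)
      then have "card ?J = k + card B''" using J finJ fin' by (simp add: card_Un_disjoint)
      then have "2 * card ?J + 2 \<le> card D" using cards Suc.prems(3) cardBA by simp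
      then have *: "(\<Sum>i\<in>D - ?J. ?e (insert i ?J)) \<in> plucker_ideal"
        by (rule twisted_exchange[OF SD(2,3,1) JD])
      have "D - ?J = (F - J) \<union> ?R" "(F - J) \<inter> ?R = {}"
        using J by (auto simp: F_def B''_def)
      then have "(\<Sum>i\<in>F - J. ?e (insert i ?J)) = (\<Sum>i\<in>D - ?J. ?e (insert i ?J)) - (\<Sum>i\<in>?R. ?e (insert i ?J))"
        using fin' by (simp add: sum.union_disjoint)
      moreover have "(\<Sum>i\<in>?R. ?e (insert i ?J)) \<in> ?S"
        using good[OF J] by (intro straight_sum) auto
      ultimately show ?thesis
        using straight_diff[OF straight_ideal[OF *]] by simp
    qed
    \<comment> \<open>Weighting these sums with \<open>inclusion_inverse\<close> cancels every
      product except the one for \<open>B'\<close>, which up to sign is the given product.\<close>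
    let ?E = "\<lambda>C. ?e (C \<union> B'')"
    let ?c = "\<lambda>J. mconst (inclusion_inverse k (card (J - B'))) :: ('n plucker, complex) mvpoly"
    have "(\<Sum>J | J \<subseteq> F \<and> card J = k. ?c J * (\<Sum>i\<in>F - J. ?e (insert i (J \<union> B'')))) \<in> ?S"
      by (rule straight_sum, rule straight_scale, rule rel) auto
    also have "(\<Sum>J | J \<subseteq> F \<and> card J = k. ?c J * (\<Sum>i\<in>F - J. ?e (insert i (J \<union> B'')))) =
      (\<Sum>J | J \<subseteq> F \<and> card J = k. \<Sum>i\<in>F - J. ?c J * ?E (insert i J))"
      by (simp add: sum_distrib_left)
    also have "\<dots> = (\<Sum>C | C \<subseteq> F \<and> card C = Suc k. \<Sum>i\<in>C. ?c (C - {i}) * ?E C)"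
      by (rule sum_subset_exchange[OF fin'(5)])
    also have "\<dots> = (\<Sum>C | C \<subseteq> F \<and> card C = Suc k. if C = B' then ?E B' else 0)"
    proof (intro sum.cong refl)
      fix C assume "C \<in> {C. C \<subseteq> F \<and> card C = Suc k}"
      then have inv: "(\<Sum>i\<in>C. inclusion_inverse k (card (C - {i} - B'))) = of_bool (C = B')"
        by (intro inclusion_inverse[OF fin'(5) B'F k]) auto
      have msum: "mconst (sum g X) = (\<Sum>x\<in>X. mconst (g x) :: ('n plucker, complex) mvpoly)" for g and X :: "nat set"
        by (induction X rule: infinite_finite_induct) (simp_all add: const_hom.add)
      have "(\<Sum>i\<in>C. ?c (C - {i}) * ?E C) = mconst (of_bool (C = B')) * ?E C"
        unfolding inv[symmetric] msum by (simp add: sum_distrib_right)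
      then show "(\<Sum>i\<in>C. ?c (C - {i}) * ?E C) = (if C = B' then ?E B' else 0)" by simp
    qed
    also have "\<dots> = ?E B'" using fin' B'F k by simp
    finally have "?e (B - A) \<in> ?S" by (simp add: BA)
    then have "mconst (\<Prod>i\<in>B - A. rank_sign D i) * ?e (B - A) \<in> ?S" by (rule straight_scale)
    moreover have "rank_sign D i * rank_sign D i = 1" for i by (simp add: rank_sign_def flip: power_add)
    then have "(\<Prod>i\<in>B - A. rank_sign D i) * (\<Prod>i\<in>B - A. rank_sign D i) = 1"
      by (simp flip: prod.distrib)
    then have "mconst (\<Prod>i\<in>B - A. rank_sign D i) * ?e (B - A) = mvar (plk A) * mvar (plk B)"
      unfolding twisted_product_def A[symmetric] B[symmetric]
      by (simp flip: mult.assoc const_hom.mult)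
    ultimately show ?thesis by simp
  qed
qed

lemma product_straight:
  assumes "length (indices b) \<le> length (indices a)"
  shows "mvar a * mvar b \<in> straight (length (indices a)) (length (indices (b :: 'n::card2 plucker)))"
proof -
  have c: "card (set (indices a)) = length (indices a)" for a :: "'n plucker"
    by (simp add: distinct_card distinct_indices)
  have "\<forall>z\<ge>CARD('n). cnt (set (indices b)) z \<le> cnt (set (indices a)) z"
    using pcnt_large assms unfolding pcnt_def by metis
  then show ?thesis
    using straightening_bounded[OF plk_set_indices[of a] plk_set_indices[of b]] assms by (simp add: c)
qed

section \<open>Independence of standard monomials\<close>

definition monic_of :: "complex poly \<Rightarrow> nat \<Rightarrow> bool" where
  "monic_of p d \<longleftrightarrow> degree p = d \<and> lead_coeff p = 1"

lemma monic_ofI: "coeff p d = 1 \<Longrightarrow> (\<And>e. d < e \<Longrightarrow> coeff p e = 0) \<Longrightarrow> monic_of p d"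
  unfolding monic_of_def by (metis degree_le le_degree le_antisym zero_neq_one)

lemma monic_of_mult: "monic_of p d \<Longrightarrow> monic_of q e \<Longrightarrow> monic_of (p * q) (d + e)"
  unfolding monic_of_def by (metis degree_mult_eq lead_coeff_mult leading_coeff_0_iff mult_1 zero_neq_one)

lemma monic_of_1: "monic_of 1 0"
  by (simp add: monic_of_def)

lemma monic_of_power: "monic_of p d \<Longrightarrow> monic_of (p ^ k) (k * d)"
  by (induction k) (simp_all add: monic_of_1 monic_of_mult)

lemma monic_of_prod: "(\<And>x. x \<in> A \<Longrightarrow> monic_of (g x) (d x)) \<Longrightarrow> monic_of (prod g A) (sum d A)"
  by (induction A rule: infinite_finite_induct) (simp_all add: monic_of_1 monic_of_mult)

lemma monic_of_nonzero: "\<not> monic_of 0 d"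
  by (simp add: monic_of_def)

section \<open>Evaluation at matrices with entries in one indeterminate\<close>

interpretation poly_hom: coefficient_hom "\<lambda>c::complex. [:c:]"
  by unfold_locales (simp_all add: one_pCons)

lemma extend_plucker_minor:
  "poly_hom.extend z (plucker_minor a) = leading_minor z (indices a)"
proof -
  interpret H: comm_ring_hom "poly_hom.extend z"
    by unfold_locales (simp_all add: poly_hom.extend_add poly_hom.extend_mult)
  let ?k = "length (indices a)"
  let ?A = "Matrix.mat ?k ?k (\<lambda>(r, s). mvar (r + 1, indices a ! s))"
  have "poly_hom.extend z (plucker_minor a) = Determinant.det (map_mat (poly_hom.extend z) ?A)"
    by (simp add: plucker_minor_def Let_def)
  also have "map_mat (poly_hom.extend z) ?A = Matrix.mat ?k ?k (\<lambda>(r, s). z (r + 1, indices a ! s))"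
    by (rule eq_matI) auto
  finally show ?thesis by (simp add: leading_minor_def)
qed

text \<open>Later positions in the lexicographic order of (row, column) get a smaller weight, so that the
  diagonal term of a minor dominates.\<close>

definition wt :: "nat \<Rightarrow> nat \<Rightarrow> nat \<Rightarrow> nat \<Rightarrow> nat" where
  "wt n M r s = M ^ (Suc n * Suc n - (r * Suc n + s))"

text \<open>Let \<open>r\<close> be the first row moved by \<open>\<sigma>\<close>. There the column
  moves to the right, so in all rows from \<open>r\<close> on the terms of \<open>\<sigma>\<close>
  sit at later positions than the diagonal entry of row \<open>r\<close>. Each of these at most
  \<open>n\<close> weights is smaller by a factor of at least \<open>M > n\<close>, so their sum
  stays below that single diagonal weight.\<close>

lemma wt_dominance:
  assumes sorted: "sorted_wrt (<) xs" and set: "set xs \<subseteq> {1..n}" and len: "length xs \<le> n"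
    and M: "n < M" and \<sigma>: "\<sigma> permutes {0..<length xs}" "\<sigma> \<noteq> id"
  shows "(\<Sum>i<length xs. wt n M i (xs ! \<sigma> i)) < (\<Sum>i<length xs. wt n M i (xs ! i))"
proof -
  let ?k = "length xs"
  have le: "xs ! i \<le> n" if "i < ?k" for i using subsetD[OF set nth_mem[OF that]] by simp
  have ex: "\<exists>i. \<sigma> i \<noteq> i" using \<sigma>(2) by (auto simp: fun_eq_iff)
  define r where "r = (LEAST i. \<sigma> i \<noteq> i)"
  have r: "\<sigma> r \<noteq> r" unfolding r_def using ex by (rule LeastI_ex)
  have below: "\<sigma> i = i" if "i < r" for i using not_less_Least[OF that[unfolded r_def]] by simp
  have rk: "r < ?k" using r \<sigma>(1) by (metis permutes_not_in atLeastLessThan_iff zero_le)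
  have \<sigma>k: "\<sigma> i < ?k" if "i < ?k" for i using permutes_in_image[OF \<sigma>(1)] that by auto
  have inj: "\<sigma> i = \<sigma> j \<Longrightarrow> i = j" for i j using permutes_inj[OF \<sigma>(1)] by (auto dest: injD)
  have "r < \<sigma> r" using r below[of "\<sigma> r"] inj[of "\<sigma> r" r] by (metis linorder_neqE_nat)
  then have colr: "xs ! r < xs ! \<sigma> r" using sorted_wrt_nth_less[OF sorted] \<sigma>k[OF rk] by blast
  let ?E = "Suc n * Suc n - (r * Suc n + xs ! r)"
  have "r * Suc n + xs ! r < Suc n * Suc n"
  proof -
    have "r * Suc n + xs ! r \<le> r * Suc n + n" using le[OF rk] by simp
    also have "\<dots> < Suc r * Suc n" by simp
    also have "\<dots> \<le> Suc n * Suc n" using rk len by (intro mult_le_mono) auto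
    finally show ?thesis .
  qed
  then have E: "0 < ?E" by simp
  have small: "wt n M i (xs ! \<sigma> i) \<le> M ^ (?E - 1)" if i: "r \<le> i" "i < ?k" for i
  proof -
    have "r * Suc n + xs ! r < i * Suc n + xs ! \<sigma> i"
    proof (cases "i = r")
      case False
      then have "Suc r * Suc n \<le> i * Suc n" using i by (intro mult_le_mono) auto
      then show ?thesis using le[OF rk] by simp
    qed (use colr in simp)
    then have "Suc n * Suc n - (i * Suc n + xs ! \<sigma> i) \<le> ?E - 1" by simp
    then show ?thesis unfolding wt_def using M by (intro power_increasing) auto
  qed
  have split: "(\<Sum>i<?k. f i) = (\<Sum>i<r. f i) + (\<Sum>i\<in>{r..<?k}. f i)" for f :: "nat \<Rightarrow> nat"
    using rk by (simp add: lessThan_atLeast0 sum.atLeastLessThan_concat)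
  have "(\<Sum>i\<in>{r..<?k}. wt n M i (xs ! \<sigma> i)) \<le> of_nat (card {r..<?k}) * M ^ (?E - 1)"
    by (rule sum_bounded_above) (use small in auto)
  also have "\<dots> \<le> n * M ^ (?E - 1)" using len by (intro mult_right_mono) simp_all
  also have "\<dots> < M * M ^ (?E - 1)" using M by simp
  also have "\<dots> = wt n M r (xs ! r)" by (simp only: wt_def mult.commute[of M] power_minus_mult[OF E])
  also have "\<dots> \<le> (\<Sum>i\<in>{r..<?k}. wt n M i (xs ! i))"
    using rk by (intro member_le_sum) auto
  finally show ?thesis using below by (simp add: split)
qed

text \<open>Positions outside \<open>U\<close> are the prescribed zeros. Rows of minors count from 1
  but list positions from 0, hence \<open>r - 1\<close>.\<close>

definition pattern_matrix :: "nat \<Rightarrow> nat \<Rightarrow> (nat \<Rightarrow> nat \<Rightarrow> bool) \<Rightarrow> nat \<times> nat \<Rightarrow> complex poly" where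
  "pattern_matrix n M U = (\<lambda>(r, s). if U (r - 1) s then monom 1 (wt n M (r - 1) s) else 0)"

lemma prod_pattern:
  "(\<Prod>i<k. pattern_matrix n M U (Suc i, c i)) =
    (if \<forall>i<k. U i (c i) then monom 1 (\<Sum>i<k. wt n M i (c i)) else 0)"
  by (induction k) (auto simp: pattern_matrix_def mult_monom less_Suc_eq)

lemma leading_minor_pattern:
  "leading_minor (pattern_matrix n M U) xs = (\<Sum>\<sigma> | \<sigma> permutes {0..<length xs}. signof \<sigma> *
     (if \<forall>i<length xs. U i (xs ! \<sigma> i) then monom 1 (\<Sum>i<length xs. wt n M i (xs ! \<sigma> i)) else 0))"
proof -
  let ?k = "length xs"
  have "(\<Prod>i = 0..<?k. Matrix.mat ?k ?k (\<lambda>(r, s). pattern_matrix n M U (r + 1, xs ! s)) $$ (i, \<sigma> i)) =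
    (\<Prod>i<?k. pattern_matrix n M U (Suc i, xs ! \<sigma> i))" if "\<sigma> permutes {0..<?k}" for \<sigma>
    using that by (intro prod.cong) (use permutes_in_image[OF that] in \<open>auto simp: lessThan_atLeast0\<close>)
  then show ?thesis
    unfolding leading_minor_def by (subst det_def'[of _ ?k]) (simp_all add: prod_pattern)
qed

lemma leading_minor_pattern_zero:
  assumes "\<And>\<sigma>. \<sigma> permutes {0..<length xs} \<Longrightarrow> \<exists>i<length xs. \<not> U i (xs ! \<sigma> i)"
  shows "leading_minor (pattern_matrix n M U) xs = 0"
  unfolding leading_minor_pattern by (rule sum.neutral) (use assms in fastforce)

text \<open>By \<open>wt_dominance\<close> every permutation other than the identity contributes a
  smaller degree, and the identity contributes a nonzero term as the whole diagonal lies in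
  \<open>U\<close>.\<close>

lemma leading_minor_pattern_monic:
  assumes sorted: "sorted_wrt (<) xs" and set: "set xs \<subseteq> {1..n}" and len: "length xs \<le> n"
    and M: "n < M" and U: "\<forall>i<length xs. U i (xs ! i)"
  shows "monic_of (leading_minor (pattern_matrix n M U) xs) (\<Sum>i<length xs. wt n M i (xs ! i))"
proof (rule monic_ofI)
  let ?k = "length xs" and ?d = "\<Sum>i<length xs. wt n M i (xs ! i)"
  let ?P = "{\<sigma>. \<sigma> permutes {0..<?k}}"
  let ?t = "\<lambda>\<sigma>. (signof \<sigma> :: complex poly) *
     (if \<forall>i<length xs. U i (xs ! \<sigma> i) then monom 1 (\<Sum>i<length xs. wt n M i (xs ! \<sigma> i)) else 0)"
  have fin: "finite ?P" by (simp add: finite_permutations)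
  have id: "id \<in> ?P" by (simp add: permutes_id)
  have "leading_minor (pattern_matrix n M U) xs = ?t id + sum ?t (?P - {id})"
    unfolding leading_minor_pattern using sum.remove[OF fin id, of ?t] by simp
  moreover have "?t id = monom 1 ?d" using U by simp
  moreover have "coeff (?t \<sigma>) e = 0" if "\<sigma> \<in> ?P - {id}" "?d \<le> e" for \<sigma> e
  proof -
    have "(\<Sum>i<?k. wt n M i (xs ! \<sigma> i)) < ?d"
      using that by (intro wt_dominance[OF sorted set len M]) auto
    then show ?thesis using that(2) by (auto simp: sign_def)
  qed
  ultimately have c: "coeff (leading_minor (pattern_matrix n M U) xs) e = of_bool (e = ?d)" if "?d \<le> e" for e
    using that by (simp add: coeff_sum)
  then show "coeff (leading_minor (pattern_matrix n M U) xs) ?d = 1" by simp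
  show "coeff (leading_minor (pattern_matrix n M U) xs) e = 0" if "?d < e" for e
    using c[of e] that by simp
qed

section \<open>Diagonal degrees determine standard monomials\<close>

lemma digit_sum_less:
  assumes "finite S" "inj_on pos S" "\<And>x. x \<in> S \<Longrightarrow> pos x < k" "\<And>x. x \<in> S \<Longrightarrow> f x < M"
    and M: "0 < (M::nat)"
  shows "(\<Sum>x\<in>S. f x * M ^ pos x) < M ^ k"
proof -
  have geo: "(\<Sum>i<k. (M - 1) * M ^ i) < M ^ k" for k
  proof -
    obtain M' where "M = Suc M'" using M by (cases M) auto
    then show ?thesis by (induction k) simp_all
  qed
  have "(\<Sum>x\<in>S. f x * M ^ pos x) \<le> (\<Sum>x\<in>S. (M - 1) * M ^ pos x)"
    using assms(4) by (intro sum_mono mult_right_mono) fastforce+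
  also have "\<dots> = (\<Sum>i\<in>pos ` S. (M - 1) * M ^ i)"
    using assms(2) by (simp add: sum.reindex)
  also have "\<dots> \<le> (\<Sum>i<k. (M - 1) * M ^ i)"
    using assms(3) by (intro sum_mono2) auto
  also have "\<dots> < M ^ k" by (rule geo)
  finally show ?thesis .
qed

text \<open>Uniqueness of digits in base \<open>M\<close>, at positions that need not be
  consecutive; the induction removes the highest position.\<close>

lemma digits_unique:
  assumes "finite P" "inj_on pos P" "\<And>x. x \<in> P \<Longrightarrow> f x < M" "\<And>x. x \<in> P \<Longrightarrow> g x < M"
    and "(\<Sum>x\<in>P. f x * M ^ pos x) = (\<Sum>x\<in>P. g x * M ^ pos x)" and "0 < (M::nat)"
  shows "\<forall>x\<in>P. f x = g x"
  using assms
proof (induction P rule: finite_ranking_induct[where f = pos])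
  case (insert x S)
  show ?case
  proof (cases "x \<in> S")
    case True
    then show ?thesis using insert by (simp add: insert_absorb)
  next
    case False
    have lt: "pos y < pos x" if "y \<in> S" for y
      using insert.hyps(2)[OF that] insert.prems(1) that False by (auto simp: le_neq_implies_less inj_on_def)
    have inj: "inj_on pos S" using insert.prems(1) by simp
    have b: "(\<Sum>y\<in>S. f y * M ^ pos y) < M ^ pos x" "(\<Sum>y\<in>S. g y * M ^ pos y) < M ^ pos x"
      using insert.prems lt by (auto intro!: digit_sum_less insert.hyps inj)
    have eq: "f x * M ^ pos x + (\<Sum>y\<in>S. f y * M ^ pos y) = g x * M ^ pos x + (\<Sum>y\<in>S. g y * M ^ pos y)"
      using insert.prems(4) False insert.hyps(1) by simp
    then have "(f x * M ^ pos x + (\<Sum>y\<in>S. f y * M ^ pos y)) div M ^ pos x =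
        (g x * M ^ pos x + (\<Sum>y\<in>S. g y * M ^ pos y)) div M ^ pos x" by simp
    then have "f x = g x" using b \<open>0 < M\<close> by (simp add: div_add1_eq)
    moreover have "\<forall>y\<in>S. f y = g y"
      by (rule insert.IH[OF inj]) (use insert.prems eq \<open>f x = g x\<close> in auto)
    ultimately show ?thesis by simp
  qed
qed simp

text \<open>This is the exponent of the variable in row \<open>r + 1\<close> and column
  \<open>s\<close> in the product of the diagonal terms of the minors.\<close>

definition row_count :: "('n::card2 plucker \<Rightarrow>\<^sub>0 nat) \<Rightarrow> nat \<Rightarrow> nat \<Rightarrow> nat" where
  "row_count m r s = (\<Sum>a\<in>UNIV. lookup m a * of_bool (r < length (indices a) \<and> indices a ! r = s))"

definition diagonal_degree :: "nat \<Rightarrow> ('n::card2 plucker \<Rightarrow>\<^sub>0 nat) \<Rightarrow> nat" where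
  "diagonal_degree M m =
    (\<Sum>a\<in>UNIV. lookup m a * (\<Sum>r<length (indices a). wt CARD('n) M r (indices a ! r)))"

lemma diagonal_degree_row_count:
  "diagonal_degree M (m :: 'n::card2 plucker \<Rightarrow>\<^sub>0 nat) =
    (\<Sum>(r, s)\<in>{..<CARD('n)} \<times> {..CARD('n)}. row_count m r s * wt CARD('n) M r s)"
proof -
  let ?n = "CARD('n)"
  have eq: "(\<Sum>r<length (indices a). wt ?n M r (indices a ! r)) =
    (\<Sum>(r, s)\<in>{..<?n} \<times> {..?n}. of_bool (r < length (indices a) \<and> indices a ! r = s) * wt ?n M r s)" for a :: "'n plucker"
  proof -
    have "(\<Sum>(r, s)\<in>{..<?n} \<times> {..?n}. of_bool (r < length (indices a) \<and> indices a ! r = s) * wt ?n M r s) =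
      (\<Sum>r<?n. \<Sum>s\<le>?n. if indices a ! r = s then of_bool (r < length (indices a)) * wt ?n M r s else 0)"
      by (subst sum.cartesian_product[symmetric], intro sum.cong refl) simp
    also have "\<dots> = (\<Sum>r<?n. of_bool (indices a ! r \<le> ?n) * of_bool (r < length (indices a)) * wt ?n M r (indices a ! r))"
      by (intro sum.cong) auto
    also have "\<dots> = (\<Sum>r<length (indices a). of_bool (indices a ! r \<le> ?n) * of_bool (r < length (indices a)) * wt ?n M r (indices a ! r))"
      using length_indices[of a] by (intro sum.mono_neutral_right) auto
    also have "\<dots> = (\<Sum>r<length (indices a). wt ?n M r (indices a ! r))"
    proof (intro sum.cong refl)
      fix r assume "r \<in> {..<length (indices a)}"
      then have "r < length (indices a)" by simp
      then have "indices a ! r \<le> ?n" using set_indices_subset[of a] nth_mem by fastforce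
      then show "of_bool (indices a ! r \<le> ?n) * of_bool (r < length (indices a)) * wt ?n M r (indices a ! r) =
        wt ?n M r (indices a ! r)" using \<open>r < length (indices a)\<close> by simp
    qed
    finally show ?thesis ..
  qed
  have "diagonal_degree M m = (\<Sum>a\<in>UNIV. \<Sum>(r, s)\<in>{..<?n} \<times> {..?n}.
      lookup m a * of_bool (r < length (indices a) \<and> indices a ! r = s) * wt ?n M r s)"
    unfolding diagonal_degree_def eq sum_distrib_left by (intro sum.cong refl) (auto simp: mult.assoc)
  also have "\<dots> = (\<Sum>(r, s)\<in>{..<?n} \<times> {..?n}. row_count m r s * wt ?n M r s)"
    unfolding row_count_def case_prod_unfold sum_distrib_right by (rule sum.swap)
  finally show ?thesis .
qed

lemma row_count_sum:
  "(\<Sum>s\<le>z. row_count m r s) = (\<Sum>a\<in>UNIV. lookup m a * of_bool (r < pcnt a z))"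
proof -
  have "(\<Sum>s\<le>z. row_count m r s) =
    (\<Sum>a\<in>UNIV. \<Sum>s\<le>z. lookup m a * of_bool (r < length (indices a) \<and> indices a ! r = s))"
    unfolding row_count_def by (rule sum.swap)
  also have "\<dots> = (\<Sum>a\<in>UNIV. \<Sum>s\<le>z. if indices a ! r = s then lookup m a * of_bool (r < length (indices a)) else 0)"
    by (intro sum.cong refl) auto
  also have "\<dots> = (\<Sum>a\<in>UNIV. lookup m a * of_bool (r < pcnt a z))"
    by (intro sum.cong refl) (simp add: less_pcnt_iff)
  finally show ?thesis .
qed

lemma plucker_le_iff_rows: "a \<le> c \<longleftrightarrow> (\<forall>r<length (indices c). r < pcnt a (indices c ! r))"
proof
  show "\<forall>r<length (indices c). r < pcnt a (indices c ! r)" if "a \<le> c"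
    using that by (auto simp: less_pcnt_iff less_eq_plucker_def)
  assume *: "\<forall>r<length (indices c). r < pcnt a (indices c ! r)"
  then have "length (indices c) - 1 < length (indices a)"
    using length_indices(1)[of c] by (simp add: less_pcnt_iff)
  then show "a \<le> c" using * by (auto simp: less_pcnt_iff less_eq_plucker_def)
qed

definition lower_degree :: "('n::card2 plucker \<Rightarrow>\<^sub>0 nat) \<Rightarrow> 'n plucker \<Rightarrow> nat" where
  "lower_degree m c = (\<Sum>a\<in>UNIV. lookup m a * of_bool (a \<le> c))"

text \<open>For each row \<open>r\<close> of \<open>c\<close>, the columns of \<open>m\<close> whose
  entry in row \<open>r\<close> exists and is at most that of \<open>c\<close> form a lower set of a
  chain. Such sets are nested, so their intersection, which consists of the columns below
  \<open>c\<close>, is the smallest of them. Each single set is counted by row counts alone.\<close>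

lemma lower_degree_Min:
  assumes "standard m"
  shows "lower_degree m c = Min ((\<lambda>r. \<Sum>s\<le>indices c ! r. row_count m r s) ` {..<length (indices c)})"
    (is "_ = Min (?T ` ?R)")
proof -
  define D where "D r = {a\<in>keys m. r < pcnt a (indices c ! r)}" for r
  have R: "finite ?R" "?R \<noteq> {}" using length_indices(1)[of c] by (auto simp: lessThan_empty_iff)
  have le: "lower_degree m c \<le> ?T r" if "r \<in> ?R" for r
    unfolding lower_degree_def row_count_sum
    using that by (intro sum_mono mult_left_mono) (auto simp: plucker_le_iff_rows)
  obtain r0 where r0: "r0 \<in> ?R" "\<forall>r\<in>?R. card (D r0) \<le> card (D r)"
    using arg_min_if_finite[OF R, of "\<lambda>r. card (D r)"] by (metis not_le)
  have "D r0 \<subseteq> D r" if r: "r \<in> ?R" for r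
  proof (rule ccontr)
    assume no: "\<not> D r0 \<subseteq> D r"
    then obtain x where x: "x \<in> D r0" "x \<notin> D r" by blast
    have "D r \<subseteq> D r0"
    proof
      fix y assume y: "y \<in> D r"
      then have "x \<le> y \<or> y \<le> x" using x(1) assms by (auto simp: D_def standard_def incomparable_def)
      then show "y \<in> D r0"
      proof
        assume "x \<le> y"
        then have "x \<in> D r" using y x(1) unfolding plucker_le_iff D_def by (auto intro: less_le_trans)
        then show ?thesis using x(2) by simp
      next
        assume "y \<le> x"
        then show ?thesis using y x(1) unfolding plucker_le_iff D_def by (auto intro: less_le_trans)
      qed
    qed
    then have "D r \<subset> D r0" using no by blast
    then have "card (D r) < card (D r0)" by (intro psubset_card_mono) (auto simp: D_def)
    then show False using r0(2)[rule_format, OF r] by simp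
  qed
  then have eq: "lookup m a * of_bool (r0 < pcnt a (indices c ! r0)) = lookup m a * of_bool (a \<le> c)" for a
    using r0(1) by (cases "a \<in> keys m") (auto simp: plucker_le_iff_rows D_def not_in_keys_iff_lookup_eq_zero)
  have "lower_degree m c = ?T r0"
    unfolding lower_degree_def row_count_sum eq ..
  then show ?thesis
    using le r0(1) R by (intro antisym) (auto intro!: Min.boundedI Min_le simp: Min_le_iff)
qed

text \<open>The row counts determine all lower degrees, and these determine the multiplicities by
  induction from the bottom of the lattice.\<close>

lemma standard_eqI:
  assumes "standard m" "standard m'" and "\<And>r s. row_count m r s = row_count m' r s"
  shows "m = m'"
proof (rule poly_mapping_eqI)
  have eq: "lower_degree m c = lower_degree m' c" for c
    unfolding lower_degree_Min[OF assms(1)] lower_degree_Min[OF assms(2)] by (simp add: assms(3))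
  fix c
  show "lookup m c = lookup m' c"
  proof (induction "card {x. x \<le> c}" arbitrary: c rule: less_induct)
    case less
    have "lookup m a = lookup m' a" if "a < c" for a
    proof (rule less)
      have "{x. x \<le> a} \<subset> {x. x \<le> c}" using that by (auto intro: order_trans dest: leD)
      then show "card {x. x \<le> a} < card {x. x \<le> c}" by (intro psubset_card_mono) auto
    qed
    then have *: "(\<Sum>a\<in>UNIV. lookup m a * of_bool (a < c)) = (\<Sum>a\<in>UNIV. lookup m' a * of_bool (a < c))"
      by (intro sum.cong) auto
    have "lower_degree k c = (\<Sum>a\<in>UNIV. lookup k a * of_bool (a < c)) + lookup k c" for k :: "'a plucker \<Rightarrow>\<^sub>0 nat"
    proof -
      have "lower_degree k c = (\<Sum>a\<in>UNIV. lookup k a * of_bool (a < c) + (if a = c then lookup k c else 0))"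
        unfolding lower_degree_def by (intro sum.cong) (auto simp: le_less)
      then show ?thesis by (simp add: sum.distrib)
    qed
    then show ?case using eq[of c] * by simp
  qed
qed

text \<open>If \<open>M\<close> exceeds the total degrees, the row counts are the base
  \<open>M\<close> digits of the diagonal degree.\<close>

lemma diagonal_degree_inj:
  fixes m m' :: "'n::card2 plucker \<Rightarrow>\<^sub>0 nat"
  assumes std: "standard m" "standard m'"
    and M: "(\<Sum>a\<in>UNIV. lookup m a) < M" "(\<Sum>a\<in>UNIV. lookup m' a) < M"
    and eq: "diagonal_degree M m = diagonal_degree M m'"
  shows "m = m'"
proof (rule standard_eqI[OF std])
  let ?n = "CARD('n)"
  let ?P = "{..<?n} \<times> {..?n}"
  define pos where "pos = (\<lambda>(r, s). Suc ?n * Suc ?n - (r * Suc ?n + s))"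
  have le: "row_count k r s \<le> (\<Sum>a\<in>UNIV. lookup k a)" for k :: "'n plucker \<Rightarrow>\<^sub>0 nat" and r s
    unfolding row_count_def by (intro sum_mono) auto
  have lt: "row_count m r s < M" "row_count m' r s < M" for r s
    using le M by (meson le_less_trans)+
  have inj: "inj_on pos ?P"
  proof (rule inj_on_inverseI[where g = "\<lambda>p. ((Suc ?n * Suc ?n - p) div Suc ?n, (Suc ?n * Suc ?n - p) mod Suc ?n)"])
    fix x assume "x \<in> ?P"
    then obtain r s where x: "x = (r, s)" "r < ?n" "s \<le> ?n" by auto
    have "r * Suc ?n + s \<le> Suc ?n * Suc ?n"
    proof -
      have "r * Suc ?n + s \<le> ?n * Suc ?n + Suc ?n" using x by (intro add_mono mult_le_mono) auto
      then show ?thesis by simp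
    qed
    then have "Suc ?n * Suc ?n - pos x = r * Suc ?n + s" by (simp add: pos_def x)
    moreover have "(r * Suc ?n + s) div Suc ?n = r" "(r * Suc ?n + s) mod Suc ?n = s"
      using x by (simp_all del: mult_Suc_right)
    ultimately show "((Suc ?n * Suc ?n - pos x) div Suc ?n, (Suc ?n * Suc ?n - pos x) mod Suc ?n) = x"
      by (simp only: x(1))
  qed
  have "\<forall>x\<in>?P. (case x of (r, s) \<Rightarrow> row_count m r s) = (case x of (r, s) \<Rightarrow> row_count m' r s)"
    using eq M lt unfolding diagonal_degree_row_count
    by (intro digits_unique[OF _ inj, where M = M])
      (auto simp: wt_def pos_def case_prod_unfold)
  then have in_P: "row_count m r s = row_count m' r s" if "r < ?n" "s \<le> ?n" for r s
    using that by auto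
  have out_P: "row_count k r s = 0" if "\<not> (r < ?n \<and> s \<le> ?n)" for k :: "'n plucker \<Rightarrow>\<^sub>0 nat" and r s
  proof -
    have "\<not> (r < length (indices a) \<and> indices a ! r = s)" for a :: "'n plucker"
      using that length_indices[of a] subsetD[OF set_indices_subset[of a] nth_mem[of r "indices a"]] by auto
    then show ?thesis unfolding row_count_def by (intro sum.neutral ballI) (simp only: of_bool_def if_False mult_0_right)
  qed
  show "row_count m r s = row_count m' r s" for r s
    using in_P out_P by (cases "r < ?n \<and> s \<le> ?n") auto
qed

text \<open>All \<open>M\<close> are required at once, since \<open>pattern_independence\<close>
  chooses \<open>M\<close> only in terms of the polynomial.\<close>

definition vanishes_on :: "(nat \<Rightarrow> nat \<Rightarrow> bool) \<Rightarrow> 'n::card2 plucker \<Rightarrow> bool" where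
  "vanishes_on U a \<longleftrightarrow> (\<forall>M. leading_minor (pattern_matrix CARD('n) M U) (indices a) = 0)"

definition diagonal_in :: "(nat \<Rightarrow> nat \<Rightarrow> bool) \<Rightarrow> 'n::card2 plucker \<Rightarrow> bool" where
  "diagonal_in U a \<longleftrightarrow> (\<forall>r<length (indices a). U r (indices a ! r))"

lemma diagonal_in_monic:
  assumes "diagonal_in U (a :: 'n::card2 plucker)" "CARD('n) < M"
  shows "monic_of (leading_minor (pattern_matrix CARD('n) M U) (indices a))
    (\<Sum>r<length (indices a). wt CARD('n) M r (indices a ! r))"
  using assms sorted_indices[of a] set_indices_subset[of a] length_indices[of a]
  by (intro leading_minor_pattern_monic) (auto simp: diagonal_in_def)

lemma diagonal_in_not_vanishes: "diagonal_in U (a :: 'n::card2 plucker) \<Longrightarrow> \<not> vanishes_on U a"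
  using diagonal_in_monic[of U a "Suc CARD('n)"] monic_of_nonzero
  unfolding vanishes_on_def by (metis lessI)

text \<open>On the pattern matrix the monomials with a vanishing factor disappear, and the others
  become monic polynomials in one indeterminate of pairwise different degrees. The one of largest
  degree cannot cancel.\<close>

lemma pattern_independence:
  fixes h :: "('n::card2 plucker, complex) mvpoly"
  assumes h: "h \<in> plucker_ideal"
    and cases: "\<And>m. m \<in> keys h \<Longrightarrow>
      (standard m \<and> (\<forall>a\<in>keys m. diagonal_in U a)) \<or> (\<exists>a\<in>keys m. vanishes_on U a)"
    and m: "m \<in> keys h"
  shows "\<exists>a\<in>keys m. vanishes_on U a"
proof (rule ccontr)
  assume no: "\<not> (\<exists>a\<in>keys m. vanishes_on U a)"
  let ?n = "CARD('n)"
  define G where "G = {m\<in>keys h. standard m \<and> (\<forall>a\<in>keys m. diagonal_in U a)}"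
  have G: "finite G" "m \<in> G" using cases[OF m] no m by (auto simp: G_def)
  \<comment> \<open>Larger than \<open>n\<close>, so that diagonal terms dominate, and larger than
    the degree of every monomial of \<open>h\<close>, so that row counts are digits.\<close>
  define M where "M = Suc (?n + (\<Sum>m\<in>keys h. \<Sum>a\<in>UNIV. lookup m a))"
  have M: "?n < M" "\<And>k. k \<in> keys h \<Longrightarrow> (\<Sum>a\<in>UNIV. lookup k a) < M"
    by (auto simp: M_def less_Suc_eq_le intro!: trans_le_add2 member_le_sum)
  let ?z = "pattern_matrix ?n M U"
  let ?v = "\<lambda>a. leading_minor ?z (indices a)"
  have "0 = poly_hom.extend ?z (msubst plucker_minor h)"
    using h by (simp add: plucker_ideal_def)
  also have "\<dots> = (\<Sum>k\<in>keys h. [:lookup h k:] * monom_val ?v k)"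
    by (simp only: poly_hom.extend_msubst extend_plucker_minor) (simp add: poly_hom.extend_def)
  also have "\<dots> = (\<Sum>k\<in>G. [:lookup h k:] * monom_val ?v k)"
  proof (rule sum.mono_neutral_right)
    show "\<forall>k\<in>keys h - G. [:lookup h k:] * monom_val ?v k = 0"
    proof
      fix k assume "k \<in> keys h - G"
      then obtain a where "a \<in> keys k" "?v a = 0" using cases[of k] by (auto simp: G_def vanishes_on_def)
      then have "monom_val ?v k = 0"
        unfolding monom_val_def by (intro prod_zero) (auto simp: in_keys_iff intro!: bexI[of _ a])
      then show "[:lookup h k:] * monom_val ?v k = 0" by simp
    qed
  qed (auto simp: G_def)
  finally have zero: "(\<Sum>k\<in>G. [:lookup h k:] * monom_val ?v k) = 0" by simp
  have monic: "monic_of (monom_val ?v k) (diagonal_degree M k)" if "k \<in> G" for k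
  proof -
    have "monic_of (monom_val ?v k)
        (\<Sum>a\<in>keys k. lookup k a * (\<Sum>r<length (indices a). wt ?n M r (indices a ! r)))"
      unfolding monom_val_def using that M(1)
      by (intro monic_of_prod monic_of_power diagonal_in_monic) (auto simp: G_def)
    also have "(\<Sum>a\<in>keys k. lookup k a * (\<Sum>r<length (indices a). wt ?n M r (indices a ! r))) = diagonal_degree M k"
      unfolding diagonal_degree_def
      by (rule sum.mono_neutral_left) (auto simp: not_in_keys_iff_lookup_eq_zero)
    finally show ?thesis .
  qed
  obtain k0 where k0: "k0 \<in> G" "\<forall>k\<in>G. diagonal_degree M k \<le> diagonal_degree M k0"
    using G by (metis (no_types, lifting) Max_ge Max_in empty_iff finite_imageI image_iff image_is_empty)
  have "coeff ([:lookup h k:] * monom_val ?v k) (diagonal_degree M k0) = (if k = k0 then lookup h k0 else 0)"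
    if k: "k \<in> G" for k
  proof (cases "k = k0")
    case True
    have "coeff (monom_val ?v k) (diagonal_degree M k) = 1"
      using monic[OF k] unfolding monic_of_def by metis
    then show ?thesis using True by simp
  next
    case False
    have "diagonal_degree M k \<noteq> diagonal_degree M k0"
      using diagonal_degree_inj[of k k0 M] False k k0(1) M(2) by (auto simp: G_def)
    then have "degree (monom_val ?v k) < diagonal_degree M k0"
      using monic[OF k] k0(2) k by (simp add: monic_of_def le_neq_implies_less)
    then show ?thesis using False by (simp add: coeff_eq_0)
  qed
  then have "coeff (\<Sum>k\<in>G. [:lookup h k:] * monom_val ?v k) (diagonal_degree M k0) = lookup h k0"
    using G(1) k0(1) by (simp add: coeff_sum)
  then have "lookup h k0 = 0" unfolding zero by simp
  then show False using k0(1) by (auto simp: G_def in_keys_iff)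
qed

section \<open>Columns whose minors vanish on a pattern\<close>

lemma permutes_card_contradiction:
  assumes "\<sigma> permutes {0..<k}" "A \<subseteq> {0..<k}" "\<sigma> ` A \<subseteq> B" "finite B" "card B < card A"
  shows False
proof -
  have "card (\<sigma> ` A) = card A" using permutes_inj[OF assms(1)] by (simp add: card_image inj_on_def)
  then show False using card_mono[OF assms(4,3)] assms(5) by simp
qed

text \<open>If \<open>a\<close> is longer than \<open>\<tau>\<close>, a row is zero. Otherwise some
  entry of \<open>a\<close> at a position \<open>i\<close> is smaller than that of
  \<open>\<tau>\<close>, and the rows from \<open>i\<close> on have nonzero entries only in columns
  after \<open>i\<close>, one too few.\<close>

lemma vanishes_below:
  fixes a \<tau> :: "'n::card2 plucker"
  assumes "\<not> \<tau> \<le> a"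
  shows "vanishes_on (\<lambda>r s. r < length (indices \<tau>) \<and> indices \<tau> ! r \<le> s) a"
  unfolding vanishes_on_def
proof (intro allI leading_minor_pattern_zero, rule ccontr)
  let ?k = "length (indices a)"
  fix \<sigma> assume \<sigma>: "\<sigma> permutes {0..<?k}"
  assume "\<not> (\<exists>i<?k. \<not> (i < length (indices \<tau>) \<and> indices \<tau> ! i \<le> indices a ! \<sigma> i))"
  then have *: "i < length (indices \<tau>)" "indices \<tau> ! i \<le> indices a ! \<sigma> i" if "i < ?k" for i
    using that by auto
  have "?k \<le> length (indices \<tau>)" using *(1) by (meson leI less_irrefl)
  then obtain i where i: "i < ?k" "indices a ! i < indices \<tau> ! i"
    using assms by (auto simp: less_eq_plucker_def not_le)
  have "\<sigma> ` {i..<?k} \<subseteq> {Suc i..<?k}"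
  proof
    fix y assume "y \<in> \<sigma> ` {i..<?k}"
    then obtain j where j: "y = \<sigma> j" "i \<le> j" "j < ?k" by auto
    have yk: "y < ?k" using permutes_in_image[OF \<sigma>] j by auto
    have "indices \<tau> ! i \<le> indices \<tau> ! j"
      using j(2,3) *(1)[of j] sorted_wrt_nth_less[OF sorted_indices[of \<tau>], of i j] by (cases "i = j") auto
    then have "indices a ! i < indices a ! y" using i(2) *(2)[OF j(3)] unfolding j(1) by linarith
    then have "i < y" using sorted_wrt_nth_less[OF sorted_indices[of a], of y i] i(1)
      by (metis less_irrefl less_asym linorder_neqE_nat)
    then show "y \<in> {Suc i..<?k}" using yk by simp
  qed
  then show False
    by (rule permutes_card_contradiction[OF \<sigma>, rotated]) (use i(1) in auto)
qed

lemma diagonal_in_above: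
  "\<tau> \<le> a \<Longrightarrow> diagonal_in (\<lambda>r s. r < length (indices \<tau>) \<and> indices \<tau> ! r \<le> s) a"
  by (auto simp: diagonal_in_def less_eq_plucker_def)

text \<open>If entry \<open>i\<close> of \<open>a\<close> exceeds that of \<open>q\<close>, the rows
  up to \<open>i\<close> have nonzero entries only in columns before \<open>i\<close>, one too few.
  By the length hypothesis these rows do occur in the minor.\<close>

lemma vanishes_above:
  fixes a q :: "'n::card2 plucker"
  assumes "\<not> a \<le> q" "length (indices q) \<le> length (indices a)"
  shows "vanishes_on (\<lambda>r s. r < length (indices q) \<longrightarrow> s \<le> indices q ! r) a"
  unfolding vanishes_on_def
proof (intro allI leading_minor_pattern_zero, rule ccontr)
  let ?k = "length (indices a)"
  fix \<sigma> assume \<sigma>: "\<sigma> permutes {0..<?k}"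
  assume "\<not> (\<exists>i<?k. \<not> (i < length (indices q) \<longrightarrow> indices a ! \<sigma> i \<le> indices q ! i))"
  then have *: "indices a ! \<sigma> i \<le> indices q ! i" if "i < length (indices q)" for i
    using that assms(2) by auto
  obtain i where i: "i < length (indices q)" "indices q ! i < indices a ! i"
    using assms by (auto simp: less_eq_plucker_def not_le)
  have "\<sigma> ` {..i} \<subseteq> {..<i}"
  proof
    fix y assume "y \<in> \<sigma> ` {..i}"
    then obtain j where j: "y = \<sigma> j" "j \<le> i" by auto
    have yk: "y < ?k" using permutes_in_image[OF \<sigma>, of j] j i(1) assms(2) by auto
    have "indices q ! j \<le> indices q ! i"
      using j(2) i(1) sorted_wrt_nth_less[OF sorted_indices[of q], of j i] by (cases "i = j") auto
    then have "indices a ! y < indices a ! i" using i *[of j] j by simp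
    then have "y < i" using sorted_wrt_nth_less[OF sorted_indices[of a], of i y] yk
      by (metis less_irrefl less_asym linorder_neqE_nat)
    then show "y \<in> {..<i}" by simp
  qed
  then show False
    by (rule permutes_card_contradiction[OF \<sigma>, rotated]) (use i(1) assms(2) in auto)
qed

lemma diagonal_in_below:
  "a \<le> q \<Longrightarrow> diagonal_in (\<lambda>r s. r < length (indices q) \<longrightarrow> s \<le> indices q ! r) a"
  by (auto simp: diagonal_in_def less_eq_plucker_def)

section \<open>Initial ideals\<close>

lemma pair_monom_eq_imp: "pair_monom a b = pair_monom c d \<Longrightarrow> {a, b} = {c, d}"
  by (metis keys_pair_monom)

lemma pair_monom_inj:
  "pair_monom p q = pair_monom p' q' \<Longrightarrow> p \<le> q \<Longrightarrow> p' \<le> q' \<Longrightarrow> p = p' \<and> q = (q' :: 'a::order)"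
  by (auto simp: doubleton_eq_iff dest!: pair_monom_eq_imp)

lemma standard_pair_monom: "p \<le> q \<Longrightarrow> standard (pair_monom p q)"
  by (auto simp: standard_def keys_pair_monom incomparable_def)

lemma lookup_single_mult: "lookup (single u c * f) (u + m) = c * lookup f m"
  for u :: "'v \<Rightarrow>\<^sub>0 nat" and f :: "('v, 'a::comm_ring_1) mvpoly"
proof -
  have "single u c * f = (\<Sum>k\<in>keys f. single (u + k) (c * lookup f k))"
    by (subst sum_single_lookup[of f, symmetric]) (simp add: sum_distrib_left mult_single)
  then have "lookup (single u c * f) (u + m) = (\<Sum>k\<in>keys f. if k = m then c * lookup f m else 0)"
    by (auto simp: lookup_sum lookup_single when_def intro!: sum.cong)
  then show ?thesis by (auto simp: not_in_keys_iff_lookup_eq_zero)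
qed

lemma keys_single_multE:
  fixes u :: "'v \<Rightarrow>\<^sub>0 nat" and f :: "('v, 'a::comm_ring_1) mvpoly"
  assumes "v \<in> keys (single u c * f)"
  obtains v' where "v' \<in> keys f" "v = u + v'"
  using subsetD[OF keys_mult assms] by (auto split: if_splits)

lemma keys_quadratic:
  assumes "m \<in> keys (quadratic f)"
  obtains p q where "f p q \<noteq> 0" "m = pair_monom p q"
proof -
  obtain p where "m \<in> keys (\<Sum>q\<in>UNIV. mconst (f p q) * (mvar p * mvar q))"
    using assms unfolding quadratic_def by (rule keys_sumE)
  then obtain q where "m \<in> keys (mconst (f p q) * (mvar p * mvar q))"
    by (rule keys_sumE)
  then have "f p q \<noteq> 0 \<and> m = pair_monom p q"
    unfolding mvar_mult_mvar mconst_mult_single by (auto split: if_splits)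
  then show ?thesis using that by blast
qed

lemma lookup_quadratic:
  fixes f :: "'v::{finite,order} \<Rightarrow> 'v \<Rightarrow> complex"
  assumes f: "\<And>p q. f p q \<noteq> 0 \<Longrightarrow> p \<le> q" and "p0 \<le> q0"
  shows "lookup (quadratic f) (pair_monom p0 q0) = f p0 q0"
proof -
  have "lookup (mconst (f p q) * (mvar p * mvar q)) (pair_monom p0 q0) =
    (if p = p0 then if q = q0 then f p0 q0 else 0 else 0)" for p q
  proof (cases "f p q = 0")
    case False
    then show ?thesis
      using pair_monom_inj[OF _ f[OF False] \<open>p0 \<le> q0\<close>]
      unfolding mvar_mult_mvar mconst_mult_single by (auto simp: lookup_single when_def)
  qed auto
  then have "lookup (quadratic f) (pair_monom p0 q0) =
    (\<Sum>p\<in>UNIV. \<Sum>q\<in>UNIV. if p = p0 then if q = q0 then f p0 q0 else 0 else 0)"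
    by (simp only: quadratic_def lookup_sum)
  also have "\<dots> = (\<Sum>p\<in>UNIV. if p = p0 then f p0 q0 else 0)"
    by (intro sum.cong refl) auto
  finally show ?thesis by simp
qed

lemma standard_independence:
  assumes "h \<in> plucker_ideal" "\<And>m. m \<in> keys h \<Longrightarrow> standard m"
  shows "h = 0"
proof (rule ccontr)
  assume "h \<noteq> 0"
  then obtain m where "m \<in> keys h" by (metis ex_in_conv keys_eq_empty)
  have in_all: "diagonal_in (\<lambda>_ _. True) a" for a :: "'a plucker" by (simp add: diagonal_in_def)
  then show False
    using pattern_independence[OF assms(1) _ \<open>m \<in> keys h\<close>, of "\<lambda>_ _. True"] assms(2)
      diagonal_in_not_vanishes[OF in_all] by blast
qed

definition straightens :: "('n::card2 plucker \<Rightarrow> 'n plucker \<Rightarrow> complex) \<Rightarrow> 'n plucker \<Rightarrow> 'n plucker \<Rightarrow> bool" where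
  "straightens f a b \<longleftrightarrow> (\<forall>p q. f p q \<noteq> 0 \<longrightarrow> p \<le> q) \<and> mvar a * mvar b - quadratic f \<in> plucker_ideal"

lemma straightens_unique:
  assumes "straightens f a b" "straightens g a b"
  shows "f = g"
proof -
  have f: "p \<le> q" if "f p q \<noteq> 0" for p q using assms(1) that by (auto simp: straightens_def)
  have g: "p \<le> q" if "g p q \<noteq> 0" for p q using assms(2) that by (auto simp: straightens_def)
  have "(mvar a * mvar b - quadratic g) - (mvar a * mvar b - quadratic f) \<in> plucker_ideal"
    using assms unfolding straightens_def by (blast intro: plucker_ideal_diff)
  then have "quadratic f - quadratic g \<in> plucker_ideal" by simp
  moreover have "standard m" if "m \<in> keys (quadratic f - quadratic g)" for m
  proof -
    from that show ?thesis
      by (rule keys_diffE) (use f g standard_pair_monom in \<open>metis keys_quadratic\<close>)+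
  qed
  ultimately have "quadratic f - quadratic g = 0" by (rule standard_independence)
  then have eq: "quadratic f = quadratic g" by simp
  have "f p q = g p q" for p q
  proof (cases "p \<le> q")
    case True
    then show ?thesis using lookup_quadratic[where f = f, OF f True] lookup_quadratic[where f = g, OF g True] eq by simp
  next
    case False
    then have "f p q = 0" "g p q = 0" using f[of p q] g[of p q] by blast+
    then show ?thesis by simp
  qed
  then show ?thesis by blast
qed

text \<open>The pattern is built from the term under consideration: that of \<open>p0\<close>
  preserves the diagonals of the columns above \<open>p0\<close> and kills all others, that of
  \<open>q0\<close> does so for the columns below \<open>q0\<close>. The term
  \<open>X_p0 X_q0\<close> survives on it, so by \<open>pattern_independence\<close> neither
  \<open>X_a\<close> nor \<open>X_b\<close> can vanish there.\<close>

lemma straightening_exists: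
  fixes a b :: "'n::card2 plucker"
  assumes inc: "incomparable a b"
  shows "\<exists>f. straightens f a b \<and> (\<forall>p q. f p q \<noteq> 0 \<longrightarrow> p \<le> inf a b \<and> sup a b \<le> q)"
proof -
  have main: "\<exists>f. straightens f a b \<and> (\<forall>p q. f p q \<noteq> 0 \<longrightarrow> p \<le> inf a b \<and> sup a b \<le> q)"
    if inc: "incomparable a b" and len: "length (indices b) \<le> length (indices a)" for a b :: "'n plucker"
  proof -
    obtain f where I: "mvar a * mvar b - quadratic f \<in> plucker_ideal"
      and f: "\<And>p q. f p q \<noteq> 0 \<Longrightarrow> p \<le> q \<and> length (indices p) = length (indices a) \<and> length (indices q) = length (indices b)"
      using product_straight[OF len] by (rule straightE) blast
    let ?h = "mvar a * mvar b - quadratic f"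
    have "p0 \<le> inf a b \<and> sup a b \<le> q0" if f0: "f p0 q0 \<noteq> 0" for p0 q0
    proof -
      have le0: "p0 \<le> q0" using f[OF f0] by simp
      have "pair_monom a b \<noteq> pair_monom p0 q0"
        using inc le0 pair_monom_eq_imp[of a b p0 q0] by (auto simp: incomparable_def doubleton_eq_iff)
      then have "lookup ?h (pair_monom p0 q0) = - f p0 q0"
        using lookup_quadratic[of f p0 q0] f le0
        by (simp add: lookup_minus mvar_mult_mvar lookup_single when_def)
      then have key: "pair_monom p0 q0 \<in> keys ?h" using f0 by (simp add: in_keys_iff)
      have contradiction: False
        if ab: "vanishes_on U a \<or> vanishes_on U b" and "diagonal_in U p0" "diagonal_in U q0"
          and pq: "\<And>p q. f p q \<noteq> 0 \<Longrightarrow> (diagonal_in U p \<and> diagonal_in U q) \<or> vanishes_on U p \<or> vanishes_on U q" for U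
      proof -
        have "\<exists>c\<in>keys (pair_monom p0 q0). vanishes_on U c"
        proof (rule pattern_independence[OF I _ key])
          fix m assume "m \<in> keys ?h"
          then consider "m = pair_monom a b" | p q where "f p q \<noteq> 0" "m = pair_monom p q"
            by (rule keys_diffE) (auto simp: mvar_mult_mvar elim: keys_quadratic)
          then show "(standard m \<and> (\<forall>a\<in>keys m. diagonal_in U a)) \<or> (\<exists>a\<in>keys m. vanishes_on U a)"
          proof cases
            case 1
            then show ?thesis using ab by (auto simp: keys_pair_monom)
          next
            case 2
            then have "standard m" using f standard_pair_monom by blast
            then show ?thesis using pq[OF 2(1)] by (auto simp: 2(2) keys_pair_monom)
          qed
        qed
        then show False using that(2,3) by (auto simp: keys_pair_monom dest: diagonal_in_not_vanishes)
      qed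
      have "p0 \<le> a \<and> p0 \<le> b"
      proof (rule ccontr)
        let ?U = "\<lambda>r s. r < length (indices p0) \<and> indices p0 ! r \<le> s"
        assume no: "\<not> (p0 \<le> a \<and> p0 \<le> b)"
        show False
        proof (rule contradiction[of ?U])
          show "(diagonal_in ?U p \<and> diagonal_in ?U q) \<or> vanishes_on ?U p \<or> vanishes_on ?U q"
            if "f p q \<noteq> 0" for p q
          proof (cases "p0 \<le> p")
            case True
            then have "p0 \<le> q" using f[OF that] order_trans by blast
            then show ?thesis using True by (intro disjI1 conjI diagonal_in_above)
          next
            case False
            then show ?thesis by (intro disjI2 disjI1 vanishes_below)
          qed
          show "vanishes_on ?U a \<or> vanishes_on ?U b"
            using no vanishes_below[of p0 a] vanishes_below[of p0 b] by blast
        qed (rule diagonal_in_above[OF order_refl], rule diagonal_in_above[OF le0])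
      qed
      moreover have "a \<le> q0 \<and> b \<le> q0"
      proof (rule ccontr)
        let ?U = "\<lambda>r s. r < length (indices q0) \<longrightarrow> s \<le> indices q0 ! r"
        have l0: "length (indices q0) = length (indices b)" using f[OF f0] by simp
        assume no: "\<not> (a \<le> q0 \<and> b \<le> q0)"
        show False
        proof (rule contradiction[of ?U])
          show "vanishes_on ?U a \<or> vanishes_on ?U b"
            using no vanishes_above[of a q0] vanishes_above[of b q0] l0 len by auto
          show "(diagonal_in ?U p \<and> diagonal_in ?U q) \<or> vanishes_on ?U p \<or> vanishes_on ?U q"
            if "f p q \<noteq> 0" for p q
          proof (cases "q \<le> q0")
            case True
            then have "p \<le> q0" using f[OF that] order_trans by blast
            then show ?thesis using True by (intro disjI1 conjI diagonal_in_below)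
          next
            case False
            then show ?thesis using f[OF that] l0 by (intro disjI2 vanishes_above) simp_all
          qed
        qed (rule diagonal_in_below[OF le0], rule diagonal_in_below[OF order_refl])
      qed
      ultimately show ?thesis by simp
    qed
    moreover have "straightens f a b" using f I by (auto simp: straightens_def)
    ultimately show ?thesis by blast
  qed
  show ?thesis
  proof (cases "length (indices b) \<le> length (indices a)")
    case True
    then show ?thesis by (rule main[OF inc])
  next
    case False
    have "incomparable b a" using inc by (auto simp: incomparable_def)
    then show ?thesis
      using main[of b a] False by (auto simp: straightens_def mult.commute inf_commute sup_commute)
  qed
qed

definition straightening_coeff :: "'n::card2 plucker \<Rightarrow> 'n plucker \<Rightarrow> 'n plucker \<Rightarrow> 'n plucker \<Rightarrow> complex" where
  "straightening_coeff a b = (SOME f. straightens f a b)"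

lemma straightening_coeff:
  assumes "incomparable a b"
  shows "straightens (straightening_coeff a b) a b"
    and "straightening_coeff a b p q \<noteq> 0 \<Longrightarrow> p \<le> inf a b" 
    and "straightening_coeff a b p q \<noteq> 0 \<Longrightarrow> sup a b \<le> q"
    and "straightening_coeff a b p q \<noteq> 0 \<Longrightarrow> p \<le> q"
proof -
  obtain f where f: "straightens f a b" "\<forall>p q. f p q \<noteq> 0 \<longrightarrow> p \<le> inf a b \<and> sup a b \<le> q"
    using straightening_exists[OF assms] by blast
  show s: "straightens (straightening_coeff a b) a b"
    unfolding straightening_coeff_def using f(1) by (rule someI[of "\<lambda>f. straightens f a b"])
  then have "straightening_coeff a b = f" using f(1) by (rule straightens_unique)
  then show "straightening_coeff a b p q \<noteq> 0 \<Longrightarrow> p \<le> inf a b"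
    "straightening_coeff a b p q \<noteq> 0 \<Longrightarrow> sup a b \<le> q" using f(2) by auto
  show "straightening_coeff a b p q \<noteq> 0 \<Longrightarrow> p \<le> q" using s by (auto simp: straightens_def)
qed

lemma straightening_coeff_eqI: "straightens f a b \<Longrightarrow> straightening_coeff a b = f"
  unfolding straightening_coeff_def by (metis someI straightens_unique)

lemma straightening_coeff_commute: "straightening_coeff a b = straightening_coeff b a"
  unfolding straightening_coeff_def by (simp add: straightens_def mult.commute)

lemma straightening_mem:
  assumes "incomparable a b"
  shows "single (u + pair_monom a b) 1 - single u 1 * quadratic (straightening_coeff a b) \<in> plucker_ideal"
proof -
  have "single u 1 * (mvar a * mvar b - quadratic (straightening_coeff a b)) \<in> plucker_ideal"
    using straightening_coeff(1)[OF assms] by (intro plucker_ideal_mult) (simp add: straightens_def)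
  then show ?thesis by (simp add: right_diff_distrib mvar_mult_mvar mult_single)
qed

section \<open>Weights and normal forms\<close>

definition strict_at :: "real ^ 'n::card2 plucker \<Rightarrow> 'n plucker \<Rightarrow> 'n plucker \<Rightarrow> bool" where
  "strict_at w a b \<longleftrightarrow> (\<forall>p q. straightening_coeff a b p q \<noteq> 0 \<longrightarrow> w $ a + w $ b < w $ p + w $ q)"

definition weak_weight :: "real ^ 'n::card2 plucker \<Rightarrow> bool" where
  "weak_weight w \<longleftrightarrow> (\<forall>a b p q. incomparable a b \<longrightarrow> straightening_coeff a b p q \<noteq> 0 \<longrightarrow>
     w $ a + w $ b \<le> w $ p + w $ q)"

text \<open>A weight for which every straightening relation has leading term \<open>X\<^sub>a X\<^sub>b\<close>, since
  \<open>p\<close> lies strictly below both \<open>a\<close> and \<open>b\<close>.\<close>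

definition potential :: "'n::card2 plucker \<Rightarrow> nat" where
  "potential a = 3 ^ (card (UNIV :: 'n plucker set) - card {x. x \<le> a})"

lemma potential_less:
  assumes "p < (a :: 'n::card2 plucker)"
  shows "3 * potential a \<le> potential p"
proof -
  have "{x. x \<le> p} \<subset> {x. x \<le> a}" using assms by (auto intro: order_trans dest: leD)
  then have "card {x. x \<le> p} < card {x. x \<le> a}" by (intro psubset_card_mono) auto
  moreover have "card {x. x \<le> a} \<le> card (UNIV :: 'n plucker set)" by (intro card_mono) auto
  ultimately have "Suc (card (UNIV :: 'n plucker set) - card {x. x \<le> a}) \<le> card (UNIV :: 'n plucker set) - card {x. x \<le> p}"
    by simp
  then have "(3::nat) ^ Suc (card (UNIV :: 'n plucker set) - card {x. x \<le> a}) \<le> potential p"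
    unfolding potential_def by (intro power_increasing) auto
  then show ?thesis by (simp add: potential_def)
qed

text \<open>The base 3 of \<open>potential\<close> makes each of the two potentials on the left at
  most a third of that of \<open>p\<close>.\<close>

lemma potential_straightening:
  assumes "incomparable a b" "straightening_coeff a b p q \<noteq> 0"
  shows "potential a + potential b < potential p + potential q"
proof -
  have "p \<le> inf a b" using straightening_coeff(2)[OF assms] .
  then have "p < a" "p < b" using le_less_trans incomparable_sup_inf[OF assms(1)] by blast+
  then have "3 * potential a \<le> potential p" "3 * potential b \<le> potential p"
    by (auto intro: potential_less)
  moreover have "0 < potential p" by (simp add: potential_def)
  ultimately show ?thesis by linarith
qed

text \<open>A termination measure: straightening raises potentials, so their complements to the
  bound \<open>3 ^ card UNIV\<close> shrink.\<close>

definition monom_potential :: "('n::card2 plucker \<Rightarrow>\<^sub>0 nat) \<Rightarrow> nat" where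
  "monom_potential m = (\<Sum>a\<in>UNIV. lookup m a * (3 ^ card (UNIV :: 'n plucker set) - potential a))"

lemma monom_potential_add: "monom_potential (m + m') = monom_potential m + monom_potential m'"
  by (simp add: monom_potential_def lookup_add distrib_right sum.distrib)

lemma monom_potential_single: 
  "monom_potential (single (a :: 'n::card2 plucker) 1) = 3 ^ card (UNIV :: 'n plucker set) - potential a"
proof -
  have "monom_potential (single a 1) =
    (\<Sum>x\<in>UNIV. if a = x then 3 ^ card (UNIV :: 'n plucker set) - potential x else 0)"
    unfolding monom_potential_def by (intro sum.cong) (auto simp: lookup_single when_def)
  then show ?thesis by simp
qed

lemma nat_diff_sum_less:
  "(a::nat) + b < p + q \<Longrightarrow> a \<le> K \<Longrightarrow> b \<le> K \<Longrightarrow> p \<le> K \<Longrightarrow> q \<le> K \<Longrightarrow> (K - p) + (K - q) < (K - a) + (K - b)"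
  by linarith

lemma monom_potential_straightening:
  assumes "incomparable a b" "straightening_coeff a b p q \<noteq> 0"
  shows "monom_potential (u + pair_monom p q) < monom_potential (u + pair_monom a b)"
proof -
  have "potential x \<le> 3 ^ card (UNIV :: 'a plucker set)" for x :: "'a plucker"
    unfolding potential_def by (intro power_increasing) auto
  then show ?thesis
    using potential_straightening[OF assms]
    unfolding monom_potential_add pair_monom_def monom_potential_single
    by (metis (no_types, lifting) nat_diff_sum_less add_less_cancel_left)
qed

text \<open>The property \<open>Q\<close> is left open so that the same substitution of normal forms
  serves both the weak and the strict version.\<close>

lemma normal_form_step:
  assumes "incomparable a b"
    and "\<And>p q. straightening_coeff a b p q \<noteq> 0 \<Longrightarrow>
      \<exists>h. single (u + pair_monom p q) 1 - h \<in> plucker_ideal \<and> (\<forall>v\<in>keys h. Q v)"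
  shows "\<exists>h. single (u + pair_monom a b) 1 - h \<in> plucker_ideal \<and> (\<forall>v\<in>keys h. Q v)"
proof -
  let ?f = "straightening_coeff a b"
  obtain H where H: "\<And>p q. ?f p q \<noteq> 0 \<Longrightarrow>
      single (u + pair_monom p q) 1 - H p q \<in> plucker_ideal \<and> (\<forall>v\<in>keys (H p q). Q v)"
    using assms(2) by metis
  define h where "h = (\<Sum>p\<in>UNIV. \<Sum>q\<in>UNIV. mconst (?f p q) * H p q)"
  have "single u 1 * quadratic ?f - h =
    (\<Sum>p\<in>UNIV. \<Sum>q\<in>UNIV. mconst (?f p q) * (single (u + pair_monom p q) 1 - H p q))"
    unfolding h_def quadratic_def sum_distrib_left sum_subtractf[symmetric]
    by (intro sum.cong refl) (simp add: mvar_mult_mvar right_diff_distrib mult_single mconst_mult_single mult.left_commute[of "single u 1"])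
  also have "\<dots> \<in> plucker_ideal"
  proof (intro plucker_ideal_sum)
    fix p q
    show "mconst (?f p q) * (single (u + pair_monom p q) 1 - H p q) \<in> plucker_ideal"
      using H[of p q] by (cases "?f p q = 0") (auto intro: plucker_ideal_zero plucker_ideal_mult)
  qed
  finally have "single u 1 * quadratic ?f - h \<in> plucker_ideal" .
  from plucker_ideal_add[OF straightening_mem[OF assms(1), of u] this]
  have "single (u + pair_monom a b) 1 - h \<in> plucker_ideal" by simp
  moreover have "Q v" if v: "v \<in> keys h" for v
  proof -
    obtain p where "v \<in> keys (\<Sum>q\<in>UNIV. mconst (?f p q) * H p q)"
      using v unfolding h_def by (rule keys_sumE)
    then obtain q where "v \<in> keys (mconst (?f p q) * H p q)" by (rule keys_sumE)
    then have "?f p q \<noteq> 0" "v \<in> keys (H p q)" by (auto simp: in_keys_iff)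
    then show ?thesis using H by blast
  qed
  ultimately show ?thesis by blast
qed

lemma monom_weight_pair: "monom_weight w (u + pair_monom p q) = monom_weight w u + (w $ p + w $ q)"
  by (simp add: monom_weight_add pair_monom_def)

lemma weak_normal_form:
  assumes "weak_weight w"
  shows "\<exists>h. single u 1 - h \<in> plucker_ideal \<and> (\<forall>v\<in>keys h. standard v \<and> monom_weight w u \<le> monom_weight w v)"
proof (induction "monom_potential u" arbitrary: u rule: less_induct)
  case less
  show ?case
  proof (cases "standard u")
    case True
    then show ?thesis by (intro exI[of _ "single u 1"]) (simp add: plucker_ideal_zero)
  next
    case False
    then obtain a b u' where ab: "incomparable a b" and u: "u = u' + pair_monom a b"
      by (rule not_standardE)
    show ?thesis
      unfolding u
    proof (rule normal_form_step[OF ab])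
      fix p q assume pq: "straightening_coeff a b p q \<noteq> 0"
      obtain h where h: "single (u' + pair_monom p q) 1 - h \<in> plucker_ideal"
        "\<forall>v\<in>keys h. standard v \<and> monom_weight w (u' + pair_monom p q) \<le> monom_weight w v"
        using less[OF monom_potential_straightening[OF ab pq, of u', folded u]] by blast
      moreover have "monom_weight w (u' + pair_monom a b) \<le> monom_weight w (u' + pair_monom p q)"
        using assms ab pq by (simp add: monom_weight_pair weak_weight_def)
      ultimately show "\<exists>h. single (u' + pair_monom p q) 1 - h \<in> plucker_ideal \<and>
          (\<forall>v\<in>keys h. standard v \<and> monom_weight w (u' + pair_monom a b) \<le> monom_weight w v)"
        by (meson order_trans)
    qed
  qed
qed

text \<open>Only the first step has to raise the weight; the later ones do not lower it by
  \<open>weak_normal_form\<close>.\<close>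

lemma strict_normal_form:
  assumes "weak_weight w" "incomparable a b" "strict_at w a b"
  shows "\<exists>h. single (u + pair_monom a b) 1 - h \<in> plucker_ideal \<and>
    (\<forall>v\<in>keys h. standard v \<and> monom_weight w (u + pair_monom a b) < monom_weight w v)"
proof (rule normal_form_step[OF assms(2)])
  fix p q assume pq: "straightening_coeff a b p q \<noteq> 0"
  have "monom_weight w (u + pair_monom a b) < monom_weight w (u + pair_monom p q)"
    using assms(3) pq by (simp add: monom_weight_pair strict_at_def)
  then show "\<exists>h. single (u + pair_monom p q) 1 - h \<in> plucker_ideal \<and>
      (\<forall>v\<in>keys h. standard v \<and> monom_weight w (u + pair_monom a b) < monom_weight w v)"
    using weak_normal_form[OF assms(1), of "u + pair_monom p q"] by (meson less_le_trans)
qed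

text \<open>Since \<open>p \<le> c \<le> q\<close> for all terms \<open>X\<^sub>p X\<^sub>q\<close> of the straightening of \<open>X\<^sub>a X\<^sub>b\<close>, multiplication by
  \<open>X\<^sub>c\<close> keeps them standard, so they all show up in the normal form of \<open>X\<^sub>a X\<^sub>b X\<^sub>c\<close>.\<close>

lemma strict_at_descend:
  assumes weak: "weak_weight w" and ab: "incomparable a b" and c: "b < c" "c < sup a b"
    and ac: "incomparable a c" "strict_at w a c"
  shows "strict_at w a b"
  unfolding strict_at_def
proof (intro allI impI)
  fix p q assume pq: "straightening_coeff a b p q \<noteq> 0"
  let ?f = "straightening_coeff a b"
  let ?h = "single (single c 1) 1 * quadratic ?f"
  have u: "single c 1 + pair_monom a b = single b 1 + pair_monom a c" by (simp only: pair_monom_def add_ac)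
  obtain h where h: "single (single c 1 + pair_monom a b) 1 - h \<in> plucker_ideal"
    and hk: "\<forall>v\<in>keys h. standard v \<and> monom_weight w (single c 1 + pair_monom a b) < monom_weight w v"
    using strict_normal_form[OF weak ac, of "single b 1", folded u] by blast
  have "(single (single c 1 + pair_monom a b) 1 - h) - (single (single c 1 + pair_monom a b) 1 - ?h) \<in> plucker_ideal"
    by (rule plucker_ideal_diff[OF h straightening_mem[OF ab]])
  then have "?h - h \<in> plucker_ideal" by simp
  moreover have "standard v" if v: "v \<in> keys (?h - h)" for v
  proof -
    from v show ?thesis
    proof (rule keys_diffE)
      assume "v \<in> keys ?h"
      then obtain v' where v': "v' \<in> keys (quadratic ?f)" "v = single c 1 + v'"
        by (rule keys_single_multE)
      obtain p' q' where pq': "?f p' q' \<noteq> 0" "v' = pair_monom p' q'" by (rule keys_quadratic[OF v'(1)])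
      have "p' \<le> c" "c \<le> q'" "p' \<le> q'"
        using straightening_coeff(2,3,4)[OF ab pq'(1)] c by (auto intro: order_trans less_imp_le)
      then show ?thesis unfolding v'(2) pq'(2) standard_def keys_add_nat keys_pair_monom by (auto simp: incomparable_def)
    qed (use hk in blast)
  qed
  ultimately have "?h - h = 0" by (rule standard_independence)
  then have eq: "?h = h" by simp
  have "lookup ?h (single c 1 + pair_monom p q) = ?f p q"
    unfolding lookup_single_mult using lookup_quadratic[of ?f p q] straightening_coeff(4)[OF ab] pq by simp
  then have "single c 1 + pair_monom p q \<in> keys h" using pq eq by (simp add: in_keys_iff)
  then have "monom_weight w (single c 1 + pair_monom a b) < monom_weight w (single c 1 + pair_monom p q)"
    using hk by blast
  then show "w $ a + w $ b < w $ p + w $ q" by (simp only: monom_weight_pair)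
qed

lemma strict_at_commute: "strict_at w a b \<longleftrightarrow> strict_at w b a"
  by (simp add: strict_at_def straightening_coeff_commute[of a b] add.commute)

lemma strict_everywhere:
  fixes w :: "real ^ 'n::card2 plucker"
  assumes weak: "weak_weight w" and dia: "\<And>a b. diamond_pair a b \<Longrightarrow> strict_at w a b"
    and "incomparable a b"
  shows "strict_at w a b"
  using assms(3)
proof (induction rule: incomparable_diamond_induct)
  case (commute a b)
  then show ?case by (simp add: strict_at_commute)
next
  case (between a b c)
  then show ?case using strict_at_descend[OF weak between(1-3) incomparable_between(1)[OF between(1-3)]] by blast
qed (rule dia)

definition interior_weight :: "real ^ 'n::card2 plucker" where
  "interior_weight = (\<chi> a. real (potential a))"

lemma strict_at_interior_weight: "incomparable a b \<Longrightarrow> strict_at interior_weight a b"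
  unfolding strict_at_def interior_weight_def using potential_straightening
  by (auto simp flip: of_nat_add)

text \<open>Otherwise move from \<open>w\<close> towards \<open>interior_weight\<close> until the last violated inequality becomes
  an equality; the diamond inequalities stay strict along the way.\<close>

lemma strict_at_if_diamonds:
  fixes w :: "real ^ 'n::card2 plucker"
  assumes dia: "\<And>a b. diamond_pair a b \<Longrightarrow> strict_at w a b" and inc: "incomparable a b"
  shows "strict_at w a b"
proof (rule ccontr)
  assume "\<not> strict_at w a b"
  then obtain p q where pq: "straightening_coeff a b p q \<noteq> 0" "w $ p + w $ q \<le> w $ a + w $ b"
    by (auto simp: strict_at_def not_less)
  define V where "V = {(a :: 'n plucker, b, p, q). incomparable a b \<and> straightening_coeff a b p q \<noteq> 0}"
  define slack where "slack w = (\<lambda>(a :: 'n plucker, b, p, q). w $ p + w $ q - (w $ a + w $ b))" for w :: "real ^ 'n plucker"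
  let ?w0 = "interior_weight :: real ^ 'n plucker"
  have V: "finite V" "(a, b, p, q) \<in> V" using inc pq by (auto simp: V_def)
  have pos: "0 < slack ?w0 v" if "v \<in> V" for v
  proof -
    obtain a b p q where v: "v = (a, b, p, q)" by (cases v)
    then show ?thesis
      using that strict_at_interior_weight[of a b] by (simp add: V_def slack_def strict_at_def)
  qed
  let ?R = "(\<lambda>v. - slack w v / slack ?w0 v) ` V"
  \<comment> \<open>The slack along \<open>w + t *\<^sub>R ?w0\<close> is linear in \<open>t\<close>
    with positive slope, so \<open>\<mu>\<close> is the first parameter from which on no slack is
    negative, and some slack vanishes there.\<close>
  define \<mu> where "\<mu> = Max ?R"
  have R: "finite ?R" "?R \<noteq> {}" using V by auto
  have ge: "- slack w v / slack ?w0 v \<le> \<mu>" if "v \<in> V" for v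
    unfolding \<mu>_def using R(1) that by (intro Max_ge) auto
  obtain v0 where v0: "v0 \<in> V" "\<mu> = - slack w v0 / slack ?w0 v0"
    using Max_in[OF R] unfolding \<mu>_def by auto
  have "0 \<le> - slack w (a, b, p, q) / slack ?w0 (a, b, p, q)"
    using pos[OF V(2)] pq(2) by (intro divide_nonneg_pos) (auto simp: slack_def)
  then have \<mu>: "0 \<le> \<mu>" using ge[OF V(2)] by simp
  define w' where "w' = w + \<mu> *\<^sub>R ?w0"
  have slack': "slack w' v = slack w v + \<mu> * slack ?w0 v" for v
    by (simp add: slack_def w'_def algebra_simps split: prod.split)
  have "0 \<le> slack w' v" if "v \<in> V" for v
    using ge[OF that] pos[OF that] by (simp add: slack' field_simps)
  then have weak: "weak_weight w'" by (force simp: weak_weight_def V_def slack_def)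
  have "strict_at w' a b" if d: "diamond_pair a b" for a b
    unfolding strict_at_def
  proof (intro allI impI)
    fix p q assume "straightening_coeff a b p q \<noteq> 0"
    then have "0 < slack w (a, b, p, q)" "0 < slack ?w0 (a, b, p, q)"
      using dia[OF d] strict_at_interior_weight[OF diamond_pair_incomparable[OF d]]
      by (auto simp: strict_at_def slack_def)
    then have "0 < slack w' (a, b, p, q)" using \<mu> by (simp add: slack' add_pos_nonneg)
    then show "w' $ a + w' $ b < w' $ p + w' $ q" by (simp add: slack_def)
  qed
  then have all: "strict_at w' a b" if "incomparable a b" for a b
    using strict_everywhere[OF weak] that by blast
  have "0 < slack w' v0" using v0(1) all by (auto simp: V_def slack_def strict_at_def)
  moreover have "slack w' v0 = 0" using v0 pos[OF v0(1)] by (simp add: slack')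
  ultimately show False by simp
qed

section \<open>Strict inequalities and the initial ideal\<close>

lemma initial_part_single:
  assumes "\<And>v. v \<in> keys r \<Longrightarrow> monom_weight w m < monom_weight w v"
  shows "initial_part w (single m 1 - r) = single m 1"
proof (rule poly_mapping_eqI)
  fix k
  have r: "lookup r m = 0" using assms by (auto simp: not_in_keys_iff_lookup_eq_zero[symmetric])
  have key: "m \<in> keys (single m 1 - r)" by (simp add: in_keys_iff lookup_minus r)
  have ge: "monom_weight w m \<le> monom_weight w v" if "v \<in> keys (single m 1 - r)" for v
  proof -
    have "v = m \<or> v \<in> keys r" using that by (auto elim: keys_diffE)
    then show ?thesis using assms by (auto intro: less_imp_le)
  qed
  show "lookup (initial_part w (single m 1 - r)) k = lookup (single m 1) k"
  proof (cases "k = m")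
    case True
    then show ?thesis using ge r by (simp add: lookup_initial_part lookup_minus)
  next
    case False
    have "lookup r k = 0" if "\<forall>m'\<in>keys (single m 1 - r). monom_weight w k \<le> monom_weight w m'"
      using that key assms[of k] by (auto simp: not_in_keys_iff_lookup_eq_zero[symmetric] dest: leD)
    then show ?thesis using False by (auto simp: lookup_initial_part lookup_minus lookup_single_not_eq)
  qed
qed

lemma groebner_cone_if_strict:
  fixes w :: "real ^ 'n::card2 plucker"
  assumes strict: "\<And>a b. incomparable a b \<Longrightarrow> strict_at w a b"
  shows "initial_ideal w plucker_ideal = incomparable_ideal"
proof
  show "incomparable_ideal \<subseteq> initial_ideal w plucker_ideal"
    unfolding initial_ideal_def
  proof (rule incomparable_ideal_subset_linear_span)
    fix m :: "'n plucker \<Rightarrow>\<^sub>0 nat" assume "\<not> standard m"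
    then obtain a b u where ab: "incomparable a b" and m: "m = u + pair_monom a b"
      by (rule not_standardE)
    let ?r = "single u 1 * quadratic (straightening_coeff a b)"
    have "monom_weight w m < monom_weight w v" if v: "v \<in> keys ?r" for v
    proof -
      obtain v' where v': "v' \<in> keys (quadratic (straightening_coeff a b))" "v = u + v'"
        using v by (rule keys_single_multE)
      obtain p q where "straightening_coeff a b p q \<noteq> 0" "v' = pair_monom p q" by (rule keys_quadratic[OF v'(1)])
      then show ?thesis using strict[OF ab] by (simp add: m v'(2) monom_weight_pair strict_at_def)
    qed
    then have "initial_part w (single m 1 - ?r) = single m 1" by (rule initial_part_single)
    moreover have "single m 1 - ?r \<in> plucker_ideal" unfolding m by (rule straightening_mem[OF ab])
    ultimately have mem: "single m 1 \<in> initial_part w ` plucker_ideal" by (metis imageI)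
    interpret V: Vector_Spaces.vector_space "\<lambda>c (p :: ('n plucker, complex) mvpoly). mconst c * p"
      by (rule vector_space_mconst)
    from mem show "single m 1 \<in> linear_span (initial_part w ` plucker_ideal)"
      unfolding linear_span_def by (intro V.span_base)
  qed
next
  have weak: "weak_weight w" using strict by (force simp: weak_weight_def strict_at_def intro: less_imp_le)
  have "\<exists>h. single u 1 - h \<in> plucker_ideal \<and> (\<forall>v\<in>keys h. standard v) \<and>
      (if standard u then h = single u 1 else \<forall>v\<in>keys h. monom_weight w u < monom_weight w v)" for u :: "'n plucker \<Rightarrow>\<^sub>0 nat"
  proof (cases "standard u")
    case True
    then show ?thesis by (intro exI[of _ "single u 1"]) (simp add: plucker_ideal_zero)
  next
    case False
    then obtain a b u' where "incomparable a b" "u = u' + pair_monom a b" by (rule not_standardE)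
    then show ?thesis using strict_normal_form[OF weak _ strict, of a b u'] False by auto
  qed
  then obtain H where H: "\<And>u. single u 1 - H u \<in> plucker_ideal" "\<And>u v. v \<in> keys (H u) \<Longrightarrow> standard v"
    "\<And>u. if standard u then H u = single u 1 else \<forall>v\<in>keys (H u). monom_weight w u < monom_weight w v"
    by metis
  show "initial_ideal w plucker_ideal \<subseteq> incomparable_ideal"
    unfolding initial_ideal_def
  proof (rule linear_span_subset_incomparable_ideal, rule subsetI)
    fix p :: "('n plucker, complex) mvpoly" assume "p \<in> initial_part w ` plucker_ideal"
    then obtain g where g: "g \<in> plucker_ideal" "p = initial_part w g" by blast
    show "p \<in> incomparable_ideal"
      unfolding incomparable_ideal_iff
    proof (rule ballI, rule notI)
      fix v assume "v \<in> keys p" and std: "standard v"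
      then have v: "lookup g v \<noteq> 0" "\<forall>m'\<in>keys g. monom_weight w v \<le> monom_weight w m'"
        by (auto simp: g(2) in_keys_iff lookup_initial_part split: if_splits)
      \<comment> \<open>The normal form of \<open>g\<close>, which is 0 because \<open>g\<close>
        lies in the ideal. But a standard monomial \<open>v\<close> of least weight keeps its
        coefficient: other standard monomials are their own normal forms, and nonstandard ones have
        normal forms of strictly larger weight.\<close>
      define h where "h = (\<Sum>u\<in>keys g. mconst (lookup g u) * H u)"
      have "g - h = (\<Sum>u\<in>keys g. mconst (lookup g u) * single u 1) - h"
        by (simp add: mconst_mult_single sum_single_lookup)
      also have "\<dots> = (\<Sum>u\<in>keys g. mconst (lookup g u) * (single u 1 - H u))"
        by (simp add: h_def right_diff_distrib sum_subtractf)
      also have "\<dots> \<in> plucker_ideal" using H(1) by (intro plucker_ideal_sum plucker_ideal_mult)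
      finally have "g - (g - h) \<in> plucker_ideal" by (rule plucker_ideal_diff[OF g(1)])
      then have "h \<in> plucker_ideal" by simp
      moreover have "standard m" if "m \<in> keys h" for m
      proof -
        obtain u where "m \<in> keys (mconst (lookup g u) * H u)" using \<open>m \<in> keys h\<close> unfolding h_def by (rule keys_sumE)
        then show ?thesis using H(2) keys_mconst_mult by blast
      qed
      ultimately have "h = 0" by (rule standard_independence)
      have "lookup (H u) v = (if u = v then 1 else 0)" if u: "u \<in> keys g" for u
      proof (cases "standard u")
        case True
        then show ?thesis using H(3)[of u] by (auto simp: lookup_single when_def)
      next
        case False
        then have "v \<notin> keys (H u)" using H(3)[of u] v(2) u by (auto dest: leD)
        then show ?thesis using False std by (auto simp: not_in_keys_iff_lookup_eq_zero)
      qed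
      then have "lookup h v = (\<Sum>u\<in>keys g. if u = v then lookup g v else 0)"
        unfolding h_def lookup_sum by (intro sum.cong) auto
      also have "\<dots> = lookup g v" using v(1) by (auto simp: in_keys_iff)
      finally show False using v(1) \<open>h = 0\<close> by simp
    qed
  qed
qed

text \<open>The initial part of \<open>s(a, b)\<close> has only nonstandard monomials, and
  \<open>X_a X_b\<close> is the only nonstandard monomial of \<open>s(a, b)\<close>; so it alone has
  minimal weight.\<close>

lemma strict_if_groebner_cone:
  fixes w :: "real ^ 'n::card2 plucker"
  assumes eq: "initial_ideal w plucker_ideal = incomparable_ideal" and ab: "incomparable a b"
  shows "strict_at w a b"
  unfolding strict_at_def
proof (intro allI impI)
  fix p q assume pq: "straightening_coeff a b p q \<noteq> 0"
  let ?f = "straightening_coeff a b"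
  let ?s = "single (pair_monom a b) 1 - quadratic ?f"
  have "?s \<in> plucker_ideal"
    using straightening_coeff(1)[OF ab] by (simp add: straightens_def mvar_mult_mvar)
  interpret V: Vector_Spaces.vector_space "\<lambda>c (p :: ('n plucker, complex) mvpoly). mconst c * p"
    by (rule vector_space_mconst)
  have "initial_part w ?s \<in> initial_ideal w plucker_ideal"
    unfolding initial_ideal_def linear_span_def using \<open>?s \<in> plucker_ideal\<close> by (intro V.span_base imageI)
  then have nonstd: "\<not> standard m" if "m \<in> keys (initial_part w ?s)" for m
    using that unfolding eq incomparable_ideal_iff by blast
  have keys: "m = pair_monom a b \<or> (\<exists>p q. ?f p q \<noteq> 0 \<and> m = pair_monom p q)" if "m \<in> keys ?s" for m
  proof -
    from that show ?thesis
      by (rule keys_diffE) (auto elim: keys_quadratic)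
  qed
  have std: "standard (pair_monom p q)" if "?f p q \<noteq> 0" for p q
    using straightening_coeff(4)[OF ab that] by (rule standard_pair_monom)
  have "pair_monom a b \<noteq> pair_monom p q"
    using std[OF pq] ab by (metis standard_def keys_pair_monom insertCI)
  then have "lookup ?s (pair_monom p q) = - ?f p q"
    using lookup_quadratic[of ?f p q] straightening_coeff(4)[OF ab] pq
    by (simp add: lookup_minus lookup_single when_def)
  then have key: "pair_monom p q \<in> keys ?s" using pq by (simp add: in_keys_iff)
  obtain m where m: "m \<in> keys ?s" "\<forall>m'\<in>keys ?s. monom_weight w m \<le> monom_weight w m'"
    using ex_min_if_finite[of "monom_weight w ` keys ?s"] key by (force simp: not_less)
  have in_initial: "k \<in> keys (initial_part w ?s)" if "k \<in> keys ?s" "monom_weight w k \<le> monom_weight w m" for k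
    using that m(2) by (auto simp: in_keys_iff lookup_initial_part intro: order_trans)
  have "m = pair_monom a b" using keys[OF m(1)] nonstd[OF in_initial[OF m(1)]] std by auto
  moreover have "\<not> monom_weight w (pair_monom p q) \<le> monom_weight w m"
    using nonstd[OF in_initial[OF key]] std[OF pq] by blast
  ultimately show "w $ a + w $ b < w $ p + w $ q" using monom_weight_pair[of w 0] by simp
qed

lemma groebner_cone_iff:
  "w \<in> groebner_cone plucker_ideal incomparable_ideal \<longleftrightarrow> (\<forall>a b. diamond_pair a b \<longrightarrow> strict_at w a b)"
  unfolding groebner_cone_def mem_Collect_eq
  using groebner_cone_if_strict strict_if_groebner_cone strict_at_if_diamonds diamond_pair_incomparable
  by metis

section \<open>Diamond pairs and the inequalities of the cone\<close>

lemma straightening_coeff_quad: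
  fixes S a b c d
  assumes q: "quad TYPE('n::card2) S a b c d"
  defines "x \<equiv> pk2 S b c :: 'n plucker" and "y \<equiv> pk2 S a d"
  obtains \<epsilon>\<^sub>1 \<epsilon>\<^sub>2 where "\<epsilon>\<^sub>1 \<noteq> 0" "\<epsilon>\<^sub>2 \<noteq> 0"
    "straightening_coeff x y = (\<lambda>p q. (if p = pk2 S a c \<and> q = pk2 S b d then \<epsilon>\<^sub>1 else 0) +
       (if p = pk2 S a b \<and> q = pk2 S c d then \<epsilon>\<^sub>2 else 0))"
    "straightening x y 1 (\<lambda>i. if i = 0 then \<epsilon>\<^sub>1 else \<epsilon>\<^sub>2) (\<lambda>i. if i = 0 then pk2 S a c else pk2 S a b)
      (\<lambda>i. if i = 0 then pk2 S b d else pk2 S c d)"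
proof -
  note L = quad_lattice[OF q, folded x_def y_def]
  obtain \<epsilon>\<^sub>1 \<epsilon>\<^sub>2 where \<epsilon>: "\<epsilon>\<^sub>1 \<noteq> 0" "\<epsilon>\<^sub>2 \<noteq> 0"
    and I: "mvar x * mvar y - (mconst \<epsilon>\<^sub>1 * mvar (pk2 S a c) * mvar (pk2 S b d) +
       mconst \<epsilon>\<^sub>2 * mvar (pk2 S a b) * mvar (pk2 S c d)) \<in> plucker_ideal"
    unfolding x_def y_def using quad_three_term[OF q] by blast
  have lt1: "pk2 S a c < (pk2 S b d :: 'n plucker)"
    using incomparable_sup_inf[OF L(3)] unfolding L(1,2) by (blast intro: less_trans)
  have lt2: "pk2 S a b < (pk2 S c d :: 'n plucker)" "pk2 S a b < (pk2 S a c :: 'n plucker)"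
    using lt1 L(4,5) unfolding L(1,2) by (blast intro: less_trans)+
  have "straightens (\<lambda>p q. (if p = pk2 S a c \<and> q = pk2 S b d then \<epsilon>\<^sub>1 else 0) +
       (if p = pk2 S a b \<and> q = pk2 S c d then \<epsilon>\<^sub>2 else 0)) x y"
    unfolding straightens_def quadratic_add quadratic_delta
    using I less_imp_le[OF lt1] less_imp_le[OF lt2(1)] by (auto simp: mult.assoc split: if_splits)
  note coeff = straightening_coeff_eqI[OF this]
  have "straightening x y 1 (\<lambda>i. if i = 0 then \<epsilon>\<^sub>1 else \<epsilon>\<^sub>2) (\<lambda>i. if i = 0 then pk2 S a c else pk2 S a b)
      (\<lambda>i. if i = 0 then pk2 S b d else pk2 S c d)"
    unfolding straightening_def
    using \<epsilon> I lt1 lt2 L(1,2) by (auto simp: inj_on_def)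
  then show ?thesis using that \<epsilon> coeff by blast
qed

lemma strict_at_quad:
  assumes q: "quad TYPE('n::card2) S a b c d"
  shows "strict_at w (pk2 S b c) (pk2 S a d :: 'n plucker) \<longleftrightarrow>
    w $ pk2 S b c + w $ pk2 S a d < w $ pk2 S a c + w $ pk2 S b d \<and>
    w $ pk2 S b c + w $ pk2 S a d < w $ pk2 S a b + w $ pk2 S c d"
proof -
  obtain \<epsilon>\<^sub>1 \<epsilon>\<^sub>2 where \<epsilon>: "\<epsilon>\<^sub>1 \<noteq> 0" "\<epsilon>\<^sub>2 \<noteq> 0"
    and c: "straightening_coeff (pk2 S b c :: 'n plucker) (pk2 S a d) =
      (\<lambda>p q. (if p = pk2 S a c \<and> q = pk2 S b d then \<epsilon>\<^sub>1 else 0) +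
       (if p = pk2 S a b \<and> q = pk2 S c d then \<epsilon>\<^sub>2 else 0))"
    by (rule straightening_coeff_quad[OF q])
  have "pk2 S a b \<noteq> (pk2 S a c :: 'n plucker)"
    using quad_lattice(4)[OF q] unfolding quad_lattice(2)[OF q] by simp
  then show ?thesis
    unfolding strict_at_def c using \<epsilon> by (auto split: if_splits)
qed

lemma straightening_commute: "straightening a b = straightening b a"
  by (intro ext) (simp add: straightening_def inf_commute sup_commute mult.commute[of "mvar a"])

text \<open>Straightening is unique and the pair of index 0 is fixed as meet and join, so the pair
  of index 1 must be the other term of the three-term relation.\<close>

lemma further_pair_quad:
  assumes q: "quad TYPE('n::card2) S a b c d"
  shows "further_pair (pk2 S b c) (pk2 S a d :: 'n plucker) = (pk2 S a b, pk2 S c d)"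
proof -
  let ?x = "pk2 S b c :: 'n plucker" and ?y = "pk2 S a d :: 'n plucker"
  note L = quad_lattice[OF q]
  obtain \<epsilon>\<^sub>1 \<epsilon>\<^sub>2 where \<epsilon>: "\<epsilon>\<^sub>1 \<noteq> 0" "\<epsilon>\<^sub>2 \<noteq> 0"
    and coeff: "straightening_coeff ?x ?y =
      (\<lambda>p q. (if p = pk2 S a c \<and> q = pk2 S b d then \<epsilon>\<^sub>1 else 0) +
       (if p = pk2 S a b \<and> q = pk2 S c d then \<epsilon>\<^sub>2 else 0))"
    and st: "straightening ?x ?y 1 (\<lambda>i. if i = 0 then \<epsilon>\<^sub>1 else \<epsilon>\<^sub>2) (\<lambda>i. if i = 0 then pk2 S a c else pk2 S a b)
      (\<lambda>i. if i = 0 then pk2 S b d else pk2 S c d)"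
    by (rule straightening_coeff_quad[OF q])
  show ?thesis
    unfolding further_pair_def
  proof (rule the_equality)
    show "\<exists>c' p q. straightening ?x ?y 1 c' p q \<and> (pk2 S a b, pk2 S c d) = (p 1, q 1)"
      using st by (intro exI conjI, assumption) simp
  next
    fix z assume "\<exists>c' p q. straightening ?x ?y 1 c' p q \<and> z = (p 1, q 1)"
    then obtain c' p q where s: "straightening ?x ?y 1 c' p q" and z: "z = (p 1, q 1)" by blast
    let ?f = "\<lambda>u v. (if u = p 0 \<and> v = q 0 then c' 0 else 0) + (if u = p 1 \<and> v = q 1 then c' 1 else 0)"
    have lt: "p 0 < q 0" "p 1 < q 1" and c': "c' 1 \<noteq> 0" using s by (auto simp: straightening_def)
    have "inj_on (\<lambda>i. (p i, q i)) {..1::nat}" using s by (simp add: straightening_def)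
    then have ne: "(p 0, q 0) \<noteq> (p 1, q 1)" using inj_onD[of "\<lambda>i. (p i, q i)" "{..1::nat}" 0 1] by auto
    have "mvar ?x * mvar ?y - (mconst (c' 0) * (mvar (p 0) * mvar (q 0)) + mconst (c' 1) * (mvar (p 1) * mvar (q 1))) \<in> plucker_ideal"
    proof -
      have "mvar ?x * mvar ?y - (\<Sum>i\<le>1. mconst (c' i) * mvar (p i) * mvar (q i)) \<in> plucker_ideal"
        using s unfolding straightening_def by blast
      then show ?thesis by (simp add: mult.assoc)
    qed
    then have "straightens ?f ?x ?y"
      unfolding straightens_def quadratic_add quadratic_delta
      using lt by (auto split: if_splits)
    then have "straightening_coeff ?x ?y = ?f" by (rule straightening_coeff_eqI)
    then have "straightening_coeff ?x ?y (p 1) (q 1) \<noteq> 0" using ne c' by auto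
    moreover have "p 0 = pk2 S a c" "q 0 = pk2 S b d" using s L(1,2) by (auto simp: straightening_def)
    ultimately show "z = (pk2 S a b, pk2 S c d)"
      using ne unfolding coeff z by (auto split: if_splits)
  qed
qed

lemma further_pair_commute: "further_pair a b = further_pair b a"
  unfolding further_pair_def by (subst straightening_commute) (rule refl)

text \<open>The last conclusion allows evaluating both sides of an inequality without knowing which
  of \<open>a\<close>, \<open>b\<close> is which column.\<close>

lemma diamond_pair_data:
  fixes a b :: "'n::card2 plucker"
  assumes "diamond_pair a b"
  obtains S i j where "quad TYPE('n) S i (Suc i) j (Suc j)" "{a, b} = {pk2 S (Suc i) j, pk2 S i (Suc j)}"
    "sup a b = pk2 S (Suc i) (Suc j)" "inf a b = pk2 S i j" "p1 a b = pk2 S i (Suc i)" "q1 a b = pk2 S j (Suc j)"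
    "\<And>f :: 'n plucker \<Rightarrow> real. f a + f b = f (pk2 S (Suc i) j) + f (pk2 S i (Suc j))"
proof -
  obtain S i j where q: "quad TYPE('n) S i (Suc i) j (Suc j)"
    and ab: "(a = pk2 S (Suc i) j \<and> b = pk2 S i (Suc j)) \<or> (b = pk2 S (Suc i) j \<and> a = pk2 S i (Suc j))"
    by (rule diamond_pair_quad[OF assms])
  note L = quad_lattice[OF q] further_pair_quad[OF q]
  note C = sup_commute[of a b] inf_commute[of a b] further_pair_commute[of a b]
  show ?thesis
  proof (rule that[OF q])
    show "{a, b} = {pk2 S (Suc i) j, pk2 S i (Suc j)}" using ab by auto
    show "f a + f b = f (pk2 S (Suc i) j) + f (pk2 S i (Suc j))" for f :: "'n plucker \<Rightarrow> real" using ab by auto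
    show "sup a b = pk2 S (Suc i) (Suc j)" using ab L C by auto
    show "inf a b = pk2 S i j" using ab L C by auto
    show "p1 a b = pk2 S i (Suc i)" using ab L C by (auto simp: p1_def)
    show "q1 a b = pk2 S j (Suc j)" using ab L C by (auto simp: q1_def)
  qed
qed

lemma special_diamond_pair_data:
  fixes a b :: "'n::card2 plucker"
  assumes "special_diamond_pair a b"
  obtains S i where "quad TYPE('n) S i (Suc i) (Suc (Suc i)) (Suc (Suc (Suc i)))"
    "{a, b} = {pk2 S (Suc i) (Suc (Suc i)), pk2 S i (Suc (Suc (Suc i)))}"
    "p1 a b = pk2 S i (Suc i)" "q1 a b = pk2 S (Suc (Suc i)) (Suc (Suc (Suc i)))"
    "\<And>f :: 'n plucker \<Rightarrow> real. f a + f b = f (pk2 S (Suc i) (Suc (Suc i))) + f (pk2 S i (Suc (Suc (Suc i))))"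
proof -
  have "diamond_pair a b" using assms by (simp add: special_diamond_pair_def)
  then obtain S i j where *: "quad TYPE('n) S i (Suc i) j (Suc j)" "{a, b} = {pk2 S (Suc i) j, pk2 S i (Suc j)}"
    "sup a b = pk2 S (Suc i) (Suc j)" "inf a b = pk2 S i j" "p1 a b = pk2 S i (Suc i)" "q1 a b = pk2 S j (Suc j)"
    "\<And>f :: 'n plucker \<Rightarrow> real. f a + f b = f (pk2 S (Suc i) j) + f (pk2 S i (Suc j))"
    using diamond_pair_data[of a b] by metis
  have "j = Suc (Suc i)"
    using assms quad_diamond(2)[OF *(1)] by (simp add: special_diamond_pair_def *)
  then show ?thesis using that[of S i] * by simp
qed

lemma special_diamond_pair_quad:
  assumes q: "quad TYPE('n::card2) S i (Suc i) (Suc (Suc i)) (Suc (Suc (Suc i)))"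
  shows "special_diamond_pair (pk2 S (Suc i) (Suc (Suc i))) (pk2 S i (Suc (Suc (Suc i))) :: 'n plucker)"
  unfolding special_diamond_pair_def
  using quad_diamond[OF q] further_pair_quad[OF q] quad_lattice(1)[OF q] by (simp add: q1_def)

text \<open>When a square is cut in two, adding the inequalities of the pieces cancels the values on
  the common side.\<close>

lemma strictly_supermodular:
  fixes w :: "'a::{finite,distrib_lattice} \<Rightarrow> real"
  assumes dia: "\<And>a b. diamond_pair a b \<Longrightarrow> w a + w b < w (sup a b) + w (inf a b)"
    and "incomparable a b"
  shows "w a + w b < w (sup a b) + w (inf a b)"
  using assms(2)
proof (induction rule: incomparable_diamond_induct)
  case (commute a b)
  then show ?case by (simp add: sup_commute inf_commute add.commute)
next
  case (between a b c)
  then show ?case unfolding incomparable_between[OF between(1-3)] by linarith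
qed (rule dia)

text \<open>Writing \<open>uv\<close> for the index set \<open>S \<union> {u, v}\<close>, the inequality for four elements \<open>a < b < c < d\<close>
  is reduced to smaller spans by any further element \<open>e\<close> between \<open>a\<close> and \<open>d\<close>.\<close>

lemma quad_outer_inequality:
  fixes w :: "real ^ 'n::card2 plucker"
  assumes sm: "\<And>S a b c d. quad TYPE('n) S a b c d \<Longrightarrow>
      w $ pk2 S b c + w $ pk2 S a d < w $ pk2 S a c + w $ pk2 S b d"
    and sp: "\<And>S i. quad TYPE('n) S i (Suc i) (Suc (Suc i)) (Suc (Suc (Suc i))) \<Longrightarrow>
      w $ pk2 S (Suc i) (Suc (Suc i)) + w $ pk2 S i (Suc (Suc (Suc i))) <
      w $ pk2 S i (Suc i) + w $ pk2 S (Suc (Suc i)) (Suc (Suc (Suc i)))"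
  shows "quad TYPE('n) S a b c d \<Longrightarrow> w $ pk2 S b c + w $ pk2 S a d < w $ pk2 S a b + w $ pk2 S c d"
proof (induction "d - a" arbitrary: S a b c d rule: less_induct)
  case less
  note q = less.prems
  have o: "1 \<le> a" "a < b" "b < c" "c < d" "d \<le> Suc CARD('n)" "a \<notin> S" "b \<notin> S" "c \<notin> S" "d \<notin> S" "S \<subseteq> {1..Suc CARD('n)}"
    using q by (auto simp: quad_def)
  have IH: "w $ pk2 S' b' c' + w $ pk2 S' a' d' < w $ pk2 S' a' b' + w $ pk2 S' c' d'"
    if q': "quad TYPE('n) S' a' b' c' d'" and "a \<le> a'" "d' \<le> d" "a < a' \<or> d' < d" for S' a' b' c' d'
  proof -
    have "a' < d'" using q' by (simp add: quad_def)
    then have "d' - a' < d - a" using that(2-4) by linarith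
    then show ?thesis using less.hyps q' by blast
  qed
  show ?case
  proof (cases "\<exists>e. a < e \<and> e < d \<and> e \<noteq> b \<and> e \<noteq> c")
    case False
    then have *: "e = b \<or> e = c" if "a < e" "e < d" for e using that by blast
    have "b = Suc a" using *[of "Suc a"] o by force
    moreover have "c = Suc b" using *[of "Suc b"] o by force
    moreover have "d = Suc c" using *[of "Suc c"] o by force
    ultimately show ?thesis using sp[of S a] q by simp
  next
    case True
    then obtain e where e: "a < e" "e < d" "e \<noteq> b" "e \<noteq> c" by blast
    show ?thesis
    proof (cases "e \<in> S")
      case False
      consider "e < b" | "b < e" "e < c" | "c < e" using e by linarith
      then show ?thesis
      proof cases
        case 1
        have "quad TYPE('n) S e b c d" "quad TYPE('n) S a e b d" using o e 1 False by (auto simp: quad_def)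
        then show ?thesis using IH[of S e b c d] sm[of S a e b d] o e by (auto simp: insert_commute)
      next
        case 2
        have "quad TYPE('n) S a b e c" "quad TYPE('n) S b e c d" using o e 2 False by (auto simp: quad_def)
        then show ?thesis using IH[of S a b e c] IH[of S b e c d] sm[OF q] o e by (auto simp: insert_commute)
      next
        case 3
        have "quad TYPE('n) S a b c e" "quad TYPE('n) S a c e d" using o e 3 False by (auto simp: quad_def)
        then show ?thesis using IH[of S a b c e] sm[of S a c e d] o e by (auto simp: insert_commute)
      qed
    next
      case True
      \<comment> \<open>Now \<open>e\<close> belongs to all columns involved. One of the five
        entries joins \<open>S'\<close> as common part, and inequalities between triples of entries
        telescope as in the previous case.\<close>
      define S' where "S' = S - {e}"
      have S: "S = insert e S'" using True by (auto simp: S'_def)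
      have o': "a \<notin> S'" "b \<notin> S'" "c \<notin> S'" "d \<notin> S'" "e \<notin> S'" "S' \<subseteq> {1..Suc CARD('n)}" using o by (auto simp: S'_def)
      consider "e < b" | "b < e" "e < c" | "c < e" using e by linarith
      then show ?thesis
      proof cases
        case 1
        have "quad TYPE('n) (insert a S') e b c d" "quad TYPE('n) (insert c S') a e b d"
          using o o' e 1 by (auto simp: quad_def)
        then show ?thesis
          using IH[of "insert a S'" e b c d] sm[of "insert c S'" a e b d] o e unfolding S by (auto simp: insert_commute)
      next
        case 2
        have "quad TYPE('n) (insert d S') a b e c" "quad TYPE('n) (insert a S') b e c d" "quad TYPE('n) (insert e S') a b c d"
          using o o' e 2 by (auto simp: quad_def)
        then show ?thesis
          using IH[of "insert d S'" a b e c] IH[of "insert a S'" b e c d] sm[of "insert e S'" a b c d] o e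
          unfolding S by (auto simp: insert_commute)
      next
        case 3
        have "quad TYPE('n) (insert d S') a b c e" "quad TYPE('n) (insert b S') a c e d"
          using o o' e 3 by (auto simp: quad_def)
        then show ?thesis
          using IH[of "insert d S'" a b c e] sm[of "insert b S'" a c e d] o e unfolding S by (auto simp: insert_commute)
      qed
    qed
  qed
qed

lemma groebner_cone_eq:
  "groebner_cone plucker_ideal incomparable_ideal = {w :: real ^ 'n::card2 plucker.
     (\<forall>a b. diamond_pair a b \<longrightarrow> w $ a + w $ b < w $ sup a b + w $ inf a b) \<and>
     (\<forall>a b. special_diamond_pair a b \<longrightarrow> w $ a + w $ b < w $ p1 a b + w $ q1 a b)}" (is "_ = ?R")
proof (intro antisym subsetI)
  fix w :: "real ^ 'n plucker"
  assume w: "w \<in> groebner_cone plucker_ideal incomparable_ideal"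
  have both: "w $ a + w $ b < w $ sup a b + w $ inf a b \<and> w $ a + w $ b < w $ p1 a b + w $ q1 a b"
    if ab: "diamond_pair a b" for a b
  proof -
    obtain S i j where d: "quad TYPE('n) S i (Suc i) j (Suc j)"
      "sup a b = pk2 S (Suc i) (Suc j)" "inf a b = pk2 S i j" "p1 a b = pk2 S i (Suc i)" "q1 a b = pk2 S j (Suc j)"
      "\<And>f :: 'n plucker \<Rightarrow> real. f a + f b = f (pk2 S (Suc i) j) + f (pk2 S i (Suc j))"
      using diamond_pair_data[OF ab] by metis
    have "strict_at w (pk2 S (Suc i) j) (pk2 S i (Suc j))"
      using w quad_diamond(1)[OF d(1)] unfolding groebner_cone_iff by blast
    then show ?thesis unfolding strict_at_quad[OF d(1)] d(2-5) d(6)[of "\<lambda>x. w $ x"] by simp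
  qed
  then show "w \<in> ?R" by (auto simp: special_diamond_pair_def)
next
  fix w :: "real ^ 'n plucker" assume w: "w \<in> ?R"
  have sm: "w $ pk2 S b c + w $ pk2 S a d < w $ pk2 S a c + w $ pk2 S b d" if q: "quad TYPE('n) S a b c d" for S a b c d
    using strictly_supermodular[of "\<lambda>x. w $ x", OF _ quad_lattice(3)[OF q]] w
    unfolding quad_lattice(1,2)[OF q] by simp
  have sp: "w $ pk2 S (Suc i) (Suc (Suc i)) + w $ pk2 S i (Suc (Suc (Suc i))) <
      w $ pk2 S i (Suc i) + w $ pk2 S (Suc (Suc i)) (Suc (Suc (Suc i)))"
    if q: "quad TYPE('n) S i (Suc i) (Suc (Suc i)) (Suc (Suc (Suc i)))" for S i
  proof -
    let ?x = "pk2 S (Suc i) (Suc (Suc i)) :: 'n plucker" and ?y = "pk2 S i (Suc (Suc (Suc i)))"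
    have "w $ ?x + w $ ?y < w $ p1 ?x ?y + w $ q1 ?x ?y" using w special_diamond_pair_quad[OF q] by blast
    then show ?thesis by (simp add: p1_def q1_def further_pair_quad[OF q])
  qed
  show "w \<in> groebner_cone plucker_ideal incomparable_ideal"
    unfolding groebner_cone_iff
  proof (intro allI impI)
    fix a b :: "'n plucker" assume ab: "diamond_pair a b"
    obtain S i j where q: "quad TYPE('n) S i (Suc i) j (Suc j)"
      "(a = pk2 S (Suc i) j \<and> b = pk2 S i (Suc j)) \<or> (b = pk2 S (Suc i) j \<and> a = pk2 S i (Suc j))"
      by (rule diamond_pair_quad[OF ab])
    have "strict_at w (pk2 S (Suc i) j) (pk2 S i (Suc j))"
      using strict_at_quad[OF q(1)] sm[OF q(1)] quad_outer_inequality[OF sm sp q(1)] by blast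
    then show "strict_at w a b" using q(2) strict_at_commute by metis
  qed
qed

section \<open>Facets\<close>

no_notation Matrix.scalar_prod (infix \<open>\<bullet>\<close> 70)

text \<open>Adding to \<open>v\<close> the multiple of \<open>w0\<close> that makes
  \<open>l0\<close> vanish gives a point of the hyperplane where all other functionals are positive.
  Hence the face contains a nonempty relatively open part of the hyperplane and has its
  dimension.\<close>

lemma facet_of_polyhedral_cone:
  fixes L :: "'a::euclidean_space set"
  assumes fin: "finite L" and C: "C = {w. \<forall>l\<in>L. 0 < l \<bullet> w}" and w0: "w0 \<in> C"
    and l0: "l0 \<in> L" and v: "l0 \<bullet> v < 0" "\<And>l. l \<in> L \<Longrightarrow> l = l0 \<or> 0 \<le> l \<bullet> v"
  shows "{w \<in> closure C. l0 \<bullet> w = 0} facet_of closure C"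
proof -
  have pos: "0 < l \<bullet> w0" if "l \<in> L" for l using w0 that by (simp add: C)
  have half: "C = (\<Inter>l\<in>L. {w. 0 < l \<bullet> w})" by (auto simp: C)
  have op: "open C" unfolding half using fin by (intro open_INT) (auto intro: open_halfspace_gt)
  have conv: "convex C" unfolding half by (intro convex_INT) (auto intro: convex_halfspace_gt)
  have cl: "closure C = {w. \<forall>l\<in>L. 0 \<le> l \<bullet> w}"
  proof
    have "{w. \<forall>l\<in>L. 0 \<le> l \<bullet> w} = (\<Inter>l\<in>L. {w. 0 \<le> l \<bullet> w})" by auto
    then have "closed {w. \<forall>l\<in>L. 0 \<le> l \<bullet> w}"
      by (auto intro!: closed_INT closed_halfspace_ge)
    then show "closure C \<subseteq> {w. \<forall>l\<in>L. 0 \<le> l \<bullet> w}"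
      by (intro closure_minimal) (auto simp: C intro: less_imp_le)
    show "{w. \<forall>l\<in>L. 0 \<le> l \<bullet> w} \<subseteq> closure C"
    proof
      fix w assume w: "w \<in> {w. \<forall>l\<in>L. 0 \<le> l \<bullet> w}"
      \<comment> \<open>Small multiples of the interior point make the weak inequalities
        strict.\<close>
      have "(\<lambda>k. w + inverse (real (Suc k)) *\<^sub>R w0) \<longlonglongrightarrow> w + 0 *\<^sub>R w0"
        by (intro tendsto_intros LIMSEQ_inverse_real_of_nat)
      moreover have "w + inverse (real (Suc k)) *\<^sub>R w0 \<in> C" for k
        using w pos by (auto simp: C inner_add_right intro!: add_nonneg_pos)
      ultimately show "w \<in> closure C"
        unfolding closure_sequential by (intro exI[of _ "\<lambda>k. w + inverse (real (Suc k)) *\<^sub>R w0"]) simp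
    qed
  qed
  let ?F = "{w \<in> closure C. l0 \<bullet> w = 0}" and ?H = "{x. l0 \<bullet> x = 0}"
  let ?O = "\<Inter>l\<in>L - {l0}. {w. 0 < l \<bullet> w}"
  have "closure C \<inter> {x. (- l0) \<bullet> x = 0} face_of closure C"
  proof (rule face_of_Int_supporting_hyperplane_le)
    show "(- l0) \<bullet> x \<le> 0" if "x \<in> closure C" for x using that l0 by (simp add: cl)
  qed (rule convex_closure[OF conv])
  moreover have "closure C \<inter> {x. (- l0) \<bullet> x = 0} = ?F" by auto
  ultimately have face: "?F face_of closure C" by simp
  define t where "t = - (l0 \<bullet> v) / (l0 \<bullet> w0)"
  define z where "z = v + t *\<^sub>R w0"
  have "0 < t" unfolding t_def using v(1) pos[OF l0] by (intro divide_pos_pos) auto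
  then have "z \<in> ?O"
    using v(2) pos unfolding z_def by (force simp: inner_add_right intro!: add_nonneg_pos)
  moreover have zH: "z \<in> ?H"
  proof -
    have "t * (l0 \<bullet> w0) = - (l0 \<bullet> v)" using pos[OF l0] by (simp add: t_def)
    then show ?thesis by (simp add: z_def inner_add_right)
  qed
  ultimately have ne: "?H \<inter> ?O \<noteq> {}" by blast
  have "l0 \<noteq> 0" using v(1) by auto
  have "?H \<inter> ?O \<subseteq> ?F" unfolding cl by (auto intro: less_imp_le)
  then have "aff_dim (?H \<inter> ?O) \<le> aff_dim ?F" by (rule aff_dim_subset)
  moreover have "aff_dim (?H \<inter> ?O) = aff_dim ?H"
  proof (rule aff_dim_convex_Int_open)
    show "open ?O" using fin by (intro open_INT) (auto intro: open_halfspace_gt)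
  qed (use ne convex_hyperplane in auto)
  moreover have "aff_dim ?F \<le> aff_dim ?H" by (intro aff_dim_subset) auto
  moreover have "aff_dim ?H = int DIM('a) - 1" using aff_dim_hyperplane[OF \<open>l0 \<noteq> 0\<close>] by simp
  moreover have "aff_dim (closure C) = int DIM('a)" using aff_dim_open[OF op] w0 by auto
  moreover have "?F \<noteq> {}" using ne \<open>?H \<inter> ?O \<subseteq> ?F\<close> by blast
  ultimately show ?thesis using face by (simp add: facet_of_def)
qed

section \<open>Functions violating a single inequality\<close>

definition exchange_vector :: "'v::finite \<Rightarrow> 'v \<Rightarrow> 'v \<Rightarrow> 'v \<Rightarrow> real ^ 'v" where
  "exchange_vector a b p q = axis p 1 + axis q 1 - (axis a 1 + axis b 1)"

lemma inner_exchange_vector: "exchange_vector a b p q \<bullet> w = w $ p + w $ q - (w $ a + w $ b)"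
  by (simp add: exchange_vector_def inner_diff_left inner_add_left inner_axis')

lemma exchange_vector_cong: "{a, b} = {c, d} \<Longrightarrow> {p, q} = {r, s} \<Longrightarrow> exchange_vector a b p q = exchange_vector c d r s"
  by (auto simp: exchange_vector_def doubleton_eq_iff)

text \<open>Meet and join lie one level from the common level \<open>d\<close> of the pair:
  \<open>(d - 1)^2 + (d + 1)^2 - 2 d^2 = 2\<close>.\<close>

lemma depth_square_diamond:
  assumes "diamond_pair a (b :: 'n::card2 plucker)"
  shows "real (depth (sup a b)) ^ 2 + real (depth (inf a b)) ^ 2 - (real (depth a) ^ 2 + real (depth b) ^ 2) = 2"
proof -
  obtain S i j where d: "quad TYPE('n) S i (Suc i) j (Suc j)"
    "sup a b = pk2 S (Suc i) (Suc j)" "inf a b = pk2 S i j"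
    "\<And>f :: 'n plucker \<Rightarrow> real. f a + f b = f (pk2 S (Suc i) j) + f (pk2 S i (Suc j))"
    using diamond_pair_data[OF assms] by metis
  have o: "Suc i < j" using d(1) by (simp add: quad_def)
  define K where "K = real ((\<Sum>z\<le>CARD('n). cnt S z) + 2 * Suc CARD('n))"
  have D: "real (depth (pk2 S u v :: 'n plucker)) = K - real u - real v"
    if "u \<in> {i, Suc i, j, Suc j}" "v \<in> {i, Suc i, j, Suc j}" "u \<noteq> v" for u v
    using quad_depth[OF d(1) that] unfolding K_def by linarith
  have eqs: "real (depth (pk2 S (Suc i) (Suc j) :: 'n plucker)) = K - real (Suc i) - real (Suc j)"
    "real (depth (pk2 S i j :: 'n plucker)) = K - real i - real j"
    "real (depth (pk2 S (Suc i) j :: 'n plucker)) = K - real (Suc i) - real j"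
    "real (depth (pk2 S i (Suc j) :: 'n plucker)) = K - real i - real (Suc j)"
    using o by (intro D; auto)+
  show ?thesis
    unfolding d(2,3) d(4)[of "\<lambda>x. real (depth x) ^ 2"] eqs by (simp add: power2_eq_square algebra_simps)
qed

text \<open>The further term of a special pair lies two levels away on both sides:
  \<open>(d + 2)^2 + (d - 2)^2 - 2 d^2 = 8\<close>.\<close>

lemma depth_square_special:
  assumes "special_diamond_pair a (b :: 'n::card2 plucker)"
  shows "real (depth (p1 a b)) ^ 2 + real (depth (q1 a b)) ^ 2 - (real (depth a) ^ 2 + real (depth b) ^ 2) = 8"
proof -
  obtain S i where d: "quad TYPE('n) S i (Suc i) (Suc (Suc i)) (Suc (Suc (Suc i)))"
    "p1 a b = pk2 S i (Suc i)" "q1 a b = pk2 S (Suc (Suc i)) (Suc (Suc (Suc i)))"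
    "\<And>f :: 'n plucker \<Rightarrow> real. f a + f b = f (pk2 S (Suc i) (Suc (Suc i))) + f (pk2 S i (Suc (Suc (Suc i))))"
    using special_diamond_pair_data[OF assms] by metis
  define K where "K = real ((\<Sum>z\<le>CARD('n). cnt S z) + 2 * Suc CARD('n))"
  have D: "real (depth (pk2 S u v :: 'n plucker)) = K - real u - real v"
    if "u \<in> {i, Suc i, Suc (Suc i), Suc (Suc (Suc i))}" "v \<in> {i, Suc i, Suc (Suc i), Suc (Suc (Suc i))}" "u \<noteq> v" for u v
    using quad_depth[OF d(1) that] unfolding K_def by linarith
  have eqs: "real (depth (pk2 S i (Suc i) :: 'n plucker)) = K - real i - real (Suc i)"
    "real (depth (pk2 S (Suc (Suc i)) (Suc (Suc (Suc i))) :: 'n plucker)) = K - real (Suc (Suc i)) - real (Suc (Suc (Suc i)))"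
    "real (depth (pk2 S (Suc i) (Suc (Suc i)) :: 'n plucker)) = K - real (Suc i) - real (Suc (Suc i))"
    "real (depth (pk2 S i (Suc (Suc (Suc i))) :: 'n plucker)) = K - real i - real (Suc (Suc (Suc i)))"
    by (intro D; simp)+
  show ?thesis
    unfolding d(2,3) d(4)[of "\<lambda>x. real (depth x) ^ 2"] eqs by (simp add: power2_eq_square algebra_simps)
qed

lemma covers_between: "covers y x \<Longrightarrow> x \<le> z \<Longrightarrow> z \<le> y \<Longrightarrow> z = x \<or> z = y"
  unfolding covers_def by (metis le_less)

text \<open>The meet of \<open>a\<close> with an element above \<open>c\<close> is \<open>a\<close>
  or \<open>c\<close>, so distributivity makes \<open>a\<close> join-prime above \<open>c\<close>.
  Consequently \<open>z \<mapsto> a \<le> sup z c\<close> is a lattice homomorphism to the truth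
  values.\<close>

lemma covers_prime:
  fixes a c :: "'a::distrib_lattice"
  assumes "covers a c"
  shows "a \<le> sup (sup x y) c \<longleftrightarrow> a \<le> sup x c \<or> a \<le> sup y c"
proof
  have c: "c < a" using assms by (simp add: covers_def)
  have eq: "inf a (sup x c) = c" if "\<not> a \<le> sup x c" for x
  proof -
    have "c \<le> inf a (sup x c)" using c by simp
    moreover have "inf a (sup x c) \<noteq> a" using that by (metis inf_le2)
    ultimately show ?thesis using covers_between[OF assms] inf_le1 by blast
  qed
  show "a \<le> sup x c \<or> a \<le> sup y c" if le: "a \<le> sup (sup x y) c"
  proof (rule ccontr)
    assume "\<not> (a \<le> sup x c \<or> a \<le> sup y c)"
    then have "sup (inf a (sup x c)) (inf a (sup y c)) = c" using eq by simp
    then have "inf a (sup (sup x c) (sup y c)) = c" by (simp add: inf_sup_distrib1)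
    moreover have "sup (sup x c) (sup y c) = sup (sup x y) c" by (simp add: sup_aci)
    ultimately show False using le c by (simp add: inf.absorb1)
  qed
  show "a \<le> sup x c \<or> a \<le> sup y c \<Longrightarrow> a \<le> sup (sup x y) c"
    by (meson order_trans sup_mono sup_ge1 sup_ge2 order_refl)
qed

lemma covered_eqI:
  fixes a c e x :: "'a::lattice"
  assumes "covers e x" "covers e a" "c \<le> e" "a \<le> sup x c" "sup x c \<noteq> e"
  shows "x = a"
proof -
  have "x \<le> e" using assms(1) by (simp add: covers_def less_imp_le)
  then have "sup x c = a" using covers_between[OF assms(2,4)] assms(3,5) by simp
  then have "x \<le> a" by (metis sup_ge1)
  moreover have "a < e" using assms(2) by (simp add: covers_def)
  ultimately show ?thesis using covers_between[OF assms(1), of a] by (auto intro: less_imp_le)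
qed

text \<open>For a diamond the first summand is the product of the two homomorphisms of
  \<open>covers_prime\<close> belonging to \<open>a\<close> and \<open>b\<close>. It alone does not
  distinguish the diamond from parallel ones elsewhere in the lattice; the second summand singles
  out the one with top \<open>sup a b\<close>.\<close>

definition diamond_bump :: "'a::lattice \<Rightarrow> 'a \<Rightarrow> 'a \<Rightarrow> real" where
  "diamond_bump a b z = of_bool (sup a b \<le> sup z (inf a b)) + of_bool (z = sup a b)"

lemma diamond_bump_le: "diamond_bump a b p + diamond_bump a b q - (diamond_bump a b x + diamond_bump a b y) \<le> 4"
  by (simp add: diamond_bump_def)

lemma diamond_bump_self:
  assumes "diamond_pair a b"
  shows "diamond_bump a b (sup a b) + diamond_bump a b (inf a b) - (diamond_bump a b a + diamond_bump a b b) = 2"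
proof -
  have "a < sup a b" "b < sup a b" "inf a b < a" "inf a b < sup a b"
    using incomparable_sup_inf[OF diamond_pair_incomparable[OF assms]] by (blast intro: less_trans)+
  moreover have "sup a (inf a b) = a" "sup b (inf a b) = b" by (simp_all add: sup_absorb1)
  moreover have "sup (sup a b) (inf a b) = sup a b" by (simp add: sup_absorb1 le_infI1)
  ultimately show ?thesis
    using diamond_pair_incomparable[OF assms] by (auto simp: diamond_bump_def less_le incomparable_def)
qed

text \<open>The first summand contributes 1 only if \<open>x\<close> and \<open>y\<close> satisfy
  one of the conditions \<open>\<alpha>\<close>, \<open>\<beta>\<close> each, crosswise. If their
  join were also \<open>e\<close>, \<open>covered_eqI\<close> would identify them with
  \<open>a\<close> and \<open>b\<close>, so the second summand adds nothing then. In all other cases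
  the second summand contributes at most 1 and the first nothing positive.\<close>

lemma diamond_bump_other:
  fixes a b x y :: "'a::distrib_lattice"
  assumes ab: "diamond_pair a b" and xy: "diamond_pair x y" and ne: "{x, y} \<noteq> {a, b}"
  shows "diamond_bump a b (sup x y) + diamond_bump a b (inf x y) - (diamond_bump a b x + diamond_bump a b y) \<le> 1"
proof -
  define c e where "c = inf a b" and "e = sup a b"
  have cov: "covers a c" "covers b c" "covers e a" "covers e b" using ab by (auto simp: diamond_pair_def c_def e_def)
  define \<alpha> \<beta> where "\<alpha> z \<longleftrightarrow> a \<le> sup z c" and "\<beta> z \<longleftrightarrow> b \<le> sup z c" for z
  have le_e: "e \<le> sup z c \<longleftrightarrow> \<alpha> z \<and> \<beta> z" for z by (simp add: \<alpha>_def \<beta>_def e_def)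
  have ce: "c \<le> e" by (simp add: c_def e_def le_infI1)
  have S: "\<alpha> (sup x y) \<longleftrightarrow> \<alpha> x \<or> \<alpha> y" "\<beta> (sup x y) \<longleftrightarrow> \<beta> x \<or> \<beta> y" for x y
    unfolding \<alpha>_def \<beta>_def by (rule covers_prime[OF cov(1)], rule covers_prime[OF cov(2)])
  have I: "\<alpha> (inf x y) \<longleftrightarrow> \<alpha> x \<and> \<alpha> y" "\<beta> (inf x y) \<longleftrightarrow> \<beta> x \<and> \<beta> y" for x y
    unfolding \<alpha>_def \<beta>_def by (simp_all add: sup_inf_distrib2)
  have bump: "diamond_bump a b z = of_bool (\<alpha> z \<and> \<beta> z) + of_bool (z = e)" for z
    unfolding diamond_bump_def c_def[symmetric] e_def[symmetric] le_e ..
  have xy_ne: "inf x y \<noteq> sup x y"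
    using incomparable_sup_inf[OF diamond_pair_incomparable[OF xy]] by auto
  have cross: False
    if "\<alpha> x'" "\<not> \<beta> x'" "\<beta> y'" "\<not> \<alpha> y'" "{x', y'} = {x, y}" "sup x y = e" for x' y'
  proof -
    have "covers e x'" "covers e y'" using xy that(5,6) by (auto simp: diamond_pair_def doubleton_eq_iff)
    moreover have "sup x' c \<noteq> e" "sup y' c \<noteq> e" using that(1-4) le_e[of x'] le_e[of y'] by auto
    ultimately have "x' = a" "y' = b"
      using covered_eqI cov(3,4) ce that(1,3) unfolding \<alpha>_def \<beta>_def by metis+
    then show False using ne that(5) by simp
  qed
  have e: "\<alpha> e" "\<beta> e" using le_e[of e] by auto
  show ?thesis
  proof (cases "(\<alpha> x \<and> \<not> \<beta> x \<and> \<beta> y \<and> \<not> \<alpha> y) \<or> (\<alpha> y \<and> \<not> \<beta> y \<and> \<beta> x \<and> \<not> \<alpha> x)")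
    case True
    then have "sup x y \<noteq> e" using cross[of x y] cross[of y x] by auto
    moreover have "inf x y \<noteq> e" using True e I(1)[of x y] by auto
    ultimately show ?thesis using True unfolding bump S I by auto
  next
    case False
    have "of_bool (sup x y = e) + of_bool (inf x y = e) - (of_bool (x = e) + of_bool (y = e)) \<le> (1::real)"
      using xy_ne by auto
    then show ?thesis
      using False unfolding bump S I by (cases "\<alpha> x"; cases "\<alpha> y"; cases "\<beta> x"; cases "\<beta> y") simp_all
  qed
qed

text \<open>Half the squared depth contributes 1 on diamonds and 4 on special pairs. The bump takes
  away 2 on the given diamond, at most 1 on the others and at most 4 on special pairs.\<close>

lemma diamond_facet_function:
  fixes a b :: "'n::card2 plucker"
  assumes ab: "diamond_pair a b"
  defines "f \<equiv> \<lambda>z. real (depth z) ^ 2 / 2 - diamond_bump a b z"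
  shows "f (sup a b) + f (inf a b) < f a + f b"
    and "diamond_pair x y \<Longrightarrow> {x, y} \<noteq> {a, b} \<Longrightarrow> f x + f y \<le> f (sup x y) + f (inf x y)"
    and "special_diamond_pair x y \<Longrightarrow> f x + f y \<le> f (p1 x y) + f (q1 x y)"
  using depth_square_diamond[OF ab] depth_square_diamond[of x y] depth_square_special[of x y]
    diamond_bump_self[OF ab] diamond_bump_other[OF ab, of x y] diamond_bump_le[of a b "p1 x y" "q1 x y" x y]
  unfolding f_def by linarith+

text \<open>The second differences of \<open>excess\<close> along special diamonds vanish except for those with the same
  rows and entries as the given one; there they cancel the contribution of the depth.\<close>

definition excess :: "nat \<Rightarrow> nat \<Rightarrow> 'n::card2 plucker \<Rightarrow> real" where
  "excess z h x = of_nat (pcnt x z - Suc h)"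

text \<open>Join and meet merely permute the two counts at \<open>z\<close>, so every function of
  the count at \<open>z\<close> is modular.\<close>

lemma excess_modular: "excess z h (sup x y) + excess z h (inf x y) = excess z h x + excess z h y"
  by (auto simp: excess_def pcnt_sup pcnt_inf min_def max_def)

text \<open>The truncated subtraction is a convex function of the count with a kink at
  \<open>h + 1\<close>. At \<open>z = i + 1\<close> the counts are \<open>cnt S z\<close> plus 2 and
  0 on one side and plus 1 twice on the other, so the kink is seen when \<open>h = cnt S z\<close>;
  at every other \<open>z\<close> both sides have the same counts.\<close>

lemma excess_special:
  assumes q: "quad TYPE('n::card2) S i (Suc i) (Suc (Suc i)) (Suc (Suc (Suc i)))" and z: "z \<le> CARD('n)"
  shows "excess z h (pk2 S i (Suc i) :: 'n plucker) + excess z h (pk2 S (Suc (Suc i)) (Suc (Suc (Suc i))) :: 'n plucker) -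
    (excess z h (pk2 S (Suc i) (Suc (Suc i)) :: 'n plucker) + excess z h (pk2 S i (Suc (Suc (Suc i))) :: 'n plucker)) =
    of_bool (z = Suc i \<and> h = cnt S z)"
proof -
  note N = quad_pcnt[OF q _ _ _ z]
  have v: "pcnt (pk2 S i (Suc i) :: 'n plucker) z = cnt S z + of_bool (i \<le> z) + of_bool (Suc i \<le> z)"
    "pcnt (pk2 S (Suc (Suc i)) (Suc (Suc (Suc i))) :: 'n plucker) z =
      cnt S z + of_bool (Suc (Suc i) \<le> z) + of_bool (Suc (Suc (Suc i)) \<le> z)"
    "pcnt (pk2 S (Suc i) (Suc (Suc i)) :: 'n plucker) z = cnt S z + of_bool (Suc i \<le> z) + of_bool (Suc (Suc i) \<le> z)"
    "pcnt (pk2 S i (Suc (Suc (Suc i))) :: 'n plucker) z = cnt S z + of_bool (i \<le> z) + of_bool (Suc (Suc (Suc i)) \<le> z)"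
    by (rule N; simp)+
  consider "z < i" | "z = i" | "z = Suc i" | "z = Suc (Suc i)" | "Suc (Suc i) < z" by linarith
  then show ?thesis
  proof cases
    case 3
    consider "cnt S z < h" | "cnt S z = h" | "h < cnt S z" by linarith
    then show ?thesis unfolding excess_def v using 3 by cases (auto simp: of_nat_diff)
  qed (unfold excess_def v, simp_all)
qed

text \<open>Half the squared depth contributes 4 on special pairs, and 4 times the excess cancels
  this on those of the same position while being modular on diamonds. Subtracting the indicator of
  \<open>q1 a b\<close> then makes the given inequality fail. It costs at most 1 on diamonds, where
  1 is available, and at most 2 on special pairs of other positions, where 4 is available; for the
  same position it costs nothing unless the further terms share the column
  \<open>q1 a b\<close>.\<close>

lemma special_facet_function:
  fixes a b :: "'n::card2 plucker"
  assumes ab: "special_diamond_pair a b"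
  obtains f :: "'n plucker \<Rightarrow> real" where "f (p1 a b) + f (q1 a b) < f a + f b"
    "\<And>x y. diamond_pair x y \<Longrightarrow> f x + f y \<le> f (sup x y) + f (inf x y)"
    "\<And>x y. special_diamond_pair x y \<Longrightarrow>
      exchange_vector x y (p1 x y) (q1 x y) = exchange_vector a b (p1 a b) (q1 a b) \<or> f x + f y \<le> f (p1 x y) + f (q1 x y)"
proof -
  let ?q = "\<lambda>i. Suc (Suc i)" and ?r = "\<lambda>i. Suc (Suc (Suc i))"
  obtain S i where d: "quad TYPE('n) S i (Suc i) (?q i) (?r i)" "{a, b} = {pk2 S (Suc i) (?q i), pk2 S i (?r i)}"
    "p1 a b = pk2 S i (Suc i)" "q1 a b = pk2 S (?q i) (?r i)"
    "\<And>f :: 'n plucker \<Rightarrow> real. f a + f b = f (pk2 S (Suc i) (?q i)) + f (pk2 S i (?r i))"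
    using special_diamond_pair_data[OF ab] by metis
  define h where "h = cnt S (Suc i)"
  have z: "Suc i \<le> CARD('n)" using d(1) by (simp add: quad_def)
  define f where "f x = real (depth x) ^ 2 / 2 - 4 * excess (Suc i) h x - of_bool (x = q1 a b)" for x :: "'n plucker"
  have special: "f x + f y = f (p1 x y) + f (q1 x y) - (4 - 4 * of_bool (i' = i \<and> h = cnt S' (Suc i))
      - (of_bool (p1 x y = q1 a b) + of_bool (q1 x y = q1 a b) - (of_bool (x = q1 a b) + of_bool (y = q1 a b))))"
    if xy: "special_diamond_pair x y" and d': "quad TYPE('n) S' i' (Suc i') (?q i') (?r i')"
      "p1 x y = pk2 S' i' (Suc i')" "q1 x y = pk2 S' (?q i') (?r i')"
      "\<And>f :: 'n plucker \<Rightarrow> real. f x + f y = f (pk2 S' (Suc i') (?q i')) + f (pk2 S' i' (?r i'))" for x y S' i'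
  proof -
    have "excess (Suc i) h (p1 x y) + excess (Suc i) h (q1 x y) - (excess (Suc i) h x + excess (Suc i) h y) =
        of_bool (i' = i \<and> h = cnt S' (Suc i))"
      using excess_special[OF d'(1) z, of h] unfolding d'(2,3) d'(4)[of "excess (Suc i) h"] by auto
    then show ?thesis using depth_square_special[OF xy] unfolding f_def by (simp add: field_simps)
  qed
  show ?thesis
  proof (rule that[of f])
    have "p1 a b < q1 a b" "a \<noteq> q1 a b" "b \<noteq> q1 a b"
    proof -
      note L = quad_lattice[OF d(1)]
      have lt: "inf a b < a" "inf a b < b" "a < sup a b" "b < sup a b"
        using ab incomparable_sup_inf diamond_pair_incomparable unfolding special_diamond_pair_def by blast+
      have "sup a b < q1 a b" using ab by (simp add: special_diamond_pair_def covers_def)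
      then show "a \<noteq> q1 a b" "b \<noteq> q1 a b" using lt by auto
      show "p1 a b < q1 a b" unfolding d(3,4)
        using L(4,5) incomparable_sup_inf[OF L(3)] by (blast intro: less_trans)
    qed
    then show "f (p1 a b) + f (q1 a b) < f a + f b"
      using special[OF ab d(1,3,4,5)] by (auto simp: h_def)
    show "f x + f y \<le> f (sup x y) + f (inf x y)" if xy: "diamond_pair x y" for x y
    proof -
      have "inf x y \<noteq> sup x y"
        using incomparable_sup_inf[OF diamond_pair_incomparable[OF xy]] by auto
      then have "of_bool (sup x y = q1 a b) + of_bool (inf x y = q1 a b) - (of_bool (x = q1 a b) + of_bool (y = q1 a b)) \<le> (1::real)"
        by auto
      then show ?thesis
        using depth_square_diamond[OF xy] excess_modular[of "Suc i" h x y] unfolding f_def by linarith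
    qed
    show "exchange_vector x y (p1 x y) (q1 x y) = exchange_vector a b (p1 a b) (q1 a b) \<or> f x + f y \<le> f (p1 x y) + f (q1 x y)"
      if xy: "special_diamond_pair x y" for x y
    proof -
      obtain S' i' where d': "quad TYPE('n) S' i' (Suc i') (?q i') (?r i')" "{x, y} = {pk2 S' (Suc i') (?q i'), pk2 S' i' (?r i')}"
        "p1 x y = pk2 S' i' (Suc i')" "q1 x y = pk2 S' (?q i') (?r i')"
        "\<And>f :: 'n plucker \<Rightarrow> real. f x + f y = f (pk2 S' (Suc i') (?q i')) + f (pk2 S' i' (?r i'))"
        using special_diamond_pair_data[OF xy] by metis
      note sp = special[OF xy d'(1,3,4,5)]
      show ?thesis
      proof (cases "i' = i \<and> h = cnt S' (Suc i)")
        case False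
        then show ?thesis using sp by auto
      next
        case True
        then have i': "i' = i" by simp
        have "pcnt (p1 x y) (Suc i) = Suc (Suc h)" "pcnt (q1 a b) (Suc i) = h"
          using quad_pcnt[OF d'(1) _ _ _ z, of i' "Suc i'"] quad_pcnt[OF d(1) _ _ _ z, of "?q i" "?r i"] True
          by (auto simp: d(4) d'(3) h_def)
        then have p: "p1 x y \<noteq> q1 a b" by auto
        show ?thesis
        proof (cases "q1 x y = q1 a b")
          case False
          then show ?thesis using sp p True by auto
        next
          case True
          \<comment> \<open>Equality of the columns \<open>q1\<close> gives equality of
            \<open>S\<close> and \<open>S'\<close> only up to the element \<open>n + 1\<close>,
            which \<open>pk\<close> drops anyway; thus all four columns of both pairs agree.\<close>
          have ps: "pk_set TYPE('n) (insert (?q i) (insert (?r i) S))" "pk_set TYPE('n) (insert (?q i) (insert (?r i) S'))"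
            using quad_pk_set[OF d(1), of "?q i" "?r i"] quad_pk_set[OF d'(1), of "?q i'" "?r i'"] i' by auto
          have "insert (?q i) (insert (?r i) S) - {Suc CARD('n)} = insert (?q i) (insert (?r i) S') - {Suc CARD('n)}"
            using True set_indices_pk[OF ps(1)] set_indices_pk[OF ps(2)] unfolding d(4) d'(4) i' by simp
          moreover have "X - {Suc CARD('n)} = (insert (?q i) (insert (?r i) X) - {Suc CARD('n)}) - {?q i, ?r i}"
            if "?q i \<notin> X" "?r i \<notin> X" for X
            using that by auto
          moreover have "?q i \<notin> S" "?r i \<notin> S" "?q i \<notin> S'" "?r i \<notin> S'"
            using d(1) d'(1) i' by (auto simp: quad_def)
          ultimately have "S - {Suc CARD('n)} = S' - {Suc CARD('n)}" by metis
          moreover have "insert u (insert v X) - {Suc CARD('n)} = insert u (insert v (X - {Suc CARD('n)})) - {Suc CARD('n)}" for u v X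
            by auto
          ultimately have "pk2 S u v = (pk2 S' u v :: 'n plucker)" for u v
            unfolding pk_def by metis
          then show ?thesis using d(2-4) d'(2-4) i' by (intro disjI1 exchange_vector_cong) simp_all
        qed
      qed
    qed
  qed
qed

theorem theorem3p18:
  fixes C :: "(real ^ ('n::card2) plucker) set"
  defines "C \<equiv> groebner_cone plucker_ideal incomparable_ideal"
  shows "C = {w. (\<forall>a b. diamond_pair a b \<longrightarrow> w $ a + w $ b < w $ sup a b + w $ inf a b) \<and>
                 (\<forall>a b. special_diamond_pair a b \<longrightarrow> w $ a + w $ b < w $ p1 a b + w $ q1 a b)} \<and>
         (\<forall>a b. diamond_pair a b \<longrightarrow>
            {w \<in> closure C. w $ a + w $ b = w $ sup a b + w $ inf a b} facet_of closure C) \<and>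
         (\<forall>a b. special_diamond_pair a b \<longrightarrow>
            {w \<in> closure C. w $ a + w $ b = w $ p1 a b + w $ q1 a b} facet_of closure C)"
proof -
  \<comment> \<open>A set of vectors identifies the inequalities of \<open>(a, b)\<close> and
    \<open>(b, a)\<close>, so that a point can violate exactly one member.\<close>
  define L where "L = {exchange_vector a b (sup a b) (inf a b) |a b :: 'n plucker. diamond_pair a b} \<union>
    {exchange_vector a b (p1 a b) (q1 a b) |a b :: 'n plucker. special_diamond_pair a b}"
  have C_eq: "C = {w. (\<forall>a b. diamond_pair a b \<longrightarrow> w $ a + w $ b < w $ sup a b + w $ inf a b) \<and>
      (\<forall>a b. special_diamond_pair a b \<longrightarrow> w $ a + w $ b < w $ p1 a b + w $ q1 a b)}"
    unfolding C_def by (rule groebner_cone_eq)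
  have "exchange_vector a b p q \<in> range (\<lambda>(a, b, p, q). exchange_vector a b p q)" for a b p q :: "'n plucker"
    by (rule range_eqI[of _ _ "(a, b, p, q)"]) simp
  then have "L \<subseteq> range (\<lambda>(a, b, p, q). exchange_vector a b p q)" unfolding L_def by blast
  then have fin: "finite L" by (rule finite_subset) simp
  have CL: "C = {w. \<forall>l\<in>L. 0 < l \<bullet> w}"
  proof -
    have "w $ a + w $ b < w $ p + w $ q \<longleftrightarrow> 0 < exchange_vector a b p q \<bullet> w" for w :: "real ^ 'n plucker" and a b p q
      by (simp add: inner_exchange_vector)
    then show ?thesis unfolding C_eq L_def by blast
  qed
  have w0: "interior_weight \<in> C"
    unfolding C_def groebner_cone_iff using strict_at_interior_weight diamond_pair_incomparable by blast
  note facet = facet_of_polyhedral_cone[OF fin CL w0]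
  have dia: "{w \<in> closure C. w $ a + w $ b = w $ sup a b + w $ inf a b} facet_of closure C"
    if ab: "diamond_pair a b" for a b
  proof -
    note F = diamond_facet_function[OF ab]
    let ?l = "exchange_vector a b (sup a b) (inf a b)"
    let ?v = "\<chi> z. real (depth z) ^ 2 / 2 - diamond_bump a b z"
    have "{w \<in> closure C. ?l \<bullet> w = 0} facet_of closure C"
    proof (rule facet[where v = ?v])
      show "?l \<in> L" using ab by (auto simp: L_def)
      show "?l \<bullet> ?v < 0" using F(1) by (simp add: inner_exchange_vector)
      fix l assume "l \<in> L"
      then consider x y where "diamond_pair x y" "l = exchange_vector x y (sup x y) (inf x y)"
        | x y where "special_diamond_pair x y" "l = exchange_vector x y (p1 x y) (q1 x y)"
        unfolding L_def by blast
      then show "l = ?l \<or> 0 \<le> l \<bullet> ?v"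
      proof cases
        case 1
        show ?thesis
        proof (cases "{x, y} = {a, b}")
          case True
          then have "sup x y = sup a b" "inf x y = inf a b"
            by (auto simp: doubleton_eq_iff sup_commute inf_commute)
          then show ?thesis using True unfolding 1(2) by (intro disjI1 exchange_vector_cong) simp_all
        next
          case False
          then show ?thesis using F(2)[OF 1(1)] by (simp add: 1(2) inner_exchange_vector)
        qed
      next
        case 2
        then show ?thesis using F(3)[OF 2(1)] by (simp add: inner_exchange_vector)
      qed
    qed
    moreover have "{w \<in> closure C. w $ a + w $ b = w $ sup a b + w $ inf a b} = {w \<in> closure C. ?l \<bullet> w = 0}"
      by (auto simp: inner_exchange_vector)
    ultimately show ?thesis by simp
  qed
  have spec: "{w \<in> closure C. w $ a + w $ b = w $ p1 a b + w $ q1 a b} facet_of closure C"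
    if ab: "special_diamond_pair a b" for a b
  proof -
    let ?l = "exchange_vector a b (p1 a b) (q1 a b)"
    obtain f :: "'n plucker \<Rightarrow> real" where f: "f (p1 a b) + f (q1 a b) < f a + f b"
      "\<And>x y. diamond_pair x y \<Longrightarrow> f x + f y \<le> f (sup x y) + f (inf x y)"
      "\<And>x y. special_diamond_pair x y \<Longrightarrow>
        exchange_vector x y (p1 x y) (q1 x y) = ?l \<or> f x + f y \<le> f (p1 x y) + f (q1 x y)"
      by (rule special_facet_function[OF ab]) blast
    have "{w \<in> closure C. ?l \<bullet> w = 0} facet_of closure C"
    proof (rule facet[where v = "\<chi> z. f z"])
      show "?l \<in> L" using ab by (auto simp: L_def)
      show "?l \<bullet> (\<chi> z. f z) < 0" using f(1) by (simp add: inner_exchange_vector)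
      fix l assume "l \<in> L"
      then consider x y where "diamond_pair x y" "l = exchange_vector x y (sup x y) (inf x y)"
        | x y where "special_diamond_pair x y" "l = exchange_vector x y (p1 x y) (q1 x y)"
        unfolding L_def by blast
      then show "l = ?l \<or> 0 \<le> l \<bullet> (\<chi> z. f z)"
      proof cases
        case 1
        then show ?thesis using f(2)[OF 1(1)] by (simp add: inner_exchange_vector)
      next
        case 2
        then show ?thesis using f(3)[OF 2(1)] by (auto simp: inner_exchange_vector)
      qed
    qed
    moreover have "{w \<in> closure C. w $ a + w $ b = w $ p1 a b + w $ q1 a b} = {w \<in> closure C. ?l \<bullet> w = 0}"
      by (auto simp: inner_exchange_vector)
    ultimately show ?thesis by simp
  qed
  show ?thesis using C_eq dia spec by blast
qed

end
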